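(* Let $\mathcal{Y}\subset\mathbb{R}^m$ be closed, $G\in\mathbb{S}[\boldsymbol{x},\boldsymbol{y}]^q$, $\mathcal{X}=\{\boldsymbol{x}\in\mathbb{R}^n\mid G(\boldsymbol{x},\boldsymbol{y})\succeq 0,\ \forall\boldsymbol{y}\in\mathcal{Y}\}$, and let $\nu$ be a Borel measure on $\mathbb{R}^m$ with $\mathrm{supp}(\nu)=\mathcal{Y}$, $\int_{\mathcal{Y}}|h|\,\mathrm{d}\nu<\infty$ for all $h\in\mathbb{R}[\boldsymbol{y}]$, and $\sum_{d=1}^{\infty}\left(\int_{\mathcal{Y}}y_j^{2d}\,\mathrm{d}\nu(\boldsymbol{y})\right)^{-\frac{1}{2d}}=\infty$ for every $j\in\{1,\ldots,m\}$. Let $\boldsymbol{c}\in\mathbb{R}^r$, $\Lambda_0,\ldots,\Lambda_r\in\mathbb{S}[\boldsymbol{x}]^p$, $\Lambda(\boldsymbol{x},\gamma)=\Lambda_0(\boldsymbol{x})-\sum_{i=1}^r\Lambda_i(\boldsymbol{x})\gamma_i$, and $$\tau^\star=\inf_{\gamma\in\mathbb{R}^r}\{\boldsymbol{c}^{\intercal}\gamma\mid\Lambda(\boldsymbol{x},\gamma)\succeq 0,\ \forall\boldsymbol{x}\in\mathcal{X}\}.\qquad(\ast)$$ For $\varepsilon>0$ and $\ell\in\mathbb{N}$ with $\ell\ge\max\{d_\Lambda,d_G,\lceil\deg_{\boldsymbol{y}}G/2\rceil\}$, let $\tau_\varepsilon(\ell,\ell)$ be the infimum of $\boldsymbol{c}^{\intercal}\gamma$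 over all $\gamma\in\mathbb{R}^r$ for which there exist SOS matrices $S_0\in\mathbb{S}[\boldsymbol{x}]^p$, $S\in\mathbb{S}[\boldsymbol{x},\boldsymbol{y}]^{pq}$ with $$\theta^{\ell-d_\Lambda}\left(\Lambda(\boldsymbol{x},\gamma)+\varepsilon\theta^{d_\Lambda}I_p\right)=S_0(\boldsymbol{x})+\int_{\mathcal{Y}}\langle S(\boldsymbol{x},\boldsymbol{y}),G(\boldsymbol{x},\boldsymbol{y})\rangle_p\,\mathrm{d}\nu(\boldsymbol{y}),$$ $\deg S_0\le 2\ell$, $\deg_{\boldsymbol{x}}S\le 2(\ell-d_G)$, $\deg_{\boldsymbol{y}}S\le 2(\ell-\lceil\deg_{\boldsymbol{y}}G/2\rceil)$, where $\theta=1+\Vert\boldsymbol{x}\Vert^2$. Then the limit $$\tau_0(\infty,\infty):=\lim_{\varepsilon\to 0}\lim_{\ell\to\infty}\tau_\varepsilon(\ell,\ell)$$ exists and $\tau_0(\infty,\infty)\le\tau^\star$. Moreover, if the set $\mathcal{S}$ of optimal solutions of $(\ast)$ is nonempty and bounded, then $\tau_0(\infty,\infty)=\tau^\star$.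
   Context: $\boldsymbol{x}=(x_1,\ldots,x_n)$, $\boldsymbol{y}=(y_1,\ldots,y_m)$. $\mathbb{S}[\cdot]^q$ denotes $q\times q$ symmetric matrices with real polynomial entries in the indicated variables; $\deg,\deg_{\boldsymbol{x}},\deg_{\boldsymbol{y}}$ of a polynomial matrix are the maxima over entries of the total degree, the total degree in $\boldsymbol{x}$, the total degree in $\boldsymbol{y}$. $d_G:=\max_{i,j}\lfloor\deg_{\boldsymbol{x}}(G_{ij})/2\rfloor+1$ and $d_\Lambda:=\max_{i,j}\lfloor\deg_{\boldsymbol{x}}(\Lambda_{ij})/2\rfloor+1$, where the entries $\Lambda_{ij}$ are viewed as polynomials in $(\boldsymbol{x},\gamma)$. Infima and limits are taken in $[-\infty,+\infty]$, with $\inf\emptyset=+\infty$; $\varepsilon\to0$ means $\varepsilon\downarrow 0$. The optimal solutions of $(\ast)$ are the feasible $\gamma$ with $\boldsymbol{c}^{\intercal}\gamma=\tau^\star$. An $r\times r$ SOS matrix is one of the form $T^{\intercal}T$ with $T$ an $l\times r$ real polynomial matrix in the same variables, $l\in\mathbb{N}$. For $A\in\mathbb{R}^{pq\times pq}$, $B\in\mathbb{R}^{q\times q}$, $\langle A,B\rangle_p:=\mathrm{tr}_p(A^{\intercal}(I_p\otimes B))\in\mathbb{R}^{p\times p}$, where for $C=[C_{ij}]_{i,j=1}^p$ with blocks $C_{ij}\in\mathbb{R}^{q\times q}$, $\mathrm{tr}_p(C):=[\mathrm{tr}(C_{ij})]_{i,j=1}^p$; the same definition is used for polynomial matrices. For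 $H(\boldsymbol{x},\boldsymbol{y})=\sum_\beta H_\beta(\boldsymbol{x})\boldsymbol{y}^\beta$, $\int_{\mathcal{Y}}H\,\mathrm{d}\nu(\boldsymbol{y}):=\sum_\beta H_\beta(\boldsymbol{x})\int_{\mathcal{Y}}\boldsymbol{y}^\beta\,\mathrm{d}\nu(\boldsymbol{y})$. *)

theory Defs
  imports "HOL-Analysis.Analysis" "HOL-Library.Poly_Mapping"
begin

text \<open>
  Real polynomials in finitely many variables indexed by a type: finitely supported maps
  from exponent vectors to coefficients, with the convolution product of Poly_Mapping.
  Joint polynomials in two groups of variables use a sum type as index type.
\<close>

type_synonym 'v rpoly = "('v \<Rightarrow>\<^sub>0 nat) \<Rightarrow>\<^sub>0 real"

definition Const :: "real \<Rightarrow> 'v rpoly" where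
  "Const a = Poly_Mapping.single 0 a"

definition Var :: "'v \<Rightarrow> 'v rpoly" where
  "Var v = Poly_Mapping.single (Poly_Mapping.single v 1) 1"

definition mono_eval :: "('v::finite \<Rightarrow> 'a::comm_ring_1) \<Rightarrow> ('v \<Rightarrow>\<^sub>0 nat) \<Rightarrow> 'a" where
  "mono_eval f t = (\<Prod>v\<in>UNIV. f v ^ Poly_Mapping.lookup t v)"

definition peval :: "('v::finite \<Rightarrow> real) \<Rightarrow> 'v rpoly \<Rightarrow> real" where
  "peval f p = (\<Sum>t\<in>Poly_Mapping.keys p. Poly_Mapping.lookup p t * mono_eval f t)"

definition psubst :: "('v::finite \<Rightarrow> 'w rpoly) \<Rightarrow> 'v rpoly \<Rightarrow> 'w rpoly" where
  "psubst f p = (\<Sum>t\<in>Poly_Mapping.keys p. Const (Poly_Mapping.lookup p t) * mono_eval f t)"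

text \<open>Total degree in the variables of \<open>V\<close>; the zero polynomial is given degree 0.\<close>

definition deg_in :: "'v set \<Rightarrow> 'v rpoly \<Rightarrow> nat" where
  "deg_in V p = Max (insert 0 ((\<lambda>t. \<Sum>v\<in>V. Poly_Mapping.lookup t v) ` Poly_Mapping.keys p))"

definition map_matrix :: "('a \<Rightarrow> 'b) \<Rightarrow> 'a^'c^'d \<Rightarrow> 'b^'c^'d" where
  "map_matrix f A = (\<chi> i j. f (A $ i $ j))"

definition mdeg_in :: "'v set \<Rightarrow> 'v rpoly^'c^'d \<Rightarrow> nat" where
  "mdeg_in V A = Max (range (\<lambda>(i, j). deg_in V (A $ i $ j)))"

text \<open>The maximum over the entries of \<open>\<lfloor>deg / 2\<rfloor> + 1\<close>, as used for \<open>d_G\<close> and \<open>d_\<Lambda>\<close>.\<close>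

definition half_deg_in :: "'v set \<Rightarrow> 'v rpoly^'c^'d \<Rightarrow> nat" where
  "half_deg_in V A = Max (range (\<lambda>(i, j). deg_in V (A $ i $ j) div 2)) + 1"

definition psd_matrix :: "real^'k^'k \<Rightarrow> bool" where
  "psd_matrix A \<longleftrightarrow> transpose A = A \<and> (\<forall>v. 0 \<le> v \<bullet> (A *v v))"

text \<open>
  \<open>S = T\<^sup>T T\<close> for some \<open>l \<times> r\<close> polynomial matrix \<open>T\<close>. The number \<open>l\<close> is
  existentially quantified, hence \<open>T\<close> is given by its rows \<open>T 0, \<dots>, T (l - 1)\<close>.
\<close>

definition sos_matrix :: "'v rpoly^'k^'k \<Rightarrow> bool" where
  "sos_matrix S \<longleftrightarrow>
     (\<exists>(l::nat) (T :: nat \<Rightarrow> 'v rpoly^'k). S = (\<chi> i j. \<Sum>k<l. T k $ i * T k $ j))"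

text \<open>
  A \<open>pq \<times> pq\<close> matrix is indexed by pairs: entry \<open>((i, k), (j, l))\<close> is entry \<open>(k, l)\<close> of
  the block \<open>(i, j)\<close>.
\<close>

definition kron :: "'a::times^'p::finite^'p \<Rightarrow> 'a^'q::finite^'q \<Rightarrow> 'a^('p \<times> 'q)^('p \<times> 'q)" where
  "kron A B = (\<chi> a b. A $ fst a $ fst b * B $ snd a $ snd b)"

definition block_trace :: "'a::semiring_1^('p::finite \<times> 'q::finite)^('p \<times> 'q) \<Rightarrow> 'a^'p^'p" where
  "block_trace C = (\<chi> i j. trace (\<chi> k l. C $ (i, k) $ (j, l)))"

definition block_inner ::
  "'a::semiring_1^('p::finite \<times> 'q::finite)^('p \<times> 'q) \<Rightarrow> 'a^'q^'q \<Rightarrow> 'a^'p^'p" where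
  "block_inner A B = block_trace (transpose A ** kron (mat 1) B)"

definition pscale :: "'v rpoly \<Rightarrow> 'v rpoly^'k^'k \<Rightarrow> 'v rpoly^'k^'k" where
  "pscale a A = map_matrix (\<lambda>b. a * b) A"

text \<open>
  For \<open>h = \<Sum>\<^sub>\<beta> h\<^sub>\<beta>(x) y\<^sup>\<beta>\<close>, \<open>y_coeff h \<beta>\<close> is \<open>h\<^sub>\<beta>(x)\<close>; \<open>map_key Inl\<close> and
  \<open>map_key Inr\<close> split a joint exponent vector into its \<open>x\<close>- and \<open>y\<close>-part.
\<close>

definition y_coeff :: "('n + 'm) rpoly \<Rightarrow> ('m \<Rightarrow>\<^sub>0 nat) \<Rightarrow> 'n rpoly" where
  "y_coeff h \<beta> = (\<Sum>t\<in>{t \<in> Poly_Mapping.keys h. Poly_Mapping.map_key Inr t = \<beta>}.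
     Poly_Mapping.single (Poly_Mapping.map_key Inl t) (Poly_Mapping.lookup h t))"

definition y_integral ::
  "(real^'m::finite) measure \<Rightarrow> (real^'m) set \<Rightarrow> ('n + 'm) rpoly \<Rightarrow> 'n rpoly" where
  "y_integral \<nu> Y h = (\<Sum>\<beta>\<in>Poly_Mapping.map_key Inr ` Poly_Mapping.keys h.
     y_coeff h \<beta> * Const (LINT y:Y|\<nu>. mono_eval (($) y) \<beta>))"

definition measure_support :: "'a::topological_space measure \<Rightarrow> 'a set" where
  "measure_support \<nu> = {y. \<forall>U. open U \<and> y \<in> U \<longrightarrow> emeasure \<nu> U > 0}"

text \<open>
  The sum is taken in \<open>[0, \<infinity>]\<close>, where \<open>inverse 0 = \<infinity>\<close>, so that a vanishing even moment
  makes the series diverge. The index is shifted: \<open>d\<close> here is \<open>d - 1\<close> in the usual form.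
\<close>

definition carleman :: "(real^'m::finite) measure \<Rightarrow> (real^'m) set \<Rightarrow> 'm \<Rightarrow> bool" where
  "carleman \<nu> Y j \<longleftrightarrow>
     suminf (\<lambda>d. inverse (ennreal
        ((LINT y:Y|\<nu>. (y $ j) ^ (2 * Suc d)) powr (1 / real (2 * Suc d))))) = \<infinity>"

definition feasible_x ::
  "(real^'m::finite) set \<Rightarrow> ('n::finite + 'm) rpoly^'q^'q \<Rightarrow> (real^'n) set" where
  "feasible_x Y G = {x. \<forall>y\<in>Y. psd_matrix (map_matrix (peval (case_sum (($) x) (($) y))) G)}"

definition Lam ::
  "'n rpoly^'p^'p \<Rightarrow> ('r::finite \<Rightarrow> 'n rpoly^'p^'p) \<Rightarrow> real^'r \<Rightarrow> 'n rpoly^'p^'p" where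
  "Lam \<Lambda>\<^sub>0 \<Lambda> \<gamma> = \<Lambda>\<^sub>0 - (\<Sum>i\<in>UNIV. pscale (Const (\<gamma> $ i)) (\<Lambda> i))"

text \<open>The same matrix with \<open>\<gamma>\<close> as indeterminates; only used to define \<open>d_\<Lambda>\<close>.\<close>

definition Lam_joint ::
  "'n::finite rpoly^'p^'p \<Rightarrow> ('r::finite \<Rightarrow> 'n rpoly^'p^'p) \<Rightarrow> ('n + 'r) rpoly^'p^'p" where
  "Lam_joint \<Lambda>\<^sub>0 \<Lambda> =
     (let embed = map_matrix (psubst (\<lambda>i. Var (Inl i)))
      in embed \<Lambda>\<^sub>0 - (\<Sum>i\<in>UNIV. pscale (Var (Inr i)) (embed (\<Lambda> i))))"

definition d_Lam :: "'n::finite rpoly^'p^'p \<Rightarrow> ('r::finite \<Rightarrow> 'n rpoly^'p^'p) \<Rightarrow> nat" where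
  "d_Lam \<Lambda>\<^sub>0 \<Lambda> = half_deg_in (range Inl) (Lam_joint \<Lambda>\<^sub>0 \<Lambda>)"

definition d_G :: "('n::finite + 'm::finite) rpoly^'q^'q \<Rightarrow> nat" where
  "d_G G = half_deg_in (range Inl) G"

definition half_deg_y :: "('n::finite + 'm::finite) rpoly^'q^'q \<Rightarrow> nat" where
  "half_deg_y G = nat \<lceil>real (mdeg_in (range Inr) G) / 2\<rceil>"

definition theta :: "'n::finite rpoly" where
  "theta = 1 + (\<Sum>i\<in>UNIV. Var i ^ 2)"

definition feasible_gamma ::
  "(real^'n::finite) set \<Rightarrow> 'n rpoly^'p^'p \<Rightarrow> ('r::finite \<Rightarrow> 'n rpoly^'p^'p) \<Rightarrow> (real^'r) set" where
  "feasible_gamma X \<Lambda>\<^sub>0 \<Lambda> =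
     {\<gamma>. \<forall>x\<in>X. psd_matrix (map_matrix (peval (($) x)) (Lam \<Lambda>\<^sub>0 \<Lambda> \<gamma>))}"

definition tau_star ::
  "(real^'n::finite) set \<Rightarrow> real^'r::finite \<Rightarrow> 'n rpoly^'p^'p \<Rightarrow> ('r \<Rightarrow> 'n rpoly^'p^'p) \<Rightarrow> ereal" where
  "tau_star X c \<Lambda>\<^sub>0 \<Lambda> = (INF \<gamma>\<in>feasible_gamma X \<Lambda>\<^sub>0 \<Lambda>. ereal (c \<bullet> \<gamma>))"

definition optimal_gamma ::
  "(real^'n::finite) set \<Rightarrow> real^'r::finite \<Rightarrow> 'n rpoly^'p^'p \<Rightarrow> ('r \<Rightarrow> 'n rpoly^'p^'p)
     \<Rightarrow> (real^'r) set" where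
  "optimal_gamma X c \<Lambda>\<^sub>0 \<Lambda> =
     {\<gamma> \<in> feasible_gamma X \<Lambda>\<^sub>0 \<Lambda>. ereal (c \<bullet> \<gamma>) = tau_star X c \<Lambda>\<^sub>0 \<Lambda>}"

text \<open>
  The SOS relaxation is meaningful for \<open>l \<ge> max {d_Lam, d_G, half_deg_y}\<close> only; below that
  bound the subtractions truncate. An SOS matrix is symmetric by its definition.
\<close>

definition relaxed_gamma ::
  "(real^'m::finite) measure \<Rightarrow> (real^'m) set \<Rightarrow> ('n::finite + 'm) rpoly^'q::finite^'q
     \<Rightarrow> 'n rpoly^'p::finite^'p \<Rightarrow> ('r::finite \<Rightarrow> 'n rpoly^'p^'p) \<Rightarrow> real \<Rightarrow> nat \<Rightarrow> (real^'r) set" where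
  "relaxed_gamma \<nu> Y G \<Lambda>\<^sub>0 \<Lambda> \<epsilon> l =
     {\<gamma>. \<exists>(S\<^sub>0 :: 'n rpoly^'p^'p) (S :: ('n + 'm) rpoly^('p \<times> 'q)^('p \<times> 'q)).
        sos_matrix S\<^sub>0 \<and> sos_matrix S \<and>
        pscale (theta ^ (l - d_Lam \<Lambda>\<^sub>0 \<Lambda>))
            (Lam \<Lambda>\<^sub>0 \<Lambda> \<gamma> + pscale (Const \<epsilon> * theta ^ d_Lam \<Lambda>\<^sub>0 \<Lambda>) (mat 1))
          = S\<^sub>0 + map_matrix (y_integral \<nu> Y) (block_inner S G) \<and>
        mdeg_in UNIV S\<^sub>0 \<le> 2 * l \<and>
        mdeg_in (range Inl) S \<le> 2 * (l - d_G G) \<and>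
        mdeg_in (range Inr) S \<le> 2 * (l - half_deg_y G)}"

definition tau_relaxed ::
  "(real^'m::finite) measure \<Rightarrow> (real^'m) set \<Rightarrow> ('n::finite + 'm) rpoly^'q::finite^'q \<Rightarrow> real^'r::finite
     \<Rightarrow> 'n rpoly^'p::finite^'p \<Rightarrow> ('r \<Rightarrow> 'n rpoly^'p^'p) \<Rightarrow> real \<Rightarrow> nat \<Rightarrow> ereal" where
  "tau_relaxed \<nu> Y G c \<Lambda>\<^sub>0 \<Lambda> \<epsilon> l =
     (INF \<gamma>\<in>relaxed_gamma \<nu> Y G \<Lambda>\<^sub>0 \<Lambda> \<epsilon> l. ereal (c \<bullet> \<gamma>))"

end

theory Submission
  imports Defs
begin

text \<open>
  A certificate at level \<open>l\<close>, multiplied by \<open>\<theta>\<close>, is a certificate at level \<open>l + 1\<close>, and adding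
  the sum of squares \<open>(\<epsilon>' - \<epsilon>) \<theta>\<^sup>l I\<close> turns a certificate for \<open>\<epsilon>\<close> into one for \<open>\<epsilon>' \<ge> \<epsilon>\<close>.
  So the relaxed values decrease in \<open>l\<close>, their limits increase as \<open>\<epsilon>\<close> decreases to \<open>0\<close>, and the
  iterated limit exists. It remains to compare it with the optimal value from both sides.

  Upper bound. Let \<open>P = \<Lambda>(x, \<gamma>)\<close> be positive semidefinite on \<open>X\<close>. A certificate for
  \<open>P + \<epsilon> \<theta>\<^sup>d I\<close> is needed at some level (lemma \<open>positivstellensatz\<close>). Since \<open>deg P < 2 d\<close>, the
  quotient \<open>P / \<theta>\<^sup>d\<close> tends to \<open>0\<close> at infinity, so that \<open>P / \<theta>\<^sup>d + \<epsilon> I\<close> is definite outside a ball,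
  and also near every point of \<open>X\<close>. For a point \<open>x\<^sub>0\<close> outside \<open>X\<close> there are a polynomial \<open>p\<close> in \<open>y\<close>
  and a vector \<open>v\<close> such that \<open>g(x) = \<integral> p(y)\<^sup>2 v\<^sup>T G(x, y) v d\<nu>\<close> is negative at \<open>x\<^sub>0\<close>
  (\<open>exists_separator\<close>); by compactness finitely many such \<open>g\<close> suffice (\<open>finite_separation\<close>).
  For \<open>g\<close> scaled to \<open>\<bar>g\<bar> \<le> \<theta>\<^sup>e\<close>, the admissible term \<open>c (\<theta>\<^sup>e - g)\<^sup>2\<^sup>k g\<close> is very negative where \<open>g\<close>
  is negative, and its positive values are only of relative size \<open>c / k\<close>. Subtracting these terms leaves a
  matrix polynomial \<open>Q \<ge> \<delta> \<theta>\<^sup>L I\<close> on the whole space, and \<open>\<theta>\<^sup>N Q\<close> is a sum of squares for some \<open>N\<close>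
  by a matrix version of Reznick's theorem (\<open>matrix_reznick\<close>).

  The polynomial \<open>p\<close> comes from an approximation argument. If \<open>w(y) = v\<^sup>T G(x\<^sub>0, y) v\<close> is negative at
  a point of the support of \<open>\<nu>\<close>, then the integral of \<open>w\<close> against a narrow Gaussian \<open>f\<^sup>2\<close> around this
  point is negative, and \<open>f\<close> is a limit of polynomials in \<open>L\<^sup>2(\<bar>w\<bar> d\<nu>)\<close>. A Gaussian is a limit of
  products of cosines, and a cosine is a limit of polynomials because the pairing
  \<open>t \<mapsto> \<langle>cos(t y\<^sub>j + b), h\<rangle>\<close> with a function \<open>h\<close> orthogonal to the polynomials is quasi-analytic: all
  its derivatives vanish at \<open>0\<close>, and Carleman's condition bounds them so that Bang's proof of the
  Denjoy-Carleman theorem makes it vanish identically (\<open>bang\<close>, \<open>cos_dense\<close>).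

  Lower bound. Evaluating a certificate on \<open>X\<close> shows that \<open>\<Lambda>(x, \<gamma>) + \<epsilon> \<theta>\<^sup>d I\<close> is positive
  semidefinite there. These conditions define closed convex sets of \<open>\<gamma>\<close> which shrink to the feasible
  set as \<open>\<epsilon>\<close> decreases to \<open>0\<close>, and if the set of optimal solutions is nonempty and bounded, the infimum
  of a linear function over them converges to its infimum over the feasible set (\<open>perturbed_infimum\<close>).
\<close>

section \<open>Polynomials as functions\<close>

lemma mono_eval_zero [simp]: "mono_eval f 0 = 1"
  by (simp add: mono_eval_def)

lemma mono_eval_add: "mono_eval f (s + t) = mono_eval f s * mono_eval f t"
  by (simp add: mono_eval_def lookup_add power_add prod.distrib)

lemma mono_eval_single [simp]: "mono_eval f (Poly_Mapping.single v n) = f v ^ n"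
proof -
  have "mono_eval f (Poly_Mapping.single v n) = (\<Prod>w\<in>UNIV. if w = v then f v ^ n else 1)"
    unfolding mono_eval_def by (rule prod.cong) (auto simp: lookup_single when_def)
  then show ?thesis by simp
qed

lemma peval_superset:
  assumes "finite A" "Poly_Mapping.keys p \<subseteq> A"
  shows "peval f p = (\<Sum>t\<in>A. Poly_Mapping.lookup p t * mono_eval f t)"
  unfolding peval_def by (rule sum.mono_neutral_left) (use assms in \<open>auto simp: in_keys_iff\<close>)

lemma peval_zero [simp]: "peval f 0 = 0"
  by (simp add: peval_def)

lemma peval_add [simp]: "peval f (p + q) = peval f p + peval f q"
proof -
  let ?A = "Poly_Mapping.keys p \<union> Poly_Mapping.keys q"
  have "peval f (p + q) = (\<Sum>t\<in>?A. Poly_Mapping.lookup (p + q) t * mono_eval f t)"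
    by (rule peval_superset) (auto dest: subsetD[OF keys_add])
  also have "\<dots> = (\<Sum>t\<in>?A. Poly_Mapping.lookup p t * mono_eval f t)
      + (\<Sum>t\<in>?A. Poly_Mapping.lookup q t * mono_eval f t)"
    by (simp add: lookup_add distrib_right sum.distrib)
  finally show ?thesis
    by (simp add: peval_superset[symmetric])
qed

lemma peval_single [simp]: "peval f (Poly_Mapping.single t a) = a * mono_eval f t"
  by (cases "a = 0") (simp_all add: peval_def)

lemma peval_sum [simp]: "peval f (sum p I) = (\<Sum>i\<in>I. peval f (p i))"
  by (induction I rule: infinite_finite_induct) auto

lemma rpoly_monomials: "p = (\<Sum>t\<in>Poly_Mapping.keys p. Poly_Mapping.single t (Poly_Mapping.lookup p t))"
  by (rule poly_mapping_eqI) (auto simp: lookup_sum lookup_single when_def in_keys_iff sum.delta)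

lemma peval_mult [simp]: "peval f (p * q) = peval f p * peval f q"
proof -
  have "p * q = (\<Sum>s\<in>Poly_Mapping.keys p. \<Sum>t\<in>Poly_Mapping.keys q.
      Poly_Mapping.single (s + t) (Poly_Mapping.lookup p s * Poly_Mapping.lookup q t))"
    by (subst (1) rpoly_monomials[of p], subst (1) rpoly_monomials[of q])
      (simp add: sum_product mult_single)
  then show ?thesis
    by (simp add: peval_def[of _ p] peval_def[of _ q] sum_product mono_eval_add mult.assoc
        mult.left_commute[of "mono_eval f _"])
qed

lemma peval_one [simp]: "peval f 1 = 1"
  by (metis mono_eval_zero mult_1 peval_single single_one)

lemma peval_uminus [simp]: "peval f (- p) = - peval f p"
  by (metis add_eq_0_iff peval_add peval_zero)

lemma peval_diff [simp]: "peval f (p - q) = peval f p - peval f q"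
  by (metis peval_add peval_uminus uminus_add_conv_diff add.commute)

lemma peval_power [simp]: "peval f (p ^ n) = peval f p ^ n"
  by (induction n) auto

lemma peval_prod [simp]: "peval f (prod p I) = (\<Prod>i\<in>I. peval f (p i))"
  by (induction I rule: infinite_finite_induct) auto

lemma peval_Const [simp]: "peval f (Const a) = a"
  by (simp add: Const_def)

lemma peval_Var [simp]: "peval f (Var v) = f v"
  by (simp add: Var_def)

lemma peval_mono_eval [simp]: "peval g (mono_eval f t) = mono_eval (\<lambda>v. peval g (f v)) t"
  by (simp add: mono_eval_def)

lemma peval_psubst [simp]: "peval g (psubst f p) = peval (\<lambda>v. peval g (f v)) p"
  by (simp add: psubst_def peval_def[of "\<lambda>v. peval g (f v)"])

text \<open>
  Induction on the variables: for fixed values of the others, the sum is a univariate polynomial in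
  the new variable \<open>w\<close> that vanishes identically, so the terms with each exponent of \<open>w\<close> already
  cancel.
\<close>

lemma monomials_independent:
  fixes c :: "('v \<Rightarrow> nat) \<Rightarrow> real"
  assumes "finite V" "finite T" "\<And>x. (\<Sum>t\<in>T. c t * (\<Prod>v\<in>V. x v ^ t v)) = 0"
  shows "(\<Sum>t\<in>{t\<in>T. \<forall>v\<in>V. t v = \<tau> v}. c t) = 0"
  using assms
proof (induction V arbitrary: T rule: finite_induct)
  case empty
  then show ?case by simp
next
  case (insert w V)
  define B where "B = Max (insert 0 ((\<lambda>t. t w) ` T))"
  have B: "t w \<le> B" if "t \<in> T" for t
    using that insert.prems(1) unfolding B_def by (intro Max_ge) auto
  define T' where "T' = {t\<in>T. t w = \<tau> w}"
  have "(\<Sum>t\<in>T'. c t * (\<Prod>v\<in>V. x v ^ t v)) = 0" for x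
  proof -
    define d where "d k = (\<Sum>t\<in>{t\<in>T. t w = k}. c t * (\<Prod>v\<in>V. x v ^ t v))" for k
    have "(\<Sum>k\<le>B. d k * z ^ k) = 0" for z
    proof -
      have split: "(\<Prod>v\<in>insert w V. (x(w := z)) v ^ t v) = (\<Prod>v\<in>V. x v ^ t v) * z ^ t w" for t
      proof -
        have "(\<Prod>v\<in>V. (x(w := z)) v ^ t v) = (\<Prod>v\<in>V. x v ^ t v)"
          using insert.hyps by (intro prod.cong) auto
        then show ?thesis using insert.hyps by (simp add: mult.commute)
      qed
      have "(\<Sum>k\<le>B. d k * z ^ k)
          = (\<Sum>k\<le>B. \<Sum>t\<in>{t\<in>T. t w = k}. c t * (\<Prod>v\<in>insert w V. (x(w := z)) v ^ t v))"
        unfolding d_def split sum_distrib_right by (intro sum.cong) (auto simp: mult.assoc)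
      also have "\<dots> = (\<Sum>t\<in>T. c t * (\<Prod>v\<in>insert w V. (x(w := z)) v ^ t v))"
        using insert.prems(1) B by (intro sum.group) auto
      also have "\<dots> = 0" by (rule insert.prems(2))
      finally show ?thesis .
    qed
    then have "\<forall>k\<le>B. d k = 0"
      using polyfun_eq_0[of d B] by blast
    moreover have "d (\<tau> w) = 0" if "\<not> \<tau> w \<le> B"
    proof -
      have "{t\<in>T. t w = \<tau> w} = {}" using that B by force
      then show ?thesis by (simp only: d_def sum.empty)
    qed
    ultimately have "d (\<tau> w) = 0" by blast
    then show ?thesis unfolding d_def T'_def .
  qed
  then have "(\<Sum>t\<in>{t\<in>T'. \<forall>v\<in>V. t v = \<tau> v}. c t) = 0"
    using insert.prems(1) by (intro insert.IH) (auto simp: T'_def)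
  moreover have "{t\<in>T'. \<forall>v\<in>V. t v = \<tau> v} = {t\<in>T. \<forall>v\<in>insert w V. t v = \<tau> v}"
    unfolding T'_def by auto
  ultimately show ?case by simp
qed

text \<open>
  Polynomial identities can therefore be checked by evaluation, which reduces them to identities
  between real numbers.
\<close>

lemma rpoly_eqI:
  fixes p q :: "'v::finite rpoly"
  assumes "\<And>x. peval x p = peval x q"
  shows "p = q"
proof (rule poly_mapping_eqI)
  fix \<tau> :: "'v \<Rightarrow>\<^sub>0 nat"
  define r where "r = p - q"
  define T where "T = Poly_Mapping.lookup ` Poly_Mapping.keys r"
  have inj: "inj_on Poly_Mapping.lookup A" for A :: "('v \<Rightarrow>\<^sub>0 nat) set"
    by (simp add: inj_on_def)
  have "(\<Sum>t\<in>T. Poly_Mapping.lookup r (Abs_poly_mapping t) * (\<Prod>v\<in>UNIV. x v ^ t v)) = 0" for x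
    using assms[of x] peval_diff[of x p q] unfolding T_def r_def[symmetric]
    by (simp add: sum.reindex[OF inj] o_def peval_def[of x r] mono_eval_def)
  then have "(\<Sum>t\<in>{t\<in>T. \<forall>v\<in>UNIV. t v = Poly_Mapping.lookup \<tau> v}.
      Poly_Mapping.lookup r (Abs_poly_mapping t)) = 0"
    by (intro monomials_independent) (auto simp: T_def)
  moreover have "{t\<in>T. \<forall>v\<in>UNIV. t v = Poly_Mapping.lookup \<tau> v}
      = (if \<tau> \<in> Poly_Mapping.keys r then {Poly_Mapping.lookup \<tau>} else {})"
    by (auto simp: T_def fun_eq_iff[symmetric] poly_mapping_eq_iff[symmetric])
  ultimately have "Poly_Mapping.lookup r \<tau> = 0"
    by (auto split: if_splits simp: in_keys_iff)
  then show "Poly_Mapping.lookup p \<tau> = Poly_Mapping.lookup q \<tau>"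
    by (simp add: r_def lookup_minus)
qed

section \<open>Degrees and growth\<close>

definition vdeg :: "'v set \<Rightarrow> ('v \<Rightarrow>\<^sub>0 nat) \<Rightarrow> nat" where
  "vdeg V t = (\<Sum>v\<in>V. Poly_Mapping.lookup t v)"

lemma vdeg_add: "vdeg V (s + t) = vdeg V s + vdeg V t"
  by (simp add: vdeg_def lookup_add sum.distrib)

lemma deg_in_le_iff: "deg_in V p \<le> d \<longleftrightarrow> (\<forall>t\<in>Poly_Mapping.keys p. vdeg V t \<le> d)"
  unfolding deg_in_def vdeg_def by (subst Max_le_iff) auto

lemma deg_in_zero [simp]: "deg_in V 0 = 0"
  by (simp add: deg_in_def)

lemma deg_in_add_le:
  assumes "deg_in V p \<le> d" "deg_in V q \<le> d"
  shows "deg_in V (p + q) \<le> d"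
  using assms keys_add[of p q] unfolding deg_in_le_iff by blast

lemma deg_in_uminus [simp]: "deg_in V (- p :: 'v rpoly) = deg_in V p"
proof -
  have "Poly_Mapping.keys (- p) = Poly_Mapping.keys p"
    by (auto simp: in_keys_iff)
  then show ?thesis by (simp add: deg_in_def)
qed

lemma deg_in_diff_le:
  assumes "deg_in V p \<le> d" "deg_in V q \<le> d"
  shows "deg_in V (p - q) \<le> d"
  using deg_in_add_le[of V p d "- q"] assms by simp

lemma deg_in_sum_le:
  assumes "\<And>i. i \<in> I \<Longrightarrow> deg_in V (p i) \<le> d"
  shows "deg_in V (sum p I) \<le> d"
  using assms by (induction I rule: infinite_finite_induct) (auto intro: deg_in_add_le)

lemma deg_in_mult_le:
  assumes "deg_in V p \<le> d" "deg_in V q \<le> e" "d + e \<le> n"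
  shows "deg_in V (p * q) \<le> n"
  unfolding deg_in_le_iff
proof
  fix t assume "t \<in> Poly_Mapping.keys (p * q)"
  then obtain a b where "t = a + b" "a \<in> Poly_Mapping.keys p" "b \<in> Poly_Mapping.keys q"
    using keys_mult[of p q] by blast
  then show "vdeg V t \<le> n"
    using assms unfolding deg_in_le_iff by (fastforce simp: vdeg_add)
qed

lemma deg_in_Const [simp]: "deg_in V (Const a) = 0"
  using deg_in_le_iff[of V "Const a" 0] by (simp add: Const_def vdeg_def)

lemma deg_in_one [simp]: "deg_in V 1 = 0"
  using deg_in_Const[of V 1] by (simp add: Const_def)

lemma deg_in_Var_le:
  fixes V :: "'v::finite set"
  shows "deg_in V (Var v) \<le> (if v \<in> V then 1 else 0)"
  unfolding deg_in_le_iff by (auto simp: Var_def vdeg_def lookup_single when_def)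

lemma deg_in_power_le:
  assumes "deg_in V p \<le> d" "d * n \<le> m"
  shows "deg_in V (p ^ n) \<le> m"
proof -
  have "deg_in V (p ^ n) \<le> d * n"
    by (induction n) (use assms(1) in \<open>auto intro: deg_in_mult_le\<close>)
  with assms(2) show ?thesis by simp
qed

lemma deg_in_prod_le:
  assumes "\<And>i. i \<in> I \<Longrightarrow> deg_in V (p i) \<le> d i"
  shows "deg_in V (prod p I) \<le> sum d I"
  using assms by (induction I rule: infinite_finite_induct) (auto intro: deg_in_mult_le)

lemma mdeg_in_le_iff:
  "mdeg_in V (M :: 'v rpoly^'c::finite^'d::finite) \<le> d \<longleftrightarrow> (\<forall>i j. deg_in V (M $ i $ j) \<le> d)"
  unfolding mdeg_in_def by (subst Max_le_iff) (auto simp: split_beta)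

text \<open>
  The strict inequality is what makes a matrix \<open>M\<close> negligible against \<open>\<theta>\<^sup>d\<close> at infinity, for
  \<open>d\<close> its half degree.
\<close>

lemma deg_in_less_half_deg_in:
  "deg_in V ((M :: 'v rpoly^'c::finite^'d::finite) $ i $ j) < 2 * half_deg_in V M"
proof -
  have "deg_in V (M $ i $ j) div 2 \<le> Max (range (\<lambda>(i, j). deg_in V (M $ i $ j) div 2))"
    by (rule Max_ge) (auto intro!: image_eqI[where x = "(i, j)"])
  moreover have "a < 2 * (m + 1)" if "a div 2 \<le> m" for a m :: nat
    using that by presburger
  ultimately show ?thesis unfolding half_deg_in_def by blast
qed

lemma deg_in_psubst_le:
  fixes V :: "'v::finite set"
  assumes "\<And>v. deg_in W (f v) \<le> (if v \<in> V then 1 else 0)" "deg_in V p \<le> d"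
  shows "deg_in W (psubst f p) \<le> d"
  unfolding psubst_def
proof (rule deg_in_sum_le)
  fix t assume t: "t \<in> Poly_Mapping.keys p"
  have "deg_in W (mono_eval f t) \<le> (\<Sum>v\<in>UNIV. if v \<in> V then Poly_Mapping.lookup t v else 0)"
    unfolding mono_eval_def using assms(1)
    by (intro deg_in_prod_le deg_in_power_le[OF assms(1)]) auto
  also have "\<dots> = vdeg V t"
    by (simp add: vdeg_def sum.If_cases)
  finally have "deg_in W (mono_eval f t) \<le> d"
    using assms(2) t unfolding deg_in_le_iff by fastforce
  then show "deg_in W (Const (Poly_Mapping.lookup p t) * mono_eval f t) \<le> d"
    by (intro deg_in_mult_le[of _ _ 0]) auto
qed

lemma peval_theta: "peval x (theta :: 'n::finite rpoly) = 1 + (\<Sum>i\<in>UNIV. (x i)\<^sup>2)"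
  by (simp add: theta_def)

lemma peval_theta_vec: "peval (($) x) theta = 1 + (norm (x :: real^'n::finite))\<^sup>2"
  by (simp add: peval_theta norm_vec_def L2_set_def real_sqrt_pow2 sum_nonneg)

lemma theta_ge_1: "1 \<le> peval x theta"
  by (simp add: peval_theta sum_nonneg)

lemma theta_pos: "0 < peval x theta"
  using theta_ge_1[of x] by linarith

lemma deg_in_theta: "deg_in V (theta :: 'n::finite rpoly) \<le> 2"
  unfolding theta_def
proof (intro deg_in_add_le deg_in_sum_le)
  show "deg_in V ((Var i)\<^sup>2) \<le> 2" for i
    by (rule deg_in_power_le[of _ _ 1]) (use deg_in_Var_le[of V i] in \<open>auto split: if_splits\<close>)
qed auto

lemma abs_mono_eval_le:
  fixes x :: "'v::finite \<Rightarrow> real"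
  assumes "\<And>v. \<bar>x v\<bar> \<le> r" "1 \<le> r" "vdeg UNIV t \<le> d"
  shows "\<bar>mono_eval x t\<bar> \<le> r ^ d"
proof -
  have "\<bar>mono_eval x t\<bar> = (\<Prod>v\<in>UNIV. \<bar>x v\<bar> ^ Poly_Mapping.lookup t v)"
    using prod_norm[of "\<lambda>v. x v ^ Poly_Mapping.lookup t v" UNIV] by (simp add: mono_eval_def power_abs)
  also have "\<dots> \<le> (\<Prod>v\<in>UNIV. r ^ Poly_Mapping.lookup t v)"
    by (intro prod_mono) (auto intro: power_mono assms)
  also have "\<dots> = r ^ vdeg UNIV t"
    by (simp add: vdeg_def power_sum)
  also have "\<dots> \<le> r ^ d"
    using assms by (intro power_increasing)
  finally show ?thesis .
qed

text \<open>
  Every coordinate is bounded by \<open>\<surd>\<theta>\<close>, so a monomial of degree at most \<open>d\<close> is bounded by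
  \<open>(\<surd>\<theta>)\<^sup>d\<close>.
\<close>

lemma peval_growth:
  fixes p :: "'n::finite rpoly"
  assumes "deg_in UNIV p \<le> d"
  obtains B where "B \<ge> 0" "\<And>x. \<bar>peval x p\<bar> \<le> B * sqrt (peval x theta) ^ d"
proof
  define B where "B = (\<Sum>t\<in>Poly_Mapping.keys p. \<bar>Poly_Mapping.lookup p t\<bar>)"
  show "B \<ge> 0" by (simp add: B_def sum_nonneg)
  show "\<bar>peval x p\<bar> \<le> B * sqrt (peval x theta) ^ d" for x
  proof -
    have le: "\<bar>x v\<bar> \<le> sqrt (peval x theta)" for v
    proof -
      have "(x v)\<^sup>2 \<le> (\<Sum>i\<in>UNIV. (x i)\<^sup>2)"
        by (rule member_le_sum) auto
      then show ?thesis
        by (intro real_le_rsqrt) (simp add: peval_theta)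
    qed
    have "\<bar>peval x p\<bar> \<le> (\<Sum>t\<in>Poly_Mapping.keys p. \<bar>Poly_Mapping.lookup p t\<bar> * \<bar>mono_eval x t\<bar>)"
      unfolding peval_def by (rule order.trans[OF sum_abs]) (simp add: abs_mult)
    also have "\<dots> \<le> (\<Sum>t\<in>Poly_Mapping.keys p. \<bar>Poly_Mapping.lookup p t\<bar> * sqrt (peval x theta) ^ d)"
      using assms theta_ge_1[of x] le unfolding deg_in_le_iff
      by (intro sum_mono mult_left_mono abs_mono_eval_le) auto
    finally show ?thesis by (simp add: B_def sum_distrib_right)
  qed
qed

lemma continuous_on_peval [continuous_intros]:
  assumes "\<And>v. continuous_on S (\<lambda>x. f x v)"
  shows "continuous_on S (\<lambda>x. peval (f x) p)"
  unfolding peval_def mono_eval_def using assms by (intro continuous_intros)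

lemma abs_mult_le_sum_squares:
  fixes u :: "'k::finite \<Rightarrow> real"
  shows "\<bar>u i * u j\<bar> \<le> (\<Sum>i\<in>UNIV. (u i)\<^sup>2)"
proof -
  have "(u k)\<^sup>2 \<le> (\<Sum>i\<in>UNIV. (u i)\<^sup>2)" for k by (rule member_le_sum) auto
  from this[of i] this[of j] show ?thesis
    using sum_squares_bound[of "\<bar>u i\<bar>" "\<bar>u j\<bar>"] by (simp add: abs_mult)
qed

lemma quadratic_form_scalar:
  fixes u :: "'k::finite \<Rightarrow> real"
  shows "(\<Sum>i\<in>UNIV. \<Sum>j\<in>UNIV. u i * u j * (r * (if i = j then 1 else 0))) = r * (\<Sum>i\<in>UNIV. (u i)\<^sup>2)"
proof -
  have "(\<Sum>j\<in>UNIV. u i * u j * (r * (if i = j then 1 else 0))) = r * (u i)\<^sup>2" for i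
  proof -
    have "(\<Sum>j\<in>UNIV. u i * u j * (r * (if i = j then 1 else 0))) = (\<Sum>j\<in>UNIV. if i = j then u i * u j * r else 0)"
      by (rule sum.cong) auto
    then show ?thesis by (simp add: power2_eq_square)
  qed
  then show ?thesis by (simp add: sum_distrib_left)
qed

section \<open>Sums of squares\<close>

definition sos :: "'v rpoly \<Rightarrow> bool" where
  "sos p \<longleftrightarrow> (\<exists>(l::nat) T. p = (\<Sum>k<l. T k * T k))"

text \<open>
  SOS matrices are the finite sums of these; all closure properties below are obtained by
  adding and scaling such summands.
\<close>

definition rank_one :: "'v rpoly^'k \<Rightarrow> 'v rpoly^'k^'k" where
  "rank_one T = (\<chi> i j. T $ i * T $ j)"

lemma sos_matrix_iff: "sos_matrix S \<longleftrightarrow> (\<exists>(l::nat) T. S = (\<Sum>k<l. rank_one (T k)))"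
  unfolding sos_matrix_def by (simp add: rank_one_def vec_eq_iff)

lemma sos_matrix_zero [simp]: "sos_matrix 0"
  unfolding sos_matrix_iff by (rule exI[of _ 0]) simp

lemma sos_matrix_add_rank_one:
  assumes "sos_matrix S"
  shows "sos_matrix (S + rank_one T)"
proof -
  obtain l :: nat and U where "S = (\<Sum>k<l. rank_one (U k))"
    using assms unfolding sos_matrix_iff by blast
  then have "S + rank_one T = (\<Sum>k<Suc l. rank_one ((U(l := T)) k))"
    by simp
  then show ?thesis unfolding sos_matrix_iff by blast
qed

lemma sos_matrix_rank_one: "sos_matrix (rank_one T)"
  using sos_matrix_add_rank_one[of 0 T] by simp

lemma sos_matrix_add:
  assumes "sos_matrix S" "sos_matrix R"
  shows "sos_matrix (S + R)"
proof -
  obtain l :: nat and U where R: "R = (\<Sum>k<l. rank_one (U k))"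
    using assms unfolding sos_matrix_iff by blast
  have "sos_matrix (S + (\<Sum>k<l. rank_one (U k)))"
  proof (induction l)
    case (Suc l)
    then show ?case using sos_matrix_add_rank_one by (simp add: add.assoc[symmetric])
  qed (use assms in simp)
  then show ?thesis by (simp add: R)
qed

lemma sos_matrix_sum:
  assumes "\<And>i. i \<in> I \<Longrightarrow> sos_matrix (S i)"
  shows "sos_matrix (sum S I)"
  using assms by (induction I rule: infinite_finite_induct) (auto intro: sos_matrix_add)

lemma pscale_nth [simp]: "pscale a M $ i $ j = a * M $ i $ j"
  by (simp add: pscale_def map_matrix_def)

lemma map_matrix_nth [simp]: "map_matrix f M $ i $ j = f (M $ i $ j)"
  by (simp add: map_matrix_def)

lemma rank_one_nth [simp]: "rank_one T $ i $ j = T $ i * T $ j"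
  by (simp add: rank_one_def)

lemma sos_matrix_pscale:
  assumes "sos p" "sos_matrix S"
  shows "sos_matrix (pscale p S)"
proof -
  obtain l :: nat and T where p: "p = (\<Sum>k<l. T k * T k)"
    using assms unfolding sos_def by blast
  obtain m :: nat and U where S: "S = (\<Sum>k<m. rank_one (U k))"
    using assms unfolding sos_matrix_iff by blast
  have "pscale p S = (\<Sum>k<l. \<Sum>h<m. rank_one (\<chi> i. T k * U h $ i))"
    by (simp add: vec_eq_iff p S sum_product mult.assoc mult.left_commute[of "T _" "U _ $ _"])
  then show ?thesis by (simp add: sos_matrix_sum sos_matrix_rank_one)
qed

lemma sos_square: "sos (p * p)" "sos (p\<^sup>2)"
proof -
  have "p * p = (\<Sum>k<Suc 0. p * p)" by simp
  then show "sos (p * p)" unfolding sos_def by (intro exI[of _ "Suc 0"] exI[of _ "\<lambda>_. p"])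
  then show "sos (p\<^sup>2)" by (simp add: power2_eq_square)
qed

lemma sos_zero: "sos 0"
  unfolding sos_def by (intro exI[of _ 0]) simp

lemma sos_add:
  assumes "sos p" "sos q"
  shows "sos (p + q)"
proof -
  obtain l :: nat and T where p: "p = (\<Sum>k<l. T k * T k)"
    using assms unfolding sos_def by blast
  obtain m :: nat and U where q: "q = (\<Sum>k<m. U k * U k)"
    using assms unfolding sos_def by blast
  have "sos (p + (\<Sum>k<m. U k * U k))"
  proof (induction m)
    case 0
    then show ?case using assms by simp
  next
    case (Suc m)
    then obtain l :: nat and T where "p + (\<Sum>k<m. U k * U k) = (\<Sum>k<l. T k * T k)"
      unfolding sos_def by blast
    then have "p + (\<Sum>k<Suc m. U k * U k) = (\<Sum>k<Suc l. (T(l := U m)) k * (T(l := U m)) k)"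
      by (simp add: add.assoc[symmetric])
    then show ?case unfolding sos_def by blast
  qed
  then show ?thesis by (simp add: q)
qed

lemma sos_one: "sos 1"
  using sos_square(1)[of 1] by simp

lemma sos_sum:
  assumes "\<And>i. i \<in> I \<Longrightarrow> sos (p i)"
  shows "sos (sum p I)"
  using assms by (induction I rule: infinite_finite_induct) (auto intro: sos_add sos_zero)

lemma sos_mult:
  assumes "sos p" "sos q"
  shows "sos (p * q)"
proof -
  obtain l :: nat and T where p: "p = (\<Sum>k<l. T k * T k)"
    using assms unfolding sos_def by blast
  obtain m :: nat and U where q: "q = (\<Sum>k<m. U k * U k)"
    using assms unfolding sos_def by blast
  have "p * q = (\<Sum>k<l. \<Sum>h<m. (T k * U h)\<^sup>2)"
    by (simp add: p q sum_product power2_eq_square ac_simps)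
  then show ?thesis by (simp add: sos_sum sos_square)
qed

lemma sos_power: "sos p \<Longrightarrow> sos (p ^ n)"
  by (induction n) (auto intro: sos_mult sos_one)

lemma Const_mult: "Const (a * b) = Const a * Const b"
  by (simp add: Const_def mult_single)

lemma Const_add: "Const (a + b) = Const a + Const b"
  by (simp add: Const_def single_add)

lemma sos_Const: "0 \<le> a \<Longrightarrow> sos (Const a)"
  using sos_square(1)[of "Const (sqrt a)"] by (simp add: Const_mult[symmetric])

lemma sos_theta: "sos (theta :: 'n::finite rpoly)"
  unfolding theta_def by (intro sos_add sos_one sos_sum sos_square)

lemma sos_theta_minus: "sos (theta - (Var i)\<^sup>2 :: 'n::finite rpoly)"
proof -
  have "theta - (Var i)\<^sup>2 = 1 + (\<Sum>k\<in>UNIV - {i}. (Var k)\<^sup>2 :: 'n rpoly)"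
    unfolding theta_def by (subst sum.remove[of UNIV i]) auto
  then show ?thesis by (simp add: sos_add sos_one sos_sum sos_square)
qed

lemma sos_theta_minus_one: "sos (theta - 1 :: 'n::finite rpoly)"
  by (simp add: theta_def sos_sum sos_square)

lemma sos_matrix_mat_one: "sos_matrix (mat 1 :: 'v rpoly^'k::finite^'k)"
proof -
  have "(mat 1 :: 'v rpoly^'k^'k) = (\<Sum>h\<in>UNIV. rank_one (\<chi> i. if i = h then 1 else 0))"
    by (auto simp: vec_eq_iff mat_def if_distrib[of "\<lambda>x. x * _"] cong: if_cong)
  then show ?thesis by (simp add: sos_matrix_sum sos_matrix_rank_one)
qed

text \<open>
  Cholesky's algorithm, by induction on the support \<open>I\<close> of the form: a pivot \<open>a p p > 0\<close> splits off
  the square of row \<open>p\<close>, and a zero pivot forces the whole row to vanish.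
\<close>

lemma psd_form_sum_of_squares:
  fixes a :: "'k::finite \<Rightarrow> 'k \<Rightarrow> real"
  assumes "\<And>i j. a i j = a j i" "\<And>v. 0 \<le> (\<Sum>i\<in>UNIV. \<Sum>j\<in>UNIV. v i * v j * a i j)"
    and "finite I" "\<And>i j. i \<notin> I \<Longrightarrow> a i j = 0"
  shows "\<exists>(l::nat) t. \<forall>i j. a i j = (\<Sum>k<l. t k i * t k j)"
  using assms(3,1,2,4)
proof (induction I arbitrary: a rule: finite_induct)
  case empty
  then show ?case by (intro exI[of _ 0]) simp
next
  case (insert p I)
  note sym = insert.prems(1) and pos = insert.prems(2) and supp = insert.prems(3)
  have two: "(\<Sum>i\<in>UNIV. \<Sum>j\<in>UNIV. (if i = p then s else v i) * (if j = p then s else v j) * b i j)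
      = s\<^sup>2 * b p p + 2 * s * (\<Sum>i\<in>UNIV - {p}. v i * b i p)
        + (\<Sum>i\<in>UNIV - {p}. \<Sum>j\<in>UNIV - {p}. v i * v j * b i j)"
    if "\<And>i j. b i j = b j i" for s :: real and v b
  proof -
    let ?w = "\<lambda>i. if i = p then s else v i" and ?R = "UNIV - {p}"
    have split: "sum g UNIV = g p + sum g ?R" for g :: "'k \<Rightarrow> real"
      by (rule sum.remove) auto
    have "(\<Sum>j\<in>UNIV. ?w p * ?w j * b p j) = s\<^sup>2 * b p p + s * (\<Sum>i\<in>?R. v i * b i p)"
    proof -
      have "(\<Sum>j\<in>?R. ?w p * ?w j * b p j) = (\<Sum>j\<in>?R. s * (v j * b j p))"
        by (rule sum.cong) (use that[of p] in auto)
      then show ?thesis by (subst split) (simp add: power2_eq_square sum_distrib_left)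
    qed
    moreover have "(\<Sum>j\<in>UNIV. ?w i * ?w j * b i j) = s * (v i * b i p) + (\<Sum>j\<in>?R. v i * v j * b i j)"
      if "i \<in> ?R" for i
    proof -
      have "(\<Sum>j\<in>?R. ?w i * ?w j * b i j) = (\<Sum>j\<in>?R. v i * v j * b i j)"
        by (rule sum.cong) (use that in auto)
      then show ?thesis using that by (subst split) simp
    qed
    then have "(\<Sum>i\<in>?R. \<Sum>j\<in>UNIV. ?w i * ?w j * b i j)
        = (\<Sum>i\<in>?R. s * (v i * b i p) + (\<Sum>j\<in>?R. v i * v j * b i j))"
      by (rule sum.cong[OF refl])
    ultimately show ?thesis
      by (simp only: split[of "\<lambda>i. \<Sum>j\<in>UNIV. ?w i * ?w j * b i j"] sum.distrib
          sum_distrib_left[symmetric])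
  qed
  show ?case
  proof (cases "a p p = 0")
    case True
    have "a i p = 0" for i
    proof (rule ccontr)
      assume nz: "a i p \<noteq> 0"
      then have ip: "i \<noteq> p" using True by auto
      \<comment> \<open>The test vector with entry s at p and 1 at i gives the form the value - 1.\<close>
      define s where "s = - (a i i + 1) / (2 * a i p)"
      have "0 \<le> (\<Sum>h\<in>UNIV. \<Sum>j\<in>UNIV. (if h = p then s else if h = i then 1 else 0)
          * (if j = p then s else if j = i then 1 else 0) * a h j)"
        by (rule pos)
      also have "\<dots> = 2 * s * a i p + a i i"
      proof -
        have single: "(\<Sum>h\<in>UNIV - {p}. (if h = i then 1 else 0) * g h) = g i" for g :: "'k \<Rightarrow> real"
        proof -
          have "(\<Sum>h\<in>UNIV - {p}. (if h = i then 1 else 0) * g h)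
              = (\<Sum>h\<in>UNIV - {p}. if h = i then g h else 0)"
            by (rule sum.cong) auto
          then show ?thesis using ip by simp
        qed
        have "(\<Sum>h\<in>UNIV - {p}. \<Sum>j\<in>UNIV - {p}. (if h = i then 1 else 0) * (if j = i then 1 else 0) * a h j) = a i i"
          by (simp only: mult.assoc sum_distrib_left[symmetric] single)
        then show ?thesis
          using True by (subst two[OF sym]) (simp only: single)
      qed
      finally have "0 \<le> 2 * s * a i p + a i i" .
      moreover have "2 * s * a i p = - (a i i + 1)" using nz by (simp add: s_def)
      ultimately show False by simp
    qed
    then have "a p i = 0" for i
      using sym[of p i] by simp
    then have "a i j = 0" if "i \<notin> I" for i j
      using that supp[of i j] by (cases "i = p") simp_all
    from insert.IH[OF sym pos this] show ?thesis .
  next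
    case False
    have "0 \<le> (\<Sum>h\<in>UNIV. \<Sum>j\<in>UNIV. (if h = p then 1 else 0) * (if j = p then 1 else 0) * a h j)"
      by (rule pos)
    then have "a p p \<ge> 0"
      using two[where b = a and s = 1 and v = "\<lambda>_. 0", OF sym]
      by (simp only: mult_zero_left sum.neutral_const mult_zero_right add_0_right power_one mult_1_left)
    with False have app: "a p p > 0" by simp
    define b where "b i j = a i j - a i p * a j p / a p p" for i j
    have bsym: "b i j = b j i" for i j
      unfolding b_def by (subst sym) (simp add: mult.commute)
    have bp: "b i p = 0" for i using app by (simp add: b_def)
    then have bp': "b p i = 0" for i using bsym[of p i] by simp
    have bpos: "0 \<le> (\<Sum>i\<in>UNIV. \<Sum>j\<in>UNIV. v i * v j * b i j)" for v
    proof -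
      define s where "s = - (\<Sum>i\<in>UNIV - {p}. v i * a i p) / a p p"
      have "(\<Sum>i\<in>UNIV. \<Sum>j\<in>UNIV. v i * v j * b i j)
          = (\<Sum>i\<in>UNIV - {p}. \<Sum>j\<in>UNIV - {p}. v i * v j * b i j)"
      proof -
        have w: "(if i = p then v p else v i) = v i" for i by simp
        from two[where b = b and s = "v p" and v = v, OF bsym]
        show ?thesis unfolding w bp by simp
      qed
      also have "\<dots> = (\<Sum>i\<in>UNIV - {p}. \<Sum>j\<in>UNIV - {p}. v i * v j * a i j)
          - (\<Sum>i\<in>UNIV - {p}. v i * a i p)\<^sup>2 / a p p"
      proof -
        have "v i * v j * b i j = v i * v j * a i j - (v i * a i p) * (v j * a j p) / a p p" for i j
          by (simp add: b_def right_diff_distrib)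
        then show ?thesis
          by (simp only: sum_subtractf power2_eq_square sum_product sum_divide_distrib)
      qed
      also have "\<dots> = (\<Sum>i\<in>UNIV. \<Sum>j\<in>UNIV. (if i = p then s else v i) * (if j = p then s else v j) * a i j)"
      proof -
        define A where "A = (\<Sum>i\<in>UNIV - {p}. v i * a i p)"
        have "s * a p p = - A" using app by (simp add: s_def A_def)
        then have "s\<^sup>2 * a p p + 2 * s * A = s * A"
          by (simp add: power2_eq_square mult.assoc)
        also have "\<dots> = - (A\<^sup>2 / a p p)" by (simp add: s_def A_def power2_eq_square)
        finally show ?thesis by (subst two[OF sym]) (simp add: A_def)
      qed
      also have "\<dots> \<ge> 0" by (rule pos)
      finally show ?thesis .
    qed
    have "b i j = 0" if "i \<notin> I" for i j
    proof (cases "i = p")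
      case True
      then show ?thesis using bp' by simp
    next
      case False
      then have "a i j = 0" "a i p = 0" using supp that by blast+
      then show ?thesis by (simp add: b_def)
    qed
    from insert.IH[OF bsym bpos this]
    obtain l :: nat and t where "\<forall>i j. b i j = (\<Sum>k<l. t k i * t k j)"
      by blast
    then have t: "b i j = (\<Sum>k<l. t k i * t k j)" for i j
      by blast
    define u where "u = t(l := (\<lambda>i. a i p / sqrt (a p p)))"
    have "a i j = (\<Sum>k<Suc l. u k i * u k j)" for i j
    proof -
      have "(\<Sum>k<l. u k i * u k j) = b i j"
        unfolding t by (rule sum.cong) (simp_all add: u_def)
      moreover have "u l i * u l j = a i p * a j p / a p p"
        using app by (simp add: u_def)
      ultimately show ?thesis by (simp add: b_def)
    qed
    then show ?thesis by (intro exI[of _ "Suc l"] exI[of _ u] allI)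
  qed
qed

lemma sos_matrix_psd_const:
  fixes C :: "'k::finite \<Rightarrow> 'k \<Rightarrow> real"
  assumes "\<And>i j. C i j = C j i" "\<And>v. 0 \<le> (\<Sum>i\<in>UNIV. \<Sum>j\<in>UNIV. v i * v j * C i j)"
  shows "sos_matrix ((\<chi> i j. Const (C i j)) :: 'v::finite rpoly^'k^'k)"
proof -
  obtain l :: nat and t where t: "\<And>i j. C i j = (\<Sum>k<l. t k i * t k j)"
    using psd_form_sum_of_squares[OF assms, of UNIV] by auto
  have "((\<chi> i j. Const (C i j)) :: 'v rpoly^'k^'k) = (\<Sum>k<l. rank_one (\<chi> i. Const (t k i)))"
    by (auto simp: vec_eq_iff t intro!: rpoly_eqI)
  then show ?thesis by (simp add: sos_matrix_sum sos_matrix_rank_one)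
qed

section \<open>Quasi-analyticity\<close>

lemma log_convex_ratio_le:
  fixes M :: "nat \<Rightarrow> real"
  assumes pos: "\<And>n. M n > 0"
    and convex: "\<And>n. (M (Suc n))\<^sup>2 \<le> M n * M (Suc (Suc n))"
    and "m \<le> n"
  shows "M (Suc m) / M m \<le> M (Suc n) / M n"
  using \<open>m \<le> n\<close>
proof (induction n rule: dec_induct)
  case (step n)
  have "M (Suc n) / M n \<le> M (Suc (Suc n)) / M (Suc n)"
    using convex[of n] pos[of n] pos[of "Suc n"]
    by (simp add: field_simps power2_eq_square)
  with step.IH show ?case by linarith
qed simp

lemma log_convex_le_geometric:
  fixes M :: "nat \<Rightarrow> real"
  assumes pos: "\<And>n. M n > 0"
    and convex: "\<And>n. (M (Suc n))\<^sup>2 \<le> M n * M (Suc (Suc n))"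
    and "i + j \<le> Suc n"
  shows "M (i + j) \<le> M i * (M (Suc n) / M n) ^ j"
  using \<open>i + j \<le> Suc n\<close>
proof (induction j)
  case (Suc j)
  have "M (i + Suc j) = M (i + j) * (M (Suc (i + j)) / M (i + j))"
    using pos[of "i + j"] by simp
  also have "\<dots> \<le> (M i * (M (Suc n) / M n) ^ j) * (M (Suc n) / M n)"
    using Suc pos by (intro mult_mono log_convex_ratio_le[where M = M, OF pos convex]) (auto simp: less_imp_le)
  finally show ?case by (simp add: ac_simps)
qed simp

lemma sum_inverse_fact_le_exp: "(\<Sum>j<m. 1 / fact j) \<le> exp (1 :: real)"
proof -
  have "(\<lambda>n. 1 ^ n /\<^sub>R fact n) sums exp (1 :: real)" by (rule exp_converges)
  then have "(\<Sum>j<m. 1 ^ j /\<^sub>R fact j) \<le> exp (1 :: real)"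
    by (intro sum_le_suminf[THEN order.trans[OF _ eq_refl]])
      (auto simp: sums_iff)
  then show ?thesis by (simp add: divide_inverse)
qed

text \<open>
  Bang's measure of flatness: \<open>F\<close> is flat of order \<open>N\<close> at \<open>t\<close> if
  \<open>\<bar>F i t\<bar> \<le> M i * exp (i - N)\<close> for all \<open>i\<close>. By Taylor's formula and log-convexity of \<open>M\<close>, a step of
  length \<open>M n / (e M (n + 1))\<close> costs at most one order of flatness.
\<close>

lemma bang_step:
  fixes F :: "nat \<Rightarrow> real \<Rightarrow> real" and M :: "nat \<Rightarrow> real"
  assumes pos: "\<And>n. M n > 0"
    and convex: "\<And>n. (M (Suc n))\<^sup>2 \<le> M n * M (Suc (Suc n))"
    and taylor: "\<And>i m t d. \<bar>F i (t + d)\<bar> \<le>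
        (\<Sum>j<m. \<bar>F (i + j) t\<bar> * (\<bar>d\<bar> ^ j / fact j)) + M (i + m) * (\<bar>d\<bar> ^ m / fact m)"
    and level: "\<And>i. \<bar>F i t\<bar> \<le> M i * exp (real i - real (Suc n))"
    and d: "\<bar>d\<bar> \<le> M n / (exp 1 * M (Suc n))"
  shows "\<bar>F i (t + d)\<bar> \<le> M i * exp (real i - real n)"
proof (cases "n \<le> i")
  case True
  have "\<bar>F i (t + d)\<bar> \<le> M i * 1" using taylor[of i t d 0] by simp
  also have "\<dots> \<le> M i * exp (real i - real n)"
    using True pos[of i] by (intro mult_left_mono) auto
  finally show ?thesis .
next
  case False
  define q where "q = M (Suc n) / M n"
  define m where "m = Suc n - i"
  have m: "i + m = Suc n" using False by (simp add: m_def)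
  have q: "q > 0" using pos by (simp add: q_def)
  have "exp 1 * q * \<bar>d\<bar> \<le> exp 1 * q * (M n / (exp 1 * M (Suc n)))"
    using d q by (intro mult_left_mono) auto
  also have "\<dots> = 1" using pos[of n] pos[of "Suc n"] by (simp add: q_def field_simps)
  finally have small: "exp 1 * q * \<bar>d\<bar> \<le> 1" .
  have term_le: "M (i + j) * exp (real (i + j) - real (Suc n)) * (\<bar>d\<bar> ^ j / fact j)
      \<le> M i * exp (real i - real (Suc n)) * (1 / fact j)" if "j \<le> m" for j
  proof -
    have "M (i + j) * exp (real (i + j) - real (Suc n)) * (\<bar>d\<bar> ^ j / fact j)
        \<le> (M i * q ^ j) * exp (real (i + j) - real (Suc n)) * (\<bar>d\<bar> ^ j / fact j)"
      using that m unfolding q_def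
      by (intro mult_right_mono log_convex_le_geometric[where M = M, OF pos convex]) auto
    also have "\<dots> = M i * exp (real i - real (Suc n)) * ((exp 1 * q * \<bar>d\<bar>) ^ j / fact j)"
    proof -
      have "exp (real (i + j) - real (Suc n)) = exp (real i - real (Suc n)) * exp 1 ^ j"
        unfolding exp_of_nat_mult[symmetric] exp_add[symmetric] by simp
      then show ?thesis by (simp add: power_mult_distrib)
    qed
    also have "\<dots> \<le> M i * exp (real i - real (Suc n)) * (1 / fact j)"
      using small q pos[of i]
      by (intro mult_left_mono divide_right_mono power_le_one) auto
    finally show ?thesis .
  qed
  have "\<bar>F i (t + d)\<bar> \<le> (\<Sum>j<m. \<bar>F (i + j) t\<bar> * (\<bar>d\<bar> ^ j / fact j)) + M (i + m) * (\<bar>d\<bar> ^ m / fact m)"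
    by (rule taylor)
  also have "\<dots> \<le> (\<Sum>j<m. M i * exp (real i - real (Suc n)) * (1 / fact j))
      + M i * exp (real i - real (Suc n)) * (1 / fact m)"
  proof (intro add_mono sum_mono)
    fix j assume "j \<in> {..<m}"
    have "\<bar>F (i + j) t\<bar> * (\<bar>d\<bar> ^ j / fact j)
        \<le> M (i + j) * exp (real (i + j) - real (Suc n)) * (\<bar>d\<bar> ^ j / fact j)"
      using level[of "i + j"] by (intro mult_right_mono) auto
    also have "\<dots> \<le> M i * exp (real i - real (Suc n)) * (1 / fact j)"
      using \<open>j \<in> {..<m}\<close> by (intro term_le) auto
    finally show "\<bar>F (i + j) t\<bar> * (\<bar>d\<bar> ^ j / fact j)
        \<le> M i * exp (real i - real (Suc n)) * (1 / fact j)" .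
  next
    show "M (i + m) * (\<bar>d\<bar> ^ m / fact m) \<le> M i * exp (real i - real (Suc n)) * (1 / fact m)"
      using term_le[of m] by (simp add: m)
  qed
  also have "\<dots> = M i * exp (real i - real (Suc n)) * (\<Sum>j<Suc m. 1 / fact j)"
    by (simp add: sum_distrib_left distrib_left)
  also have "\<dots> \<le> M i * exp (real i - real (Suc n)) * exp 1"
    using pos[of i] by (intro mult_left_mono sum_inverse_fact_le_exp) auto
  also have "\<dots> = M i * exp (real i - real n)"
    by (simp add: mult.assoc exp_add[symmetric])
  finally show ?thesis .
qed

text \<open>
  The finite form of the Denjoy-Carleman theorem. A function whose first \<open>N\<close> derivatives vanish at \<open>0\<close>
  is flat of order \<open>N\<close> there; on the way to \<open>s\<close> the steps allowed by \<open>bang_step\<close> are used up from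
  \<open>N\<close> down to \<open>K\<close>. If the steps have infinite total length, \<open>K\<close> can be taken arbitrarily large for
  given \<open>s\<close>. The functions \<open>F i\<close> stand for the derivatives of \<open>F 0\<close>; only Taylor's inequality between
  them enters, so nothing has to be differentiated.
\<close>

lemma bang:
  fixes F :: "nat \<Rightarrow> real \<Rightarrow> real" and M :: "nat \<Rightarrow> real"
  assumes pos: "\<And>n. M n > 0"
    and convex: "\<And>n. (M (Suc n))\<^sup>2 \<le> M n * M (Suc (Suc n))"
    and taylor: "\<And>i m t d. \<bar>F i (t + d)\<bar> \<le>
        (\<Sum>j<m. \<bar>F (i + j) t\<bar> * (\<bar>d\<bar> ^ j / fact j)) + M (i + m) * (\<bar>d\<bar> ^ m / fact m)"
    and zero: "\<And>i. i < N \<Longrightarrow> F i 0 = 0"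
    and "K \<le> N" and "\<bar>s\<bar> \<le> (\<Sum>n=K..<N. M n / (exp 1 * M (Suc n)))"
  shows "\<bar>F 0 s\<bar> \<le> M 0 * exp (- real K)"
proof -
  have "\<bar>F i s\<bar> \<le> M i * exp (real i - real K)" for i
    using assms(5,6)
  proof (induction K arbitrary: s i rule: inc_induct)
    case base
    then have "s = 0" by simp
    show ?case
    proof (cases "i < N")
      case True
      then show ?thesis using zero pos[of i] \<open>s = 0\<close> by simp
    next
      case False
      have "\<bar>F i s\<bar> \<le> M i * 1" using taylor[of i s 0 0] by simp
      also have "\<dots> \<le> M i * exp (real i - real N)"
        using False pos[of i] by (intro mult_left_mono) auto
      finally show ?thesis .
    qed
  next
    case (step K)
    define a where "a n = M n / (exp 1 * M (Suc n))" for n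
    define S where "S = (\<Sum>n=Suc K..<N. a n)"
    define s' where "s' = max (- S) (min s S)"
    have a: "a n \<ge> 0" for n using pos by (simp add: a_def less_imp_le)
    then have S: "S \<ge> 0" by (simp add: S_def sum_nonneg)
    have "\<bar>s\<bar> \<le> a K + S"
      using step.prems step.hyps unfolding S_def a_def by (simp add: sum.atLeast_Suc_lessThan)
    then have "\<bar>s - s'\<bar> \<le> a K" "\<bar>s'\<bar> \<le> S"
      using S a[of K] unfolding s'_def by auto
    then have "\<bar>F i (s' + (s - s'))\<bar> \<le> M i * exp (real i - real K)"
      using step.IH[of s'] unfolding S_def a_def
      by (intro bang_step[where F = F and M = M, OF pos convex taylor]) auto
    then show ?case by simp
  qed
  from this[of 0] show ?thesis by simp
qed

section \<open>Carleman's inequality\<close>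

lemma fact_root_ge:
  assumes "n > 0"
  shows "real n / exp 1 \<le> fact n powr (1 / real n)"
proof -
  have "(\<lambda>k. real n ^ k /\<^sub>R fact k) sums exp (real n)" by (rule exp_converges)
  then have "(\<Sum>k\<in>{n}. real n ^ k /\<^sub>R fact k) \<le> exp (real n)"
    by (subst sums_unique, assumption, intro sum_le_suminf) (auto simp: sums_iff)
  then have "real n ^ n / exp (real n) \<le> fact n"
    by (simp add: field_simps)
  moreover have "real n ^ n / exp (real n) = (real n / exp 1) ^ n"
    by (simp add: power_divide exp_of_nat_mult[symmetric])
  ultimately have "((real n / exp 1) ^ n) powr (1 / real n) \<le> fact n powr (1 / real n)"
    by (intro powr_mono2) auto
  then show ?thesis using assms by (simp add: powr_realpow[symmetric] powr_powr)
qed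

text \<open>
  The arithmetic-geometric mean inequality is applied to the numbers \<open>(k + 1) a k\<close>, whose extra factor
  \<open>(n + 1)!\<close> is at least \<open>((n + 1) / e) ^ (n + 1)\<close>.
\<close>

lemma carleman_inequality:
  fixes a :: "nat \<Rightarrow> real"
  assumes a: "\<And>n. a n > 0" and "summable a"
  shows "summable (\<lambda>n. (\<Prod>k\<le>n. a k) powr (1 / real (Suc n)))"
proof -
  define T where "T n = (\<Sum>k<n. real (Suc k) * a k)" for n
  have T: "T n \<ge> 0" for n using a by (simp add: T_def sum_nonneg less_imp_le)
  have le: "(\<Prod>k\<le>n. a k) powr (1 / real (Suc n)) \<le> exp 1 * (T (Suc n) / (real (Suc n))\<^sup>2)" for n
  proof -
    let ?N = "real (Suc n)"
    have fact: "(\<Prod>k\<le>n. real (Suc k)) = fact (Suc n)"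
      by (simp only: fact_prod_Suc of_nat_prod lessThan_Suc_atMost[symmetric] atLeast0LessThan)
    have "(\<Prod>k\<le>n. real (Suc k) * a k) powr (1 / card {..n}) \<le> (\<Sum>k\<le>n. real (Suc k) * a k / card {..n})"
      using a by (intro arith_geom_mean) (auto simp: less_imp_le)
    then have "fact (Suc n) powr (1 / ?N) * (\<Prod>k\<le>n. a k) powr (1 / ?N) \<le> T (Suc n) / ?N"
      using a by (simp add: prod.distrib fact powr_mult[symmetric] prod_nonneg less_imp_le T_def
          sum_divide_distrib[symmetric] lessThan_Suc_atMost del: fact_Suc of_nat_Suc)
    moreover have "(?N / exp 1) * (\<Prod>k\<le>n. a k) powr (1 / ?N)
        \<le> fact (Suc n) powr (1 / ?N) * (\<Prod>k\<le>n. a k) powr (1 / ?N)"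
      by (intro mult_right_mono fact_root_ge) auto
    ultimately have "(?N / exp 1) * (\<Prod>k\<le>n. a k) powr (1 / ?N) \<le> T (Suc n) / ?N"
      by linarith
    then show ?thesis by (simp add: field_simps power2_eq_square del: of_nat_Suc)
  qed
  \<comment> \<open>Abel summation with \<open>1 / n\<^sup>2 \<le> 2 (1 / n - 1 / (n + 1))\<close>.\<close>
  have bound: "(\<Sum>n<L. T (Suc n) / (real (Suc n))\<^sup>2) \<le> 2 * (\<Sum>k<L. a k) - 2 * T L / real (Suc L)" for L
  proof (induction L)
    case 0
    then show ?case by (simp add: T_def)
  next
    case (Suc L)
    define x where "x = real (Suc L)"
    have x: "x \<ge> 1" by (simp add: x_def)
    have TL: "T L = T (Suc L) - x * a L" by (simp add: T_def x_def)
    have "T (Suc L) / x\<^sup>2 \<le> T (Suc L) * (2 / (x * (x + 1)))"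
    proof -
      have "1 * x \<le> x * x" using x by (intro mult_right_mono) auto
      then have "x * (x + 1) \<le> 2 * x\<^sup>2" by (simp add: power2_eq_square algebra_simps)
      then have "2 / (2 * x\<^sup>2) \<le> 2 / (x * (x + 1))" using x by (intro divide_left_mono) auto
      then have "1 / x\<^sup>2 \<le> 2 / (x * (x + 1))" by simp
      from mult_left_mono[OF this T[of "Suc L"]] show ?thesis by simp
    qed
    moreover have "T (Suc L) * (2 / (x * (x + 1))) = 2 * T (Suc L) / x - 2 * T (Suc L) / (x + 1)"
      using x by (simp add: field_simps)
    moreover have "2 * T (Suc L) / x = 2 * T L / x + 2 * a L"
      using x unfolding TL by (simp add: right_diff_distrib diff_divide_distrib)
    moreover have "(\<Sum>n<L. T (Suc n) / (real (Suc n))\<^sup>2) \<le> 2 * (\<Sum>k<L. a k) - 2 * T L / x"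
      using Suc.IH by (simp add: x_def)
    ultimately have "(\<Sum>n<L. T (Suc n) / (real (Suc n))\<^sup>2) + T (Suc L) / x\<^sup>2
        \<le> 2 * ((\<Sum>k<L. a k) + a L) - 2 * T (Suc L) / (x + 1)"
      by argo
    moreover have "real (Suc (Suc L)) = x + 1" by (simp add: x_def)
    ultimately show ?case by (simp only: sum.lessThan_Suc x_def[symmetric])
  qed
  have "summable (\<lambda>n. exp 1 * (T (Suc n) / (real (Suc n))\<^sup>2))"
  proof (rule summable_mult, rule summableI_nonneg_bounded)
    show "0 \<le> T (Suc n) / (real (Suc n))\<^sup>2" for n using T[of "Suc n"] by simp
    show "(\<Sum>n<L. T (Suc n) / (real (Suc n))\<^sup>2) \<le> 2 * suminf a" for L
    proof -
      have "(\<Sum>k<L. a k) \<le> suminf a"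
        using assms by (intro sum_le_suminf) (auto simp: less_imp_le)
      moreover have "0 \<le> 2 * T L / real (Suc L)" using T[of L] by simp
      ultimately show ?thesis using bound[of L] by linarith
    qed
  qed
  then show ?thesis
    by (rule summable_comparison_test'[of _ 0]) (use le in auto)
qed

text \<open>
  The \<open>a n\<close> in the proof are the inverse square roots of the successive ratios of \<open>s\<close>, and their
  geometric means are the terms of the divergent series in the hypothesis. By Carleman's inequality the
  \<open>a n\<close> are then not summable either, and since they decrease, the even ratios, which
  dominate every other \<open>a n\<close>, are not summable.
\<close>

lemma not_summable_even_ratios:
  fixes s :: "nat \<Rightarrow> real"
  assumes pos: "\<And>n. s n > 0" and one: "s 0 = 1"
    and convex: "\<And>n. (s (Suc n))\<^sup>2 \<le> s n * s (Suc (Suc n))"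
    and div: "\<not> summable (\<lambda>n. s (Suc n) powr (- 1 / (2 * real (Suc n))))"
  shows "\<not> summable (\<lambda>n. (s (2 * n) / s (2 * Suc n)) powr (1 / 4))"
proof
  assume *: "summable (\<lambda>n. (s (2 * n) / s (2 * Suc n)) powr (1 / 4))"
  define r where "r n = s (Suc n) / s n" for n
  define a where "a n = r n powr (- 1 / 2)" for n
  have r: "r n > 0" for n using pos by (simp add: r_def)
  have r_mono: "m \<le> n \<Longrightarrow> r m \<le> r n" for m n
    unfolding r_def by (rule log_convex_ratio_le[where M = s, OF pos convex])
  have a: "a n > 0" for n using r[of n] by (simp add: a_def)
  have a_anti: "m \<le> n \<Longrightarrow> a n \<le> a m" for m n
    unfolding a_def using r by (intro powr_mono2') (auto simp: r_mono)
  have "summable (\<lambda>n. a (Suc (2 * n)))"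
  proof (rule summable_comparison_test'[OF *, of 0])
    fix n :: nat
    have "s (2 * n) / s (2 * Suc n) = 1 / (r (2 * n) * r (Suc (2 * n)))"
      using pos[of "2 * n"] pos[of "Suc (2 * n)"] by (simp add: r_def)
    moreover have "r (2 * n) * r (Suc (2 * n)) \<le> (r (Suc (2 * n)))\<^sup>2"
      using r_mono[of "2 * n" "Suc (2 * n)"] r[of "Suc (2 * n)"]
      by (simp add: power2_eq_square)
    ultimately have "1 / (r (Suc (2 * n)))\<^sup>2 \<le> s (2 * n) / s (2 * Suc n)"
      using r by (simp add: frac_le)
    then have "(1 / (r (Suc (2 * n)))\<^sup>2) powr (1 / 4) \<le> (s (2 * n) / s (2 * Suc n)) powr (1 / 4)"
      using r by (intro powr_mono2) auto
    moreover have "(1 / (r (Suc (2 * n)))\<^sup>2) powr (1 / 4) = a (Suc (2 * n))"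
    proof -
      have "1 / (r (Suc (2 * n)))\<^sup>2 = r (Suc (2 * n)) powr (- 2)"
        using r[of "Suc (2 * n)"] by (simp add: powr_minus_divide)
      then show ?thesis by (simp only: a_def powr_powr) simp
    qed
    ultimately show "norm (a (Suc (2 * n))) \<le> (s (2 * n) / s (2 * Suc n)) powr (1 / 4)"
      using a[of "Suc (2 * n)"] by simp
  qed
  then have odd: "summable (\<lambda>n. a (Suc (2 * n)))" .
  have "summable a"
  proof (rule summableI_nonneg_bounded)
    show "0 \<le> a n" for n using a[of n] by simp
    have dbl: "(\<Sum>k<Suc (2 * L). a k) \<le> a 0 + 2 * (\<Sum>n<L. a (Suc (2 * n)))" for L
    proof (induction L)
      case (Suc L)
      then show ?case using a_anti[of "Suc (2 * L)" "Suc (Suc (2 * L))"] by simp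
    qed simp
    show "(\<Sum>k<L. a k) \<le> a 0 + 2 * suminf (\<lambda>n. a (Suc (2 * n)))" for L
    proof -
      have "(\<Sum>k<L. a k) \<le> (\<Sum>k<Suc (2 * L). a k)"
        using a by (intro sum_mono2) (auto simp: less_imp_le)
      also have "\<dots> \<le> a 0 + 2 * (\<Sum>n<L. a (Suc (2 * n)))" by (rule dbl)
      finally show ?thesis
        using sum_le_suminf[OF odd, of "{..<L}"] a by (auto simp: less_imp_le)
    qed
  qed
  then have "summable (\<lambda>n. (\<Prod>k\<le>n. a k) powr (1 / real (Suc n)))"
    by (rule carleman_inequality[OF a])
  moreover have "(\<Prod>k\<le>n. a k) powr (1 / real (Suc n)) = s (Suc n) powr (- 1 / (2 * real (Suc n)))" for n
  proof -
    have "(\<Prod>k\<le>n. a k) = s (Suc n) powr (- 1 / 2)" for n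
    proof (induction n)
      case 0
      then show ?case by (simp add: a_def r_def one)
    next
      case (Suc n)
      have "(\<Prod>k\<le>Suc n. a k) = (s (Suc n) * r (Suc n)) powr (- 1 / 2)"
        using Suc.IH pos[of "Suc n"] r[of "Suc n"] by (simp add: a_def powr_mult)
      then show ?case using pos[of "Suc n"] by (simp add: r_def)
    qed
    then show ?thesis by (simp add: powr_powr)
  qed
  ultimately show False using div by simp
qed

text \<open>
  Passes from the series in \<open>[0, \<infinity>]\<close> to a real one. Adding \<open>1\<close> to the moments keeps them away
  from \<open>0\<close> and changes a term by a bounded factor where the moment is at least \<open>1\<close>; if infinitely many
  moments were smaller than \<open>1\<close>, the new series would diverge anyway.
\<close>

lemma not_summable_of_carleman_series:
  fixes m :: "nat \<Rightarrow> real"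
  assumes nonneg: "\<And>n. m n \<ge> 0"
    and convex: "\<And>n. (m (Suc n))\<^sup>2 \<le> m n * m (Suc (Suc n))"
    and T: "T \<ge> 1"
    and div: "suminf (\<lambda>d. inverse (ennreal (m (Suc d) powr (1 / real (2 * Suc d))))) = \<infinity>"
  shows "\<not> summable (\<lambda>n. ((m (Suc n) + 1) / T) powr (- 1 / (2 * real (Suc n))))"
proof
  assume *: "summable (\<lambda>n. ((m (Suc n) + 1) / T) powr (- 1 / (2 * real (Suc n))))"
  define p where "p n = 1 / (2 * real (Suc n))" for n
  have p: "0 < p n" "p n \<le> 1" for n by (auto simp: p_def field_simps)
  define H where "H n = (m (Suc n) + 1) powr (- p n)" for n
  have sumH: "summable H"
  proof (rule summable_comparison_test'[OF *, of 0])
    fix n :: nat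
    have "(m (Suc n) + 1) powr (- p n) \<le> ((m (Suc n) + 1) / T) powr (- p n)"
    proof (intro powr_mono2')
      show "(m (Suc n) + 1) / T \<le> m (Suc n) + 1"
        using nonneg[of "Suc n"] T mult_left_mono[of 1 T "m (Suc n) + 1"] by (simp add: divide_le_eq)
    qed (use nonneg[of "Suc n"] T p[of n] in auto)
    then show "norm (H n) \<le> ((m (Suc n) + 1) / T) powr (- 1 / (2 * real (Suc n)))"
      by (simp add: H_def p_def)
  qed
  then have "H \<longlonglongrightarrow> 0" by (rule summable_LIMSEQ_zero)
  then have "\<forall>\<^sub>F n in sequentially. H n < 1 / 2"
    by (rule order_tendstoD(2)) simp
  then obtain n0 where n0: "\<And>n. n \<ge> n0 \<Longrightarrow> H n < 1 / 2"
    unfolding eventually_sequentially by blast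
  have large: "m (Suc n) \<ge> 1" if "n \<ge> n0" for n
  proof (rule ccontr)
    assume "\<not> m (Suc n) \<ge> 1"
    then have "2 powr (- p n) \<le> H n"
      unfolding H_def using nonneg[of "Suc n"] p[of n] by (intro powr_mono2') auto
    moreover have "2 powr (- 1) \<le> (2 :: real) powr (- p n)"
      using p[of n] by (intro powr_mono) auto
    ultimately show False using n0[OF that] by simp
  qed
  have pos: "m (Suc n) > 0" for n
  proof (rule ccontr)
    assume "\<not> m (Suc n) > 0"
    then have zero: "m (Suc n) = 0" using nonneg[of "Suc n"] by simp
    have "m (Suc (n + k)) = 0" for k
    proof (induction k)
      case (Suc k)
      then show ?case using convex[of "Suc (n + k)"] by simp
    qed (simp add: zero)
    from this[of n0] large[of "n + n0"] show False by simp
  qed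
  define g where "g n = 1 / m (Suc n) powr p n" for n
  have "summable g"
  proof (rule summable_comparison_test'[of "\<lambda>n. 2 * H n" n0])
    show "summable (\<lambda>n. 2 * H n)" using sumH by (rule summable_mult)
    fix n assume "n \<ge> n0"
    have "m (Suc n) powr (- p n) \<le> ((m (Suc n) + 1) / 2) powr (- p n)"
      using large[OF \<open>n \<ge> n0\<close>] p[of n] by (intro powr_mono2') auto
    also have "\<dots> = 2 powr p n * H n"
      using nonneg[of "Suc n"] by (simp add: H_def powr_divide powr_minus field_simps)
    also have "\<dots> \<le> 2 powr 1 * H n"
      using p[of n] by (intro mult_right_mono powr_mono) (auto simp: H_def)
    finally show "norm (g n) \<le> 2 * H n"
      by (simp add: g_def powr_minus_divide)
  qed
  have "inverse (ennreal (m (Suc d) powr (1 / real (2 * Suc d)))) = ennreal (g d)" for d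
    using pos[of d] by (simp add: g_def p_def inverse_ennreal inverse_eq_divide)
  moreover have "suminf (\<lambda>d. ennreal (g d)) = ennreal (suminf g)"
    by (rule suminf_ennreal2[OF _ \<open>summable g\<close>]) (simp add: g_def)
  ultimately show False using div by simp
qed

section \<open>Density of polynomials under the Carleman condition\<close>

text \<open>
  Measurable functions of polynomial growth form an algebra, and all of them are integrable against a
  measure with finite moments. Working with them makes integrability a syntactic matter.
\<close>

definition tame :: "(real^'m::finite \<Rightarrow> real) \<Rightarrow> bool" where
  "tame f \<longleftrightarrow> f \<in> borel_measurable borel \<and> (\<exists>P. \<forall>y. \<bar>f y\<bar> \<le> peval (($) y) P)"

lemma tameI:
  assumes "f \<in> borel_measurable borel" "\<And>y. \<bar>f y\<bar> \<le> peval (($) y) P"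
  shows "tame f"
  using assms unfolding tame_def by blast

lemma tame_measurable [measurable_dest]: "tame f \<Longrightarrow> f \<in> borel_measurable borel"
  by (simp add: tame_def)

lemma borel_measurable_peval [measurable]: "(\<lambda>y :: real^'m::finite. peval (($) y) p) \<in> borel_measurable borel"
  by (intro borel_measurable_continuous_onI continuous_intros)

lemma tame_peval: "tame (\<lambda>y. peval (($) y) p)"
proof (rule tameI)
  show "\<bar>peval (($) y) p\<bar> \<le> peval (($) y) (1 + p\<^sup>2)" for y
    using zero_le_power2[of "\<bar>peval (($) y) p\<bar> - 1"]
    by (simp add: power2_diff)
qed simp

lemma tame_const: "tame (\<lambda>_. c)"
  using tame_peval[of "Const c"] by simp

lemma tame_coord: "tame (\<lambda>y. y $ k)"
  using tame_peval[of "Var k"] by simp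

lemma tame_add:
  assumes "tame f" "tame g"
  shows "tame (\<lambda>y. f y + g y)"
proof -
  obtain P Q where P: "\<And>y. \<bar>f y\<bar> \<le> peval (($) y) P" and Q: "\<And>y. \<bar>g y\<bar> \<le> peval (($) y) Q"
    using assms unfolding tame_def by blast
  show ?thesis
  proof (rule tameI)
    show "\<bar>f y + g y\<bar> \<le> peval (($) y) (P + Q)" for y
      using P[of y] Q[of y] by simp
  qed (use assms in measurable)
qed

lemma tame_mult:
  assumes "tame f" "tame g"
  shows "tame (\<lambda>y. f y * g y)"
proof -
  obtain P Q where P: "\<And>y. \<bar>f y\<bar> \<le> peval (($) y) P" and Q: "\<And>y. \<bar>g y\<bar> \<le> peval (($) y) Q"
    using assms unfolding tame_def by blast
  show ?thesis
  proof (rule tameI)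
    show "\<bar>f y * g y\<bar> \<le> peval (($) y) (P * Q)" for y
      using mult_mono[OF P[of y] Q[of y]] P[of y] by (simp add: abs_mult)
  qed (use assms in measurable)
qed

lemma tame_power: "tame f \<Longrightarrow> tame (\<lambda>y. f y ^ n)"
  by (induction n) (auto intro: tame_mult tame_const)

lemma tame_diff: "tame f \<Longrightarrow> tame g \<Longrightarrow> tame (\<lambda>y. f y - g y)"
  using tame_add[of f "\<lambda>y. - 1 * g y"] tame_mult[of "\<lambda>_. - 1" g] by (simp add: tame_const)

lemma tame_sum: "(\<And>i. i \<in> I \<Longrightarrow> tame (f i)) \<Longrightarrow> tame (\<lambda>y. \<Sum>i\<in>I. f i y)"
  by (induction I rule: infinite_finite_induct) (auto intro: tame_add tame_const)

lemma tame_prod: "(\<And>i. i \<in> I \<Longrightarrow> tame (f i)) \<Longrightarrow> tame (\<lambda>y. \<Prod>i\<in>I. f i y)"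
  by (induction I rule: infinite_finite_induct) (auto intro: tame_mult tame_const)

lemma tame_abs:
  assumes "tame f"
  shows "tame (\<lambda>y. \<bar>f y\<bar>)"
  using assms unfolding tame_def by auto

lemma tame_bounded:
  assumes "f \<in> borel_measurable borel" "\<And>y. \<bar>f y\<bar> \<le> 1"
  shows "tame f"
  using assms by (intro tameI[of f 1]) auto

lemma tame_cos: "tame (\<lambda>y. cos (s * y $ k + b))"
  by (intro tame_bounded borel_measurable_continuous_onI continuous_intros) auto

lemmas tame_intros = tame_add tame_mult tame_power tame_diff tame_sum tame_prod tame_abs tame_cos
  tame_const tame_coord tame_peval

text \<open>
  Taylor's formula with the derivatives written as phase shifts, so that they stay in the same family
  of functions.
\<close>

lemma cos_taylor:
  fixes u z :: real
  shows "\<bar>cos (u + z) - (\<Sum>j<m. cos (u + real j * pi / 2) * (z ^ j / fact j))\<bar> \<le> \<bar>z\<bar> ^ m / fact m"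
proof -
  define D where "D j x = cos (u + x + real j * pi / 2)" for j x
  have "DERIV (D j) x :> D (Suc j) x" for j x
  proof -
    have "DERIV (D j) x :> - sin (u + x + real j * pi / 2)"
      unfolding D_def by (auto intro!: derivative_eq_intros)
    moreover have "- sin (u + x + real j * pi / 2) = D (Suc j) x"
      unfolding D_def minus_sin_cos_eq by (simp add: algebra_simps add_divide_distrib)
    ultimately show ?thesis by simp
  qed
  then obtain t where t: "D 0 z = (\<Sum>j<m. D j 0 / fact j * z ^ j) + D m t / fact m * z ^ m"
    using Maclaurin_all_le[of D "D 0" z m] by blast
  have "\<bar>D m t / fact m * z ^ m\<bar> \<le> 1 / fact m * \<bar>z\<bar> ^ m"
    unfolding abs_mult power_abs abs_divide
    by (intro mult_right_mono) (auto simp: D_def divide_right_mono)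
  then show ?thesis using t by (simp add: D_def)
qed

locale moments =
  fixes M :: "(real^'m::finite) measure"
  assumes sets_eq: "sets M = sets borel"
    and integrable_peval: "\<And>p. integrable M (\<lambda>y. peval (($) y) p)"
begin

lemma measurable_tame: "tame f \<Longrightarrow> f \<in> borel_measurable M"
  by (simp add: tame_def measurable_cong_sets[OF sets_eq])

lemma integrable_tame:
  assumes "tame f"
  shows "integrable M f"
proof -
  obtain P where "\<And>y. \<bar>f y\<bar> \<le> peval (($) y) P"
    using assms unfolding tame_def by blast
  then show ?thesis
    using measurable_tame[OF assms]
    by (intro Bochner_Integration.integrable_bound[OF integrable_peval[of P]]) (auto intro!: AE_I2 order.trans[OF _ abs_ge_self])
qed

lemma integral_tame_add:
  "tame f \<Longrightarrow> tame g \<Longrightarrow> (\<integral>y. f y + g y \<partial>M) = (\<integral>y. f y \<partial>M) + (\<integral>y. g y \<partial>M)"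
  by (intro Bochner_Integration.integral_add integrable_tame)

lemma integral_tame_diff:
  "tame f \<Longrightarrow> tame g \<Longrightarrow> (\<integral>y. f y - g y \<partial>M) = (\<integral>y. f y \<partial>M) - (\<integral>y. g y \<partial>M)"
  by (intro Bochner_Integration.integral_diff integrable_tame)

lemma integral_tame_sum:
  "(\<And>i. i \<in> I \<Longrightarrow> tame (f i)) \<Longrightarrow> (\<integral>y. (\<Sum>i\<in>I. f i y) \<partial>M) = (\<Sum>i\<in>I. \<integral>y. f i y \<partial>M)"
  by (intro Bochner_Integration.integral_sum integrable_tame)

lemma integral_tame_mono:
  "tame f \<Longrightarrow> tame g \<Longrightarrow> (\<And>y. f y \<le> g y) \<Longrightarrow> (\<integral>y. f y \<partial>M) \<le> (\<integral>y. g y \<partial>M)"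
  by (intro integral_mono integrable_tame)

lemma cauchy_schwarz:
  assumes "tame f" "tame g" "tame w" "\<And>y. w y \<ge> 0"
  shows "(\<integral>y. f y * g y * w y \<partial>M)\<^sup>2 \<le> (\<integral>y. (f y)\<^sup>2 * w y \<partial>M) * (\<integral>y. (g y)\<^sup>2 * w y \<partial>M)"
proof -
  define A B C where "A = (\<integral>y. (f y)\<^sup>2 * w y \<partial>M)" and "B = (\<integral>y. f y * g y * w y \<partial>M)"
    and "C = (\<integral>y. (g y)\<^sup>2 * w y \<partial>M)"
  have nonneg: "0 \<le> s\<^sup>2 * A - 2 * s * t * B + t\<^sup>2 * C" for s t
  proof -
    have "0 \<le> (\<integral>y. (s * f y - t * g y)\<^sup>2 * w y \<partial>M)"
      using assms(4) by (intro integral_nonneg_AE AE_I2) simp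
    also have "(\<lambda>y. (s * f y - t * g y)\<^sup>2 * w y)
        = (\<lambda>y. s\<^sup>2 * ((f y)\<^sup>2 * w y) - 2 * s * t * (f y * g y * w y) + t\<^sup>2 * ((g y)\<^sup>2 * w y))"
      by (auto simp: fun_eq_iff power2_eq_square algebra_simps)
    also have "(\<integral>y. s\<^sup>2 * ((f y)\<^sup>2 * w y) - 2 * s * t * (f y * g y * w y) + t\<^sup>2 * ((g y)\<^sup>2 * w y) \<partial>M)
        = s\<^sup>2 * A - 2 * s * t * B + t\<^sup>2 * C"
      unfolding A_def B_def C_def using assms
      by (subst integral_tame_add integral_tame_diff, (intro tame_intros assms)+)+ simp
    finally show ?thesis .
  qed
  have C: "C \<ge> 0" unfolding C_def using assms(4) by (intro integral_nonneg_AE AE_I2) simp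
  have "B\<^sup>2 \<le> A * C"
  proof (cases "C = 0")
    case True
    have "B = 0"
    proof (rule ccontr)
      assume "B \<noteq> 0"
      then show False
        using nonneg[of 1 "(A + 1) / (2 * B)"] True by simp
    qed
    then show ?thesis using True by simp
  next
    case False
    have "0 \<le> C * (A * C - B\<^sup>2)"
      using nonneg[of C B] by (simp add: power2_eq_square algebra_simps)
    then show ?thesis using False C by (simp add: zero_le_mult_iff)
  qed
  then show ?thesis by (simp add: A_def B_def C_def)
qed

text \<open>
  The Gram-Schmidt process for the semi-inner product with weight \<open>w\<close>. A vector \<open>e\<close> of norm \<open>E = 0\<close>
  is orthogonal to everything by the Cauchy-Schwarz inequality; the coefficient \<open>\<alpha>\<close> is then a
  division by zero, which is harmless.
\<close>

lemma projection_exists: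
  fixes v :: "nat \<Rightarrow> real^'m \<Rightarrow> real"
  assumes "\<And>i. tame (v i)" "tame w" "\<And>y. w y \<ge> 0" "tame f"
  shows "\<exists>c. \<forall>j<n. (\<integral>y. (f y - (\<Sum>i<n. c i * v i y)) * v j y * w y \<partial>M) = 0"
  using assms(4)
proof (induction n arbitrary: f)
  case 0
  show ?case by simp
next
  case (Suc n)
  note t [intro, simp] = assms(1,2) Suc.prems
  obtain d where d: "\<And>j. j < n \<Longrightarrow> (\<integral>y. (v n y - (\<Sum>i<n. d i * v i y)) * v j y * w y \<partial>M) = 0"
    using Suc.IH[OF t(1)[of n]] by blast
  obtain c where c: "\<And>j. j < n \<Longrightarrow> (\<integral>y. (f y - (\<Sum>i<n. c i * v i y)) * v j y * w y \<partial>M) = 0"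
    using Suc.IH[OF t(3)] by blast
  define e where "e y = v n y - (\<Sum>i<n. d i * v i y)" for y
  define h where "h y = f y - (\<Sum>i<n. c i * v i y)" for y
  have e [intro, simp]: "tame e" and h [intro, simp]: "tame h"
    unfolding e_def h_def by (intro tame_intros t)+
  define E where "E = (\<integral>y. (e y)\<^sup>2 * w y \<partial>M)"
  define \<alpha> where "\<alpha> = (\<integral>y. h y * e y * w y \<partial>M) / E"
  have orth: "(\<integral>y. (h y - \<alpha> * e y) * v j y * w y \<partial>M) = 0" if "j < n" for j
  proof -
    have "(\<integral>y. (h y - \<alpha> * e y) * v j y * w y \<partial>M)
        = (\<integral>y. h y * v j y * w y - \<alpha> * (e y * v j y * w y) \<partial>M)"
      by (simp add: algebra_simps)
    also have "\<dots> = (\<integral>y. h y * v j y * w y \<partial>M) - \<alpha> * (\<integral>y. e y * v j y * w y \<partial>M)"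
      by (subst integral_tame_diff) (auto intro!: tame_intros)
    also have "\<dots> = 0" using c[OF that] d[OF that] by (simp add: e_def h_def)
    finally show ?thesis .
  qed
  have orth_e: "(\<integral>y. (h y - \<alpha> * e y) * e y * w y \<partial>M) = 0"
  proof -
    have "(\<integral>y. (h y - \<alpha> * e y) * e y * w y \<partial>M)
        = (\<integral>y. h y * e y * w y - \<alpha> * ((e y)\<^sup>2 * w y) \<partial>M)"
      by (simp add: algebra_simps power2_eq_square)
    also have "\<dots> = (\<integral>y. h y * e y * w y \<partial>M) - \<alpha> * E"
      unfolding E_def by (subst integral_tame_diff) (auto intro!: tame_intros)
    also have "\<dots> = 0"
    proof (cases "E = 0")
      case True
      have "(\<integral>y. h y * e y * w y \<partial>M)\<^sup>2 \<le> (\<integral>y. (h y)\<^sup>2 * w y \<partial>M) * E"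
        unfolding E_def using assms(2,3) e h by (intro cauchy_schwarz)
      then show ?thesis using True by simp
    qed (simp add: \<alpha>_def)
    finally show ?thesis .
  qed
  have v_n: "v n y = e y + (\<Sum>i<n. d i * v i y)" for y by (simp add: e_def)
  have orth_n: "(\<integral>y. (h y - \<alpha> * e y) * v n y * w y \<partial>M) = 0"
  proof -
    have "(\<integral>y. (h y - \<alpha> * e y) * v n y * w y \<partial>M)
        = (\<integral>y. (h y - \<alpha> * e y) * e y * w y + (\<Sum>i<n. d i * ((h y - \<alpha> * e y) * v i y * w y)) \<partial>M)"
      unfolding v_n by (simp add: algebra_simps sum_distrib_left)
    also have "\<dots> = (\<integral>y. (h y - \<alpha> * e y) * e y * w y \<partial>M)
        + (\<Sum>i<n. d i * (\<integral>y. (h y - \<alpha> * e y) * v i y * w y \<partial>M))"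
      by (subst integral_tame_add, (intro tame_intros t e h)+,
          subst integral_tame_sum, (intro tame_intros t e h)+, simp)
    also have "\<dots> = 0" using orth orth_e by simp
    finally show ?thesis .
  qed
  define c' where "c' = (\<lambda>i. c i - \<alpha> * d i)(n := \<alpha>)"
  have "f y - (\<Sum>i<Suc n. c' i * v i y) = h y - \<alpha> * e y" for y
  proof -
    have "(\<Sum>i<n. c' i * v i y) = (\<Sum>i<n. c i * v i y) - \<alpha> * (\<Sum>i<n. d i * v i y)"
      by (simp add: c'_def sum_subtractf sum_distrib_left left_diff_distrib mult.assoc)
    then show ?thesis by (simp add: c'_def h_def e_def algebra_simps)
  qed
  then have "\<forall>j<Suc n. (\<integral>y. (f y - (\<Sum>i<Suc n. c' i * v i y)) * v j y * w y \<partial>M) = 0"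
    using orth orth_n by (simp add: less_Suc_eq)
  then show ?case by blast
qed

definition moment :: "'m \<Rightarrow> nat \<Rightarrow> real" where
  "moment k n = (\<integral>y. (y $ k) ^ (2 * n) \<partial>M)"

text \<open>
  Adding \<open>1\<close> corresponds to adding a point mass at \<open>y\<^sub>k = 1\<close> to the measure: the sequence stays
  log-convex and becomes positive even if \<open>y\<^sub>k\<close> vanishes almost everywhere.
\<close>

definition normalized_moment :: "'m \<Rightarrow> nat \<Rightarrow> real" where
  "normalized_moment k n = (moment k n + 1) / (moment k 0 + 1)"

lemma moment_nonneg: "moment k n \<ge> 0"
  unfolding moment_def by (intro integral_nonneg_AE AE_I2) (simp add: power_mult)

lemma moment_convex: "(moment k (Suc n))\<^sup>2 \<le> moment k n * moment k (Suc (Suc n))"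
proof -
  have "(\<integral>y. (y $ k) ^ n * (y $ k) ^ Suc (Suc n) * 1 \<partial>M)\<^sup>2
      \<le> (\<integral>y. ((y $ k) ^ n)\<^sup>2 * 1 \<partial>M) * (\<integral>y. ((y $ k) ^ Suc (Suc n))\<^sup>2 * 1 \<partial>M)"
    by (intro cauchy_schwarz tame_intros) auto
  moreover have "x ^ n * x ^ Suc (Suc n) * 1 = x ^ (2 * Suc n)" "(x ^ n)\<^sup>2 * 1 = x ^ (2 * n)"
    "(x ^ Suc (Suc n))\<^sup>2 * 1 = x ^ (2 * Suc (Suc n))" for x :: real
  proof -
    have "n + Suc (Suc n) = 2 * Suc n" by simp
    then show "x ^ n * x ^ Suc (Suc n) * 1 = x ^ (2 * Suc n)"
      by (simp only: power_add[symmetric] mult_1_right)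
  qed (simp_all only: power_mult[symmetric] mult.commute[of _ 2] mult_1_right)
  ultimately show ?thesis unfolding moment_def by (simp only:)
qed

lemma normalized_moment_pos: "normalized_moment k n > 0"
  using moment_nonneg[of k n] moment_nonneg[of k 0] by (simp add: normalized_moment_def)

lemma normalized_moment_zero: "normalized_moment k 0 = 1"
  using moment_nonneg[of k 0] by (simp add: normalized_moment_def)

lemma normalized_moment_convex: "(normalized_moment k (Suc n))\<^sup>2 \<le> normalized_moment k n * normalized_moment k (Suc (Suc n))"
proof -
  define a b c where "a = moment k n" "b = moment k (Suc n)" "c = moment k (Suc (Suc n))"
  note abc = this
  have "a \<ge> 0" "b \<ge> 0" "c \<ge> 0" "b\<^sup>2 \<le> a * c"
    unfolding abc by (simp_all add: moment_nonneg moment_convex)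
  then have "b \<le> sqrt (a * c)" by (intro real_le_rsqrt)
  also have "\<dots> \<le> (a + c) / 2"
    using \<open>a \<ge> 0\<close> \<open>c \<ge> 0\<close> by (rule arith_geo_mean_sqrt)
  finally have "(b + 1)\<^sup>2 \<le> (a + 1) * (c + 1)"
    using \<open>b\<^sup>2 \<le> a * c\<close> by (simp add: power2_eq_square algebra_simps)
  then show ?thesis
    unfolding normalized_moment_def abc power_divide times_divide_times_eq power2_eq_square[of "moment k 0 + 1"]
    by (intro divide_right_mono) auto
qed

text \<open>
  Let \<open>h\<close> be the difference of the cosine \<open>f\<close> and its projection to the polynomials in \<open>y\<^sub>k\<close> of degree
  less than \<open>N\<close>. Then \<open>\<parallel>h\<parallel>\<^sup>2 = \<langle>f, h\<rangle>\<close> is the value at \<open>s\<close> of the function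
  \<open>t \<mapsto> \<langle>cos (t y\<^sub>k + b), h\<rangle>\<close>, whose derivatives of order less than \<open>N\<close> vanish at \<open>0\<close>, so Bang's theorem
  makes it small.
\<close>

lemma cos_dense:
  assumes div: "\<not> summable (\<lambda>n. (normalized_moment k (2 * n) / normalized_moment k (2 * Suc n)) powr (1 / 4))"
    and w: "tame w" "\<And>y. w y \<ge> 0" and "\<delta> > 0"
  shows "\<exists>n c. (\<integral>y. (cos (s * y $ k + b) - (\<Sum>i<n. c i * (y $ k) ^ i))\<^sup>2 * w y \<partial>M) < \<delta>"
proof -
  define W where "W = (\<integral>y. w y \<partial>M)"
  define W2 where "W2 = (\<integral>y. (w y)\<^sup>2 \<partial>M)"
  have W: "W \<ge> 0" "W2 \<ge> 0"
    unfolding W_def W2_def using w by (auto intro!: integral_nonneg_AE AE_I2)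
  define C where "C = ((moment k 0 + 1) * W2) powr (1 / 4) * sqrt W + 1"
  have C: "C > 0" using W by (simp add: C_def add_nonneg_pos)
  \<comment> \<open>The Cauchy-Schwarz inequality, used to split off first \<open>h\<close> and then \<open>w\<close>, bounds derivative \<open>n\<close>
    by the fourth root of the moment of order \<open>4 n\<close>.\<close>
  define Mb where "Mb n = C * normalized_moment k (2 * n) powr (1 / 4)" for n
  have Mb: "Mb n > 0" for n using C normalized_moment_pos[of k "2 * n"] by (simp add: Mb_def)
  have nm_le: "normalized_moment k (2 * Suc n) / normalized_moment k (2 * n) \<le> normalized_moment k (2 * Suc (Suc n)) / normalized_moment k (2 * Suc n)" for n
  proof -
    have r: "normalized_moment k (Suc i) / normalized_moment k i \<le> normalized_moment k (Suc j) / normalized_moment k j" if "i \<le> j" for i j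
      by (rule log_convex_ratio_le[where M = "normalized_moment k", OF normalized_moment_pos normalized_moment_convex that])
    have "normalized_moment k (2 * Suc n) / normalized_moment k (2 * n)
        = normalized_moment k (Suc (Suc (2 * n))) / normalized_moment k (Suc (2 * n)) * (normalized_moment k (Suc (2 * n)) / normalized_moment k (2 * n))"
      using normalized_moment_pos[of k "Suc (2 * n)"] by simp
    also have "\<dots> \<le> normalized_moment k (Suc (Suc (2 * Suc n))) / normalized_moment k (Suc (2 * Suc n))
        * (normalized_moment k (Suc (2 * Suc n)) / normalized_moment k (2 * Suc n))"
      using normalized_moment_pos by (intro mult_mono r) (auto intro!: divide_nonneg_nonneg less_imp_le)
    also have "\<dots> = normalized_moment k (2 * Suc (Suc n)) / normalized_moment k (2 * Suc n)"
      using normalized_moment_pos[of k "Suc (2 * Suc n)"] by simp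
    finally show ?thesis .
  qed
  have Mb_convex: "(Mb (Suc n))\<^sup>2 \<le> Mb n * Mb (Suc (Suc n))" for n
  proof -
    define p q r where "p = normalized_moment k (2 * n)" "q = normalized_moment k (2 * Suc n)" "r = normalized_moment k (2 * Suc (Suc n))"
    note pqr = this
    have pos: "p > 0" "q > 0" "r > 0" unfolding pqr by (rule normalized_moment_pos)+
    have "q / p \<le> r / q" unfolding pqr by (rule nm_le)
    then have "q * q \<le> p * r" using pos by (simp add: field_simps)
    then have "(q * q) powr (1 / 4) \<le> (p * r) powr (1 / 4)"
      using pos by (intro powr_mono2) auto
    then have "C\<^sup>2 * (q powr (1 / 4) * q powr (1 / 4)) \<le> C\<^sup>2 * (p powr (1 / 4) * r powr (1 / 4))"
      using pos by (intro mult_left_mono) (auto simp: powr_mult)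
    then show ?thesis unfolding Mb_def pqr by (simp add: power2_eq_square ac_simps)
  qed
  obtain K :: nat where K: "C * exp (- real K) < \<delta>"
  proof -
    have "(\<lambda>n. C * exp (- real n)) \<longlonglongrightarrow> C * 0"
      by (intro tendsto_mult tendsto_const filterlim_compose[OF exp_at_bot]
          filterlim_compose[OF filterlim_uminus_at_bot_at_top filterlim_real_sequentially])
    then have "\<forall>\<^sub>F n in sequentially. C * exp (- real n) < \<delta>"
      using \<open>\<delta> > 0\<close> by (intro order_tendstoD) auto
    then show ?thesis using that by (auto simp: eventually_sequentially)
  qed
  have ratio: "Mb n / (exp 1 * Mb (Suc n)) = (normalized_moment k (2 * n) / normalized_moment k (2 * Suc n)) powr (1 / 4) / exp 1" for n
    using C normalized_moment_pos[of k "2 * n"] normalized_moment_pos[of k "2 * Suc n"]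
    by (simp add: Mb_def powr_divide less_imp_le del: mult_Suc_right)
  obtain N where N: "K \<le> N" "\<bar>s\<bar> \<le> (\<Sum>n=K..<N. Mb n / (exp 1 * Mb (Suc n)))"
  proof -
    have "\<exists>N\<ge>K. \<bar>s\<bar> \<le> (\<Sum>n=K..<N. Mb n / (exp 1 * Mb (Suc n)))"
    proof (rule ccontr)
      assume *: "\<not> ?thesis"
      let ?g = "\<lambda>n. Mb n / (exp 1 * Mb (Suc n))"
      have g: "?g n \<ge> 0" for n using Mb by (simp add: less_imp_le)
      have "summable (\<lambda>n. ?g (n + K))"
      proof (rule summableI_nonneg_bounded)
        show "0 \<le> ?g (n + K)" for n by (rule g)
        show "(\<Sum>n<L. ?g (n + K)) \<le> \<bar>s\<bar>" for L
        proof -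
          have "(\<Sum>n<L. ?g (n + K)) = (\<Sum>n=K..<L + K. ?g n)"
            using sum.shift_bounds_nat_ivl[of ?g 0 K L] by (simp add: atLeast0LessThan)
          also have "\<dots> \<le> \<bar>s\<bar>" using * by (meson le_add2 linear)
          finally show ?thesis .
        qed
      qed
      then have "summable (\<lambda>n. ?g (n + K) * exp 1)" by (rule summable_mult2)
      then have "summable (\<lambda>n. (normalized_moment k (2 * (n + K)) / normalized_moment k (2 * Suc (n + K))) powr (1 / 4))"
        unfolding ratio by simp
      then show False
        using div summable_iff_shift[of "\<lambda>n. (normalized_moment k (2 * n) / normalized_moment k (2 * Suc n)) powr (1 / 4)" K]
        by simp
    qed
    then show ?thesis using that by blast
  qed
  define f where "f y = cos (s * y $ k + b)" for y :: "real^'m"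
  have f: "tame f" unfolding f_def by (rule tame_cos)
  obtain c where c: "\<And>j. j < N \<Longrightarrow> (\<integral>y. (f y - (\<Sum>i<N. c i * (y $ k) ^ i)) * (y $ k) ^ j * w y \<partial>M) = 0"
    using projection_exists[of "\<lambda>i y. (y $ k) ^ i" w f N] w f tame_power[OF tame_coord] by blast
  define h where "h y = f y - (\<Sum>i<N. c i * (y $ k) ^ i)" for y
  have h: "tame h" unfolding h_def by (intro tame_intros f)
  note t = h f w(1)
  have hh: "(\<integral>y. (h y)\<^sup>2 * w y \<partial>M) = (\<integral>y. f y * h y * w y \<partial>M)"
  proof -
    have "(\<integral>y. (h y)\<^sup>2 * w y \<partial>M) = (\<integral>y. f y * h y * w y - (\<Sum>i<N. c i * (h y * (y $ k) ^ i * w y)) \<partial>M)"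
    proof (rule Bochner_Integration.integral_cong[OF refl])
      fix y
      have "(\<Sum>i<N. c i * (h y * (y $ k) ^ i * w y)) = (\<Sum>i<N. c i * (y $ k) ^ i) * h y * w y"
        by (simp add: sum_distrib_left sum_distrib_right mult_ac)
      also have "(\<Sum>i<N. c i * (y $ k) ^ i) = f y - h y" by (simp add: h_def)
      finally show "(h y)\<^sup>2 * w y = f y * h y * w y - (\<Sum>i<N. c i * (h y * (y $ k) ^ i * w y))"
        by (simp add: power2_eq_square left_diff_distrib)
    qed
    also have "\<dots> = (\<integral>y. f y * h y * w y \<partial>M) - (\<Sum>i<N. c i * (\<integral>y. h y * (y $ k) ^ i * w y \<partial>M))"
      by (subst integral_tame_diff, (intro tame_intros t)+,
          subst integral_tame_sum, (intro tame_intros t)+, simp)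
    also have "\<dots> = (\<integral>y. f y * h y * w y \<partial>M)"
      using c by (simp add: h_def)
    finally show ?thesis .
  qed
  have hW: "(\<integral>y. (h y)\<^sup>2 * w y \<partial>M) \<le> W"
  proof -
    define H where "H = (\<integral>y. (h y)\<^sup>2 * w y \<partial>M)"
    have "H \<ge> 0" unfolding H_def using w by (intro integral_nonneg_AE AE_I2) auto
    have "H\<^sup>2 \<le> (\<integral>y. (f y)\<^sup>2 * w y \<partial>M) * H"
      using cauchy_schwarz[OF f h w] unfolding hh[symmetric] H_def .
    also have "\<dots> \<le> W * H"
      unfolding W_def using \<open>H \<ge> 0\<close> w
      by (intro mult_right_mono integral_tame_mono)
        (auto intro!: tame_intros t mult_left_le_one_le simp: f_def abs_square_le_1)
    finally show ?thesis
      using \<open>H \<ge> 0\<close> W unfolding H_def[symmetric] by (cases "H = 0") (auto simp: power2_eq_square)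
  qed
  have bound: "(\<integral>y. \<bar>(y $ k) ^ n\<bar> * \<bar>h y\<bar> * w y \<partial>M) \<le> Mb n" for n
  proof -
    define A where "A = (\<integral>y. \<bar>(y $ k) ^ n\<bar> * \<bar>h y\<bar> * w y \<partial>M)"
    define m2 where "m2 = (\<integral>y. (y $ k) ^ (2 * n) * w y \<partial>M)"
    have m2: "m2 \<ge> 0" unfolding m2_def using w by (intro integral_nonneg_AE AE_I2) (simp add: power_mult)
    have A: "A \<ge> 0" unfolding A_def using w by (intro integral_nonneg_AE AE_I2) simp
    have "m2\<^sup>2 \<le> moment k (2 * n) * W2"
    proof -
      have "(\<integral>y. (y $ k) ^ (2 * n) * w y * 1 \<partial>M)\<^sup>2
          \<le> (\<integral>y. ((y $ k) ^ (2 * n))\<^sup>2 * 1 \<partial>M) * (\<integral>y. (w y)\<^sup>2 * 1 \<partial>M)"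
        by (intro cauchy_schwarz tame_intros w) auto
      then show ?thesis by (simp add: m2_def W2_def moment_def power_mult[symmetric] mult.commute)
    qed
    also have "\<dots> \<le> (moment k (2 * n) + 1) * W2"
      using W by (intro mult_right_mono) auto
    finally have "m2 \<le> sqrt ((moment k (2 * n) + 1) * W2)"
      by (intro real_le_rsqrt)
    moreover have "A\<^sup>2 \<le> m2 * W"
    proof -
      have "A\<^sup>2 \<le> (\<integral>y. \<bar>(y $ k) ^ n\<bar>\<^sup>2 * w y \<partial>M) * (\<integral>y. \<bar>h y\<bar>\<^sup>2 * w y \<partial>M)"
        unfolding A_def by (intro cauchy_schwarz tame_intros t w)
      also have "\<dots> \<le> m2 * W"
        using m2 hW by (simp add: m2_def power_mult[symmetric] mult.commute[of n] mult_left_mono)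
      finally show ?thesis .
    qed
    ultimately have "A\<^sup>2 \<le> sqrt ((moment k (2 * n) + 1) * W2) * W"
      using W by (meson mult_right_mono order.trans)
    then have "A \<le> sqrt (sqrt ((moment k (2 * n) + 1) * W2) * W)"
      by (rule real_le_rsqrt)
    also have "\<dots> = ((moment k (2 * n) + 1) * W2) powr (1 / 4) * sqrt W"
      using W moment_nonneg[of k "2 * n"] by (simp add: real_sqrt_mult powr_half_sqrt[symmetric] powr_powr powr_mult)
    also have "\<dots> = normalized_moment k (2 * n) powr (1 / 4) * (((moment k 0 + 1) * W2) powr (1 / 4) * sqrt W)"
      using W moment_nonneg[of k "2 * n"] moment_nonneg[of k 0]
      by (simp add: normalized_moment_def powr_mult[symmetric])
    also have "\<dots> \<le> normalized_moment k (2 * n) powr (1 / 4) * C"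
      by (intro mult_left_mono) (auto simp: C_def)
    finally show ?thesis by (simp add: A_def Mb_def mult.commute)
  qed
  \<comment> \<open>These are the derivatives of \<open>F 0\<close>, with each differentiation recorded as a phase shift.\<close>
  define F where "F i t = (\<integral>y. (y $ k) ^ i * cos (t * y $ k + (b + real i * pi / 2)) * (h y * w y) \<partial>M)" for i t
  have taylor: "\<bar>F i (t + d)\<bar> \<le>
      (\<Sum>j<m. \<bar>F (i + j) t\<bar> * (\<bar>d\<bar> ^ j / fact j)) + Mb (i + m) * (\<bar>d\<bar> ^ m / fact m)" for i m t d
  proof -
    define u where "u y = t * y $ k + (b + real i * pi / 2)" for y :: "real^'m"
    define R where "R y = cos (u y + d * y $ k)
        - (\<Sum>j<m. cos (u y + real j * pi / 2) * ((d * y $ k) ^ j / fact j))" for y :: "real^'m"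
    have tu: "tame (\<lambda>y. cos (u y + r))" for r
      unfolding u_def add.assoc by (rule tame_cos)
    have tud: "tame (\<lambda>y. cos (u y + d * y $ k))"
      using tame_cos[of "t + d" k "b + real i * pi / 2"] by (simp add: u_def algebra_simps)
    have tR: "tame R" unfolding R_def power_mult_distrib times_divide_eq_left[symmetric]
      by (intro tame_intros tu tud) 
    have "F i (t + d) = (\<integral>y. (y $ k) ^ i * cos (u y + d * y $ k) * (h y * w y) \<partial>M)"
      by (simp add: F_def u_def algebra_simps)
    also have "\<dots> = (\<integral>y. (\<Sum>j<m. d ^ j / fact j * ((y $ k) ^ (i + j) * cos (u y + real j * pi / 2) * (h y * w y)))
        + (y $ k) ^ i * R y * (h y * w y) \<partial>M)"
      by (rule Bochner_Integration.integral_cong)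
        (simp_all add: R_def right_diff_distrib left_diff_distrib sum_distrib_left sum_distrib_right
          power_add power_mult_distrib mult_ac)
    also have "\<dots> = (\<Sum>j<m. d ^ j / fact j * F (i + j) t) + (\<integral>y. (y $ k) ^ i * R y * (h y * w y) \<partial>M)"
    proof -
      have "F (i + j) t = (\<integral>y. (y $ k) ^ (i + j) * cos (u y + real j * pi / 2) * (h y * w y) \<partial>M)" for j
        by (simp add: F_def u_def algebra_simps add_divide_distrib)
      then show ?thesis
        by (subst integral_tame_add, (intro tame_intros t tu tR)+,
            subst integral_tame_sum, (intro tame_intros t tu)+, simp)
    qed
    finally have eq: "F i (t + d) = \<dots>" .
    have "\<bar>\<integral>y. (y $ k) ^ i * R y * (h y * w y) \<partial>M\<bar>
        \<le> (\<integral>y. \<bar>d\<bar> ^ m / fact m * (\<bar>(y $ k) ^ (i + m)\<bar> * \<bar>h y\<bar> * w y) \<partial>M)"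
    proof (rule order.trans[OF integral_abs_bound], rule integral_tame_mono)
      fix y
      have "\<bar>R y\<bar> \<le> \<bar>d * y $ k\<bar> ^ m / fact m"
        unfolding R_def by (rule cos_taylor)
      then have "\<bar>y $ k\<bar> ^ i * \<bar>R y\<bar> * (\<bar>h y\<bar> * w y) \<le> \<bar>y $ k\<bar> ^ i * (\<bar>d * y $ k\<bar> ^ m / fact m) * (\<bar>h y\<bar> * w y)"
        using w by (intro mult_right_mono mult_left_mono) auto
      then show "\<bar>(y $ k) ^ i * R y * (h y * w y)\<bar> \<le> \<bar>d\<bar> ^ m / fact m * (\<bar>(y $ k) ^ (i + m)\<bar> * \<bar>h y\<bar> * w y)"
        using w(2)[of y] by (simp add: abs_mult power_abs power_add power_mult_distrib mult_ac)
    qed (intro tame_intros t tR)+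
    also have "\<dots> = \<bar>d\<bar> ^ m / fact m * (\<integral>y. \<bar>(y $ k) ^ (i + m)\<bar> * \<bar>h y\<bar> * w y \<partial>M)"
      by simp
    also have "\<dots> \<le> \<bar>d\<bar> ^ m / fact m * Mb (i + m)"
      by (intro mult_left_mono bound) auto
    finally have "\<bar>F i (t + d)\<bar> \<le> \<bar>\<Sum>j<m. d ^ j / fact j * F (i + j) t\<bar> + \<bar>d\<bar> ^ m / fact m * Mb (i + m)"
      unfolding eq by linarith
    moreover have "\<bar>\<Sum>j<m. d ^ j / fact j * F (i + j) t\<bar> \<le> (\<Sum>j<m. \<bar>F (i + j) t\<bar> * (\<bar>d\<bar> ^ j / fact j))"
      by (rule order.trans[OF sum_abs]) (simp add: abs_mult power_abs mult.commute)
    ultimately show ?thesis by (simp add: mult.commute)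
  qed
  have zero: "F i 0 = 0" if "i < N" for i
  proof -
    have "F i 0 = (\<integral>y. cos (b + real i * pi / 2) * (h y * (y $ k) ^ i * w y) \<partial>M)"
      by (simp add: F_def mult_ac)
    also have "\<dots> = cos (b + real i * pi / 2) * 0"
      using c[OF that] by (simp add: h_def)
    finally show ?thesis by simp
  qed
  have "\<bar>F 0 s\<bar> \<le> Mb 0 * exp (- real K)"
    by (rule bang[where F = F and M = Mb, OF Mb Mb_convex taylor zero N])
  also have "\<dots> = C * exp (- real K)" by (simp add: Mb_def normalized_moment_zero)
  finally have "F 0 s < \<delta>" using K by linarith
  moreover have "F 0 s = (\<integral>y. (h y)\<^sup>2 * w y \<partial>M)"
    unfolding hh F_def f_def by (simp add: mult.assoc)
  ultimately show ?thesis unfolding h_def f_def by auto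
qed

end

section \<open>Squares of polynomials as approximate point masses\<close>

text \<open>
  Both bases are \<open>1 - x\<^sup>2 / (2 n)\<close> up to an error of order \<open>n\<close> to the power \<open>-3/2\<close>, and the difference
  of two \<open>n\<close>-th powers of numbers in \<open>[-1, 1]\<close> is at most \<open>n\<close> times the difference of the bases.
\<close>

lemma cos_power_tendsto_gaussian:
  fixes x :: real
  shows "(\<lambda>n. cos (x / sqrt (real n)) ^ n) \<longlonglongrightarrow> exp (- (x\<^sup>2 / 2))"
proof -
  have diff: "\<bar>cos (x / sqrt (real n)) ^ n - exp (- (x\<^sup>2 / 2))\<bar> \<le> \<bar>x\<bar> ^ 3 / 6 * (1 / sqrt (real n)) + (x\<^sup>2 / 2)\<^sup>2 * (1 / real n)"
    if "n > 0" for n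
  proof -
    define z t where "z = x / sqrt (real n)" and "t = x\<^sup>2 / 2 / real n"
    have t: "t \<ge> 0" by (simp add: t_def)
    have z2: "z\<^sup>2 / 2 = t" by (simp add: z_def t_def power_divide)
    have "\<bar>cos z - (1 - t)\<bar> \<le> \<bar>z\<bar> ^ 3 / 6"
      using cos_taylor[of 0 z 3] z2 by (simp add: eval_nat_numeral fact_numeral)
    moreover have "\<bar>(1 - t) - exp (- t)\<bar> \<le> t\<^sup>2"
    proof -
      have "1 - t \<le> exp (- t)" using exp_ge_add_one_self[of "- t"] by simp
      moreover have "exp (- t) \<le> 1 - t + t\<^sup>2"
      proof -
        have "exp (- t) \<le> 1 / (1 + t)"
          using t exp_ge_add_one_self[of t] by (simp add: exp_minus divide_inverse le_imp_inverse_le)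
        also have "\<dots> \<le> 1 - t + t\<^sup>2"
        proof -
          have "(1 - t + t\<^sup>2) * (1 + t) = 1 + t ^ 3"
            by (simp add: algebra_simps power2_eq_square power3_eq_cube)
          then show ?thesis using t by (simp add: divide_le_eq)
        qed
        finally show ?thesis .
      qed
      ultimately show ?thesis by linarith
    qed
    ultimately have "\<bar>cos z - exp (- t)\<bar> \<le> \<bar>z\<bar> ^ 3 / 6 + t\<^sup>2" by linarith
    moreover have "\<bar>cos z ^ n - exp (- t) ^ n\<bar> \<le> real n * \<bar>cos z - exp (- t)\<bar>"
      using norm_power_diff[of "cos z" "exp (- t)" n] t by simp
    ultimately have "\<bar>cos z ^ n - exp (- t) ^ n\<bar> \<le> real n * (\<bar>z\<bar> ^ 3 / 6 + t\<^sup>2)"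
      by (meson mult_left_mono of_nat_0_le_iff order.trans)
    moreover have "exp (- t) ^ n = exp (- (x\<^sup>2 / 2))"
      using that by (simp add: exp_of_nat_mult[symmetric] t_def)
    moreover have "real n * (\<bar>z\<bar> ^ 3 / 6 + t\<^sup>2) = \<bar>x\<bar> ^ 3 / 6 * (1 / sqrt (real n)) + (x\<^sup>2 / 2)\<^sup>2 * (1 / real n)"
    proof -
      define r where "r = sqrt (real n)"
      have r: "r > 0" "real n = r * r" using that by (simp_all add: r_def)
      have 1: "r * r * (u / r ^ 3 / 6) = u / 6 * (1 / r)" for u
        using r(1) by (simp add: power3_eq_cube)
      have 2: "r * r * (u / (r * r))\<^sup>2 = u\<^sup>2 * (1 / (r * r))" for u
        using r(1) by (simp add: power2_eq_square)
      have 3: "\<bar>x / r\<bar> ^ 3 = \<bar>x\<bar> ^ 3 / r ^ 3"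
        using r(1) by (simp add: power_divide)
      have 4: "sqrt (r * r) = r" using r(1) by simp
      show ?thesis unfolding z_def t_def r(2) 4 distrib_left 3 1 2 ..
    qed
    ultimately show ?thesis by (simp only: z_def)
  qed
  have "(\<lambda>n. \<bar>x\<bar> ^ 3 / 6 * (1 / sqrt (real n)) + (x\<^sup>2 / 2)\<^sup>2 * (1 / real n)) \<longlonglongrightarrow> \<bar>x\<bar> ^ 3 / 6 * 0 + (x\<^sup>2 / 2)\<^sup>2 * 0"
  proof -
    have "(\<lambda>n. sqrt (1 / real n)) \<longlonglongrightarrow> sqrt 0"
      by (intro tendsto_real_sqrt lim_1_over_n)
    then have "(\<lambda>n. 1 / sqrt (real n)) \<longlonglongrightarrow> 0" by (simp add: real_sqrt_divide)
    then show ?thesis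
      by (rule tendsto_add[OF tendsto_mult[OF tendsto_const] tendsto_mult[OF tendsto_const lim_1_over_n]])
  qed
  then have null: "(\<lambda>n. \<bar>x\<bar> ^ 3 / 6 * (1 / sqrt (real n)) + (x\<^sup>2 / 2)\<^sup>2 * (1 / real n)) \<longlonglongrightarrow> 0"
    by simp
  have "\<forall>\<^sub>F n in sequentially. norm (cos (x / sqrt (real n)) ^ n - exp (- (x\<^sup>2 / 2)))
      \<le> \<bar>x\<bar> ^ 3 / 6 * (1 / sqrt (real n)) + (x\<^sup>2 / 2)\<^sup>2 * (1 / real n)"
  proof (rule eventually_sequentiallyI)
    fix n :: nat assume "1 \<le> n"
    then have "n > 0" by simp
    from diff[OF this] show "norm (cos (x / sqrt (real n)) ^ n - exp (- (x\<^sup>2 / 2)))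
        \<le> \<bar>x\<bar> ^ 3 / 6 * (1 / sqrt (real n)) + (x\<^sup>2 / 2)\<^sup>2 * (1 / real n)"
      unfolding real_norm_def .
  qed
  from Lim_null_comparison[OF this null]
  have "(\<lambda>n. cos (x / sqrt (real n)) ^ n - exp (- (x\<^sup>2 / 2))) \<longlonglongrightarrow> 0" .
  then show ?thesis by (simp add: LIM_zero_iff)
qed

locale carleman_moments = moments +
  assumes not_summable_ratios:
    "\<And>k. \<not> summable (\<lambda>n. (normalized_moment k (2 * n) / normalized_moment k (2 * Suc n)) powr (1 / 4))"
begin

text \<open>
  Density is required for all polynomial multiples of \<open>u\<close> at once. This is the form that survives
  multiplication by a cosine in one coordinate, and so an induction on the coordinates.
\<close>

definition poly_multiples_dense :: "(real^'a \<Rightarrow> real) \<Rightarrow> (real^'a \<Rightarrow> real) \<Rightarrow> bool" where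
  "poly_multiples_dense w u \<longleftrightarrow> (\<forall>q \<delta>. \<delta> > 0 \<longrightarrow>
     (\<exists>p. (\<integral>y. (u y * peval (($) y) q - peval (($) y) p)\<^sup>2 * w y \<partial>M) < \<delta>))"

lemma poly_multiples_dense_one: "poly_multiples_dense w (\<lambda>_. 1)"
  unfolding poly_multiples_dense_def
proof (intro allI impI)
  fix q :: "'a rpoly" and \<delta> :: real assume "\<delta> > 0"
  then show "\<exists>p. (\<integral>y. (1 * peval (($) y) q - peval (($) y) p)\<^sup>2 * w y \<partial>M) < \<delta>"
    by (intro exI[of _ q]) simp
qed

text \<open>
  The cosine is replaced by a polynomial in \<open>y\<^sub>k\<close> that is close to it for the weight \<open>(u q)\<^sup>2 w\<close>.
\<close>

lemma poly_multiples_dense_mult_cos: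
  assumes w: "tame w" "\<And>y. w y \<ge> 0" and u: "tame u" "poly_multiples_dense w u"
  shows "poly_multiples_dense w (\<lambda>y. u y * cos (s * y $ k + b))"
  unfolding poly_multiples_dense_def
proof (intro allI impI)
  fix q :: "'a rpoly" and \<delta> :: real assume "\<delta> > 0"
  define w' where "w' y = (u y * peval (($) y) q)\<^sup>2 * w y" for y
  have w': "tame w'" "\<And>y. w' y \<ge> 0"
    unfolding w'_def using w by (auto intro!: tame_intros u)
  obtain n c where c: "(\<integral>y. (cos (s * y $ k + b) - (\<Sum>i<n. c i * (y $ k) ^ i))\<^sup>2 * w' y \<partial>M) < \<delta> / 4"
    using cos_dense[where k = k and s = s and b = b and \<delta> = "\<delta> / 4", OF not_summable_ratios w'] \<open>\<delta> > 0\<close> by auto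
  define r where "r = (\<Sum>i<n. Const (c i) * Var k ^ i :: 'a rpoly)"
  have r: "peval (($) y) r = (\<Sum>i<n. c i * (y $ k) ^ i)" for y :: "real^'a"
    by (simp add: r_def)
  obtain p where p: "(\<integral>y. (u y * peval (($) y) (q * r) - peval (($) y) p)\<^sup>2 * w y \<partial>M) < \<delta> / 4"
    using u(2) \<open>\<delta> > 0\<close> unfolding poly_multiples_dense_def by (meson zero_less_divide_iff zero_less_numeral)
  have "(\<integral>y. (u y * cos (s * y $ k + b) * peval (($) y) q - peval (($) y) p)\<^sup>2 * w y \<partial>M)
      \<le> (\<integral>y. 2 * ((cos (s * y $ k + b) - peval (($) y) r)\<^sup>2 * w' y)
          + 2 * ((u y * peval (($) y) (q * r) - peval (($) y) p)\<^sup>2 * w y) \<partial>M)"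
  proof (rule integral_tame_mono)
    fix y
    define A B where "A = u y * peval (($) y) q * (cos (s * y $ k + b) - peval (($) y) r)"
      and "B = u y * peval (($) y) (q * r) - peval (($) y) p"
    have "(A + B)\<^sup>2 \<le> 2 * A\<^sup>2 + 2 * B\<^sup>2"
      using zero_le_power2[of "A - B"] by (simp add: power2_eq_square algebra_simps)
    then have "(A + B)\<^sup>2 * w y \<le> (2 * A\<^sup>2 + 2 * B\<^sup>2) * w y"
      using w by (intro mult_right_mono) auto
    moreover have "A + B = u y * cos (s * y $ k + b) * peval (($) y) q - peval (($) y) p"
      by (simp add: A_def B_def algebra_simps)
    moreover have "(2 * A\<^sup>2 + 2 * B\<^sup>2) * w y = 2 * ((cos (s * y $ k + b) - peval (($) y) r)\<^sup>2 * w' y)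
          + 2 * (B\<^sup>2 * w y)"
      by (simp only: A_def w'_def power_mult_distrib distrib_right distrib_left mult_ac)
    ultimately show "(u y * cos (s * y $ k + b) * peval (($) y) q - peval (($) y) p)\<^sup>2 * w y
      \<le> 2 * ((cos (s * y $ k + b) - peval (($) y) r)\<^sup>2 * w' y)
          + 2 * ((u y * peval (($) y) (q * r) - peval (($) y) p)\<^sup>2 * w y)"
      by (simp only: B_def)
  qed (intro tame_intros w w' u)+
  also have "\<dots> = 2 * (\<integral>y. (cos (s * y $ k + b) - peval (($) y) r)\<^sup>2 * w' y \<partial>M)
      + 2 * (\<integral>y. (u y * peval (($) y) (q * r) - peval (($) y) p)\<^sup>2 * w y \<partial>M)"
    by (subst integral_tame_add, (intro tame_intros w w' u)+, simp)
  also have "\<dots> < \<delta>" using c p unfolding r by simp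
  finally show "\<exists>p. (\<integral>y. (u y * cos (s * y $ k + b) * peval (($) y) q - peval (($) y) p)\<^sup>2 * w y \<partial>M) < \<delta>"
    by blast
qed

lemma poly_multiples_dense_prod_cos:
  assumes w: "tame w" "\<And>y. w y \<ge> 0" and "finite K"
  shows "poly_multiples_dense w (\<lambda>y. \<Prod>k\<in>K. cos (s * y $ k + b k) ^ L)"
  using \<open>finite K\<close>
proof (induction K rule: finite_induct)
  case empty
  then show ?case by (simp add: poly_multiples_dense_one)
next
  case (insert k K)
  have t: "tame (\<lambda>y. \<Prod>k\<in>K. cos (s * y $ k + b k) ^ L)" by (intro tame_intros)
  have "poly_multiples_dense w (\<lambda>y. (\<Prod>k\<in>K. cos (s * y $ k + b k) ^ L) * cos (s * y $ k + b k) ^ n)" for n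
  proof (induction n)
    case (Suc n)
    have "poly_multiples_dense w (\<lambda>y. ((\<Prod>k\<in>K. cos (s * y $ k + b k) ^ L) * cos (s * y $ k + b k) ^ n)
        * cos (s * y $ k + b k))"
      by (intro poly_multiples_dense_mult_cos w Suc tame_intros)
    then show ?case by (simp add: mult_ac)
  qed (use insert in simp)
  from this[of L] show ?case using insert.hyps by (simp add: mult.commute)
qed

text \<open>
  Near \<open>a\<close> the integrand is negative and the Gaussian is at least \<open>exp (- t / 4)\<close> on the ball of radius
  \<open>\<delta> / 2\<close>; outside the ball of radius \<open>\<delta>\<close> it is at most \<open>exp (- t)\<close>, where \<open>t = \<kappa>\<^sup>2 \<delta>\<^sup>2\<close>.
\<close>

lemma gaussian_integral_negative:
  assumes g: "peval (($) a) g < 0" and supp: "\<And>r. r > 0 \<Longrightarrow> measure M (ball a r) > 0"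
  shows "\<exists>\<kappa>. (\<integral>y. exp (- (\<kappa>\<^sup>2 * (norm (y - a))\<^sup>2)) * peval (($) y) g \<partial>M) < 0"
proof -
  define c where "c = - peval (($) a) g / 2"
  have c: "c > 0" "peval (($) a) g < - c" using g by (simp_all add: c_def)
  have "isCont (\<lambda>y. peval (($) y) g) a"
    using continuous_on_peval[of UNIV "($)" g] by (simp add: continuous_on_eq_continuous_at continuous_intros)
  then have "((\<lambda>y. peval (($) y) g) \<longlongrightarrow> peval (($) a) g) (nhds a)"
    using tendsto_at_iff_tendsto_nhds[of "\<lambda>y. peval (($) y) g" a] by (simp add: isCont_def)
  then have "\<forall>\<^sub>F y in nhds a. peval (($) y) g < - c"
    by (rule order_tendstoD(2)) (rule c(2))
  then obtain \<delta> where \<delta>: "\<delta> > 0" "\<And>y. dist y a < \<delta> \<Longrightarrow> peval (($) y) g < - c"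
    unfolding eventually_nhds_metric by blast
  define m where "m = measure M (ball a (\<delta> / 2))"
  have m: "m > 0" using supp \<delta> by (simp add: m_def)
  define G where "G = (\<integral>y. \<bar>peval (($) y) g\<bar> \<partial>M)"
  have G: "G \<ge> 0" by (simp add: G_def)
  \<comment> \<open>Chosen such that \<open>exp (3 t / 4)\<close> exceeds \<open>G / (c m)\<close>.\<close>
  define t where "t = 4 / 3 * (G / (c * m))"
  have t: "t \<ge> 0" using G c m by (simp add: t_def)
  define \<kappa> where "\<kappa> = sqrt t / \<delta>"
  have \<kappa>: "\<kappa>\<^sup>2 * \<delta>\<^sup>2 = t" using t \<delta> by (simp add: \<kappa>_def power_divide)
  define E where "E y = exp (- (\<kappa>\<^sup>2 * (norm (y - a))\<^sup>2))" for y
  have E: "tame E" unfolding E_def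
    by (intro tame_bounded borel_measurable_continuous_onI continuous_intros) auto
  have I: "integrable M (indicat_real (ball a (\<delta> / 2)))"
  proof -
    have "tame (indicat_real (ball a (\<delta> / 2)))"
      by (rule tame_bounded) (auto intro: borel_measurable_indicator simp: indicator_def)
    then show ?thesis by (rule integrable_tame)
  qed
  have ball: "ball a (\<delta> / 2) \<in> sets M" by (simp add: sets_eq)
  have space: "space M = UNIV" using sets_eq_imp_space_eq[OF sets_eq] by simp
  have "(\<integral>y. E y * peval (($) y) g \<partial>M)
      \<le> (\<integral>y. - (c * exp (- (t / 4))) * indicat_real (ball a (\<delta> / 2)) y + exp (- t) * \<bar>peval (($) y) g\<bar> \<partial>M)"
  proof (rule integral_mono)
    show "integrable M (\<lambda>y. E y * peval (($) y) g)" by (intro integrable_tame tame_intros E)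
    show "integrable M (\<lambda>y. - (c * exp (- (t / 4))) * indicat_real (ball a (\<delta> / 2)) y + exp (- t) * \<bar>peval (($) y) g\<bar>)"
      by (intro Bochner_Integration.integrable_add integrable_mult_right I integrable_tame tame_intros)
    fix y
    have gy: "E y * peval (($) y) g \<le> - (c * E y)" if "dist y a < \<delta>"
      using \<delta>(2)[OF that] mult_left_mono[of "peval (($) y) g" "- c" "E y"] by (simp add: E_def mult.commute)
    consider "dist y a < \<delta> / 2" | "\<delta> / 2 \<le> dist y a" "dist y a < \<delta>" | "\<delta> \<le> dist y a" by linarith
    then show "E y * peval (($) y) g
        \<le> - (c * exp (- (t / 4))) * indicat_real (ball a (\<delta> / 2)) y + exp (- t) * \<bar>peval (($) y) g\<bar>"
    proof cases
      case 1
      have "(norm (y - a))\<^sup>2 \<le> (\<delta> / 2)\<^sup>2"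
        using 1 by (intro power_mono) (auto simp: dist_norm)
      then have "\<kappa>\<^sup>2 * (norm (y - a))\<^sup>2 \<le> \<kappa>\<^sup>2 * (\<delta> / 2)\<^sup>2"
        by (intro mult_left_mono) auto
      also have "\<dots> = t / 4" using \<kappa> by (simp add: power_divide)
      finally have "exp (- (t / 4)) \<le> E y" by (simp add: E_def)
      then have "c * exp (- (t / 4)) \<le> c * E y" using c by simp
      moreover have "dist y a < \<delta>" using 1 \<delta> by simp
      ultimately have "E y * peval (($) y) g \<le> - (c * exp (- (t / 4)))" using gy by linarith
      moreover have "0 \<le> exp (- t) * \<bar>peval (($) y) g\<bar>" by simp
      moreover have ind: "indicat_real (ball a (\<delta> / 2)) y = 1" using 1 by (simp add: dist_commute)
      ultimately show ?thesis unfolding ind by linarith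
    next
      case 2
      have "E y * peval (($) y) g \<le> 0"
        using gy[OF 2(2)] c by (simp add: E_def) (smt (verit) exp_gt_zero mult_nonneg_nonneg)
      moreover have "0 \<le> exp (- t) * \<bar>peval (($) y) g\<bar>" by simp
      moreover have ind: "indicat_real (ball a (\<delta> / 2)) y = 0" using 2 by (simp add: dist_commute)
      ultimately show ?thesis unfolding ind by linarith
    next
      case 3
      have "\<delta>\<^sup>2 \<le> (norm (y - a))\<^sup>2" using 3 \<delta> by (intro power_mono) (auto simp: dist_norm)
      then have "t \<le> \<kappa>\<^sup>2 * (norm (y - a))\<^sup>2" unfolding \<kappa>[symmetric] by (intro mult_left_mono) auto
      then have "E y \<le> exp (- t)" by (simp add: E_def)
      then have "E y * \<bar>peval (($) y) g\<bar> \<le> exp (- t) * \<bar>peval (($) y) g\<bar>"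
        by (intro mult_right_mono) auto
      moreover have "E y * peval (($) y) g \<le> E y * \<bar>peval (($) y) g\<bar>"
        by (intro mult_left_mono) (auto simp: E_def)
      moreover have ind: "indicat_real (ball a (\<delta> / 2)) y = 0" using 3 \<delta> by (simp add: dist_commute)
      ultimately show ?thesis unfolding ind by linarith
    qed
  qed
  also have "\<dots> = - (c * exp (- (t / 4))) * m + exp (- t) * G"
    using I by (subst Bochner_Integration.integral_add)
      (auto simp: m_def G_def space intro!: integrable_tame tame_intros)
  also have "\<dots> < 0"
  proof -
    have "G / (c * m) < exp (G / (c * m))" by (rule exp_gt_self)
    also have "G / (c * m) = 3 / 4 * t" by (simp add: t_def)
    finally have "G < c * m * exp (3 / 4 * t)"
      using c m by (simp add: t_def field_simps)
    then have "exp (- t) * G < exp (- t) * (c * m * exp (3 / 4 * t))" by simp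
    also have "\<dots> = c * m * (exp (- t) * exp (3 / 4 * t))" by simp
    also have "exp (- t) * exp (3 / 4 * t) = exp (- (t / 4))"
      by (simp add: exp_add[symmetric])
    finally show ?thesis by (simp add: mult_ac)
  qed
  finally show ?thesis unfolding E_def by blast
qed

text \<open>
  The square root of the Gaussian is approximated first by a product of cosines, with dominated
  convergence, and this product by a polynomial in \<open>L\<^sup>2\<close> with weight \<open>\<bar>g\<bar>\<close>.
\<close>

theorem exists_square_negative_integral:
  assumes g: "peval (($) a) g < 0" and supp: "\<And>r. r > 0 \<Longrightarrow> measure M (ball a r) > 0"
  shows "\<exists>p. (\<integral>y. (peval (($) y) p)\<^sup>2 * peval (($) y) g \<partial>M) < 0"
proof -
  obtain \<kappa> where \<kappa>: "(\<integral>y. exp (- (\<kappa>\<^sup>2 * (norm (y - a))\<^sup>2)) * peval (($) y) g \<partial>M) < 0"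
    using gaussian_integral_negative[OF assms] by blast
  define f where "f L y = (\<Prod>k\<in>UNIV. cos (\<kappa> / sqrt (real L) * y $ k + - (\<kappa> / sqrt (real L) * a $ k)) ^ L)" for L y
  have f: "tame (f L)" for L unfolding f_def by (intro tame_intros)
  have f1: "\<bar>f L y\<bar> \<le> 1" for L y
    unfolding f_def abs_prod power_abs by (intro prod_le_1) (auto intro: power_le_one)
  have lim: "(\<lambda>L. (f L y)\<^sup>2) \<longlonglongrightarrow> exp (- (\<kappa>\<^sup>2 * (norm (y - a))\<^sup>2))" for y
  proof -
    have "(\<lambda>L. (\<Prod>k\<in>UNIV. cos (\<kappa> * (y $ k - a $ k) / sqrt (real L)) ^ L)\<^sup>2)
        \<longlonglongrightarrow> (\<Prod>k\<in>UNIV. exp (- ((\<kappa> * (y $ k - a $ k))\<^sup>2 / 2)))\<^sup>2"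
      by (intro tendsto_power tendsto_prod cos_power_tendsto_gaussian)
    moreover have "(\<Prod>k\<in>UNIV. cos (\<kappa> * (y $ k - a $ k) / sqrt (real L)) ^ L) = f L y" for L
      unfolding f_def by (rule prod.cong) (auto simp: right_diff_distrib diff_divide_distrib)
    moreover have "(\<Prod>k\<in>UNIV. exp (- ((\<kappa> * (y $ k - a $ k))\<^sup>2 / 2)))\<^sup>2 = exp (- (\<kappa>\<^sup>2 * (norm (y - a))\<^sup>2))"
    proof -
      have "(\<Prod>k\<in>UNIV. exp (- ((\<kappa> * (y $ k - a $ k))\<^sup>2 / 2)))\<^sup>2 = (\<Prod>k\<in>UNIV. exp (- (\<kappa>\<^sup>2 * (y $ k - a $ k)\<^sup>2)))"
        unfolding prod_power_distrib exp_double[symmetric] by (simp add: power_mult_distrib)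
      also have "\<dots> = exp (- (\<kappa>\<^sup>2 * (\<Sum>k\<in>UNIV. (y $ k - a $ k)\<^sup>2)))"
        by (simp only: exp_sum[OF finite_class.finite_UNIV, symmetric] sum_negf sum_distrib_left)
      also have "(\<Sum>k\<in>UNIV. (y $ k - a $ k)\<^sup>2) = (norm (y - a))\<^sup>2"
        by (simp add: norm_vec_def L2_set_def sum_nonneg)
      finally show ?thesis .
    qed
    ultimately show ?thesis by simp
  qed
  have "(\<lambda>L. \<integral>y. (f L y)\<^sup>2 * peval (($) y) g \<partial>M)
      \<longlonglongrightarrow> (\<integral>y. exp (- (\<kappa>\<^sup>2 * (norm (y - a))\<^sup>2)) * peval (($) y) g \<partial>M)"
  proof (rule integral_dominated_convergence[where w = "\<lambda>y. \<bar>peval (($) y) g\<bar>"])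
    show "integrable M (\<lambda>y. \<bar>peval (($) y) g\<bar>)" by (intro integrable_tame tame_intros)
    show "AE y in M. (\<lambda>L. (f L y)\<^sup>2 * peval (($) y) g) \<longlonglongrightarrow> exp (- (\<kappa>\<^sup>2 * (norm (y - a))\<^sup>2)) * peval (($) y) g"
      by (intro AE_I2 tendsto_mult lim tendsto_const)
    show "AE y in M. norm ((f L y)\<^sup>2 * peval (($) y) g) \<le> \<bar>peval (($) y) g\<bar>" for L
      using f1 by (intro AE_I2) (auto simp: abs_mult abs_square_le_1 intro!: mult_left_le_one_le)
    show "(\<lambda>y. (f L y)\<^sup>2 * peval (($) y) g) \<in> borel_measurable M" for L
      by (intro measurable_tame tame_intros f)
    show "(\<lambda>y. exp (- (\<kappa>\<^sup>2 * (norm (y - a))\<^sup>2)) * peval (($) y) g) \<in> borel_measurable M"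
      by (intro measurable_tame tame_intros tame_bounded borel_measurable_continuous_onI continuous_intros) auto
  qed
  then have "\<forall>\<^sub>F L in sequentially. (\<integral>y. (f L y)\<^sup>2 * peval (($) y) g \<partial>M) < 0"
    using \<kappa> by (rule order_tendstoD)
  then obtain L where L: "(\<integral>y. (f L y)\<^sup>2 * peval (($) y) g \<partial>M) < 0"
    by (auto simp: eventually_sequentially)
  define \<eta> where "\<eta> = - (\<integral>y. (f L y)\<^sup>2 * peval (($) y) g \<partial>M)"
  have \<eta>: "\<eta> > 0" using L by (simp add: \<eta>_def)
  define w where "w y = \<bar>peval (($) y) g\<bar>" for y
  have w: "tame w" "\<And>y. w y \<ge> 0" unfolding w_def by (auto intro: tame_intros)
  define W where "W = (\<integral>y. w y \<partial>M)"
  have W: "W \<ge> 0" using w by (simp add: W_def)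
  \<comment> \<open>The weight in \<open>2 \<bar>A - B\<bar> \<le> s (A - B)\<^sup>2 + 1 / s\<close>, which makes the last term cost less than \<open>\<eta> / 2\<close>.\<close>
  define s where "s = 2 * W / \<eta> + 1"
  have s: "s > 0" "W / s < \<eta> / 2"
  proof -
    show s: "s > 0" using W \<eta> by (simp add: s_def add_nonneg_pos)
    have "2 * W < \<eta> * s" using \<eta> by (simp add: s_def distrib_left)
    then show "W / s < \<eta> / 2" using s by (simp add: divide_less_eq)
  qed
  have "poly_multiples_dense w (f L)"
    unfolding f_def by (intro poly_multiples_dense_prod_cos w) auto
  moreover have "\<eta> / (2 * (1 + s)) > 0" using \<eta> s by simp
  ultimately obtain p where p: "(\<integral>y. (f L y * peval (($) y) 1 - peval (($) y) p)\<^sup>2 * w y \<partial>M) < \<eta> / (2 * (1 + s))"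
    unfolding poly_multiples_dense_def by blast
  define D where "D = (\<integral>y. (f L y - peval (($) y) p)\<^sup>2 * w y \<partial>M)"
  have D: "(1 + s) * D < \<eta> / 2" using p s by (simp add: D_def field_simps)
  have "(\<integral>y. (peval (($) y) p)\<^sup>2 * peval (($) y) g \<partial>M)
      \<le> (\<integral>y. (f L y)\<^sup>2 * peval (($) y) g + ((1 + s) * ((f L y - peval (($) y) p)\<^sup>2 * w y) + 1 / s * w y) \<partial>M)"
  proof (rule integral_tame_mono)
    fix y
    define A B where "A = f L y" and "B = peval (($) y) p"
    have A: "\<bar>A\<bar> \<le> 1" using f1 by (simp add: A_def)
    have "2 * \<bar>A - B\<bar> \<le> s * (A - B)\<^sup>2 + 1 / s"
    proof -
      have "0 \<le> (s * \<bar>A - B\<bar> - 1)\<^sup>2 / s" using s by simp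
      also have "\<dots> = s * (A - B)\<^sup>2 + 1 / s - 2 * \<bar>A - B\<bar>"
        using s by (simp add: power2_diff power_mult_distrib add_divide_distrib diff_divide_distrib
            power2_eq_square[of s])
      finally show ?thesis by simp
    qed
    moreover have "\<bar>2 * A * (A - B)\<bar> \<le> 2 * \<bar>A - B\<bar>"
      using mult_right_mono[OF A, of "\<bar>A - B\<bar>"] by (simp add: abs_mult)
    moreover have "B\<^sup>2 - A\<^sup>2 = (A - B)\<^sup>2 - 2 * A * (A - B)"
      by (simp add: power2_eq_square algebra_simps)
    moreover have "0 \<le> (A - B)\<^sup>2" by simp
    moreover have "\<bar>X - Z\<bar> \<le> X + P" if "\<bar>Z\<bar> \<le> Q" "Q \<le> P" "0 \<le> X" for X Z P Q :: real
      using that by linarith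
    ultimately have "\<bar>B\<^sup>2 - A\<^sup>2\<bar> \<le> (A - B)\<^sup>2 + (s * (A - B)\<^sup>2 + 1 / s)"
      by metis
    then have "\<bar>B\<^sup>2 - A\<^sup>2\<bar> \<le> (1 + s) * (A - B)\<^sup>2 + 1 / s"
      by (simp only: distrib_right mult_1_left add.assoc)
    then have "\<bar>B\<^sup>2 - A\<^sup>2\<bar> * w y \<le> ((1 + s) * (A - B)\<^sup>2 + 1 / s) * w y"
      using w by (intro mult_right_mono)
    moreover have "(B\<^sup>2 - A\<^sup>2) * peval (($) y) g \<le> \<bar>B\<^sup>2 - A\<^sup>2\<bar> * w y"
      unfolding w_def abs_mult[symmetric] by simp
    ultimately show "(peval (($) y) p)\<^sup>2 * peval (($) y) g
        \<le> (f L y)\<^sup>2 * peval (($) y) g + ((1 + s) * ((f L y - peval (($) y) p)\<^sup>2 * w y) + 1 / s * w y)"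
      unfolding A_def[symmetric] B_def[symmetric] by (simp add: algebra_simps)
  qed (intro tame_intros f w)+
  also have "\<dots> = - \<eta> + ((1 + s) * D + 1 / s * W)"
    by (subst integral_tame_add, (intro tame_intros f w)+, subst integral_tame_add, (intro tame_intros f w)+,
        simp add: \<eta>_def D_def W_def)
  also have "\<dots> < 0"
  proof -
    have "1 / s * W = W / s" by simp
    then show ?thesis using D s(2) by linarith
  qed
  finally show ?thesis by blast
qed

end

section \<open>Bernstein coefficients\<close>

text \<open>
  The coefficient of the \<open>j\<close>-th Bernstein polynomial of degree \<open>M\<close> in the expansion of \<open>u ^ k\<close>.
\<close>

definition bernstein_weight :: "nat \<Rightarrow> nat \<Rightarrow> nat \<Rightarrow> real" where
  "bernstein_weight M k j = real (j choose k) / real (M choose k)"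

lemma bernstein_power:
  fixes u :: real
  assumes "k \<le> M"
  shows "u ^ k = (\<Sum>j\<le>M. bernstein_weight M k j * (real (M choose j) * u ^ j * (1 - u) ^ (M - j)))"
proof -
  have "(\<Sum>j\<le>M. bernstein_weight M k j * (real (M choose j) * u ^ j * (1 - u) ^ (M - j)))
      = (\<Sum>j\<in>{k..M}. bernstein_weight M k j * (real (M choose j) * u ^ j * (1 - u) ^ (M - j)))"
    by (rule sum.mono_neutral_right) (auto simp: bernstein_weight_def)
  also have "\<dots> = (\<Sum>j\<in>{k..M}. real ((M - k) choose (j - k)) * u ^ j * (1 - u) ^ (M - j))"
  proof (rule sum.cong[OF refl])
    fix j assume j: "j \<in> {k..M}"
    have "real (M choose j) * real (j choose k) = real (M choose k) * real ((M - k) choose (j - k))"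
      using choose_mult[of k j M] j by (simp flip: of_nat_mult)
    moreover have "real (M choose k) \<noteq> 0" using assms by simp
    ultimately have "bernstein_weight M k j * real (M choose j) = real ((M - k) choose (j - k))"
      by (simp add: bernstein_weight_def divide_eq_eq mult.commute)
    then show "bernstein_weight M k j * (real (M choose j) * u ^ j * (1 - u) ^ (M - j))
        = real ((M - k) choose (j - k)) * u ^ j * (1 - u) ^ (M - j)"
      by (simp add: mult.assoc[symmetric])
  qed
  also have "\<dots> = (\<Sum>i\<le>M - k. real ((M - k) choose i) * u ^ (i + k) * (1 - u) ^ (M - k - i))"
    by (rule sum.reindex_bij_witness[where i = "\<lambda>i. i + k" and j = "\<lambda>j. j - k"]) (use assms in auto)
  also have "\<dots> = u ^ k * (u + (1 - u)) ^ (M - k)"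
    unfolding binomial_ring by (simp add: sum_distrib_left power_add mult_ac)
  finally show ?thesis by simp
qed

lemma bernstein_weight_Suc:
  assumes "k < M"
  shows "bernstein_weight M (Suc k) j = bernstein_weight M k j * (real (j - k) / real (M - k))"
proof -
  have step: "real (Suc k) * real (n choose Suc k) = real (n - k) * real (n choose k)" for n
    using binomial_absorption[of k n] binomial_absorb_comp[of n k] by (metis of_nat_mult)
  have "bernstein_weight M (Suc k) j = (real (Suc k) * real (j choose Suc k)) / (real (Suc k) * real (M choose Suc k))"
    by (simp add: bernstein_weight_def del: of_nat_Suc)
  also have "\<dots> = (real (j - k) * real (j choose k)) / (real (M - k) * real (M choose k))"
    unfolding step ..
  finally show ?thesis by (simp add: bernstein_weight_def mult.commute)
qed

lemma bernstein_weight_range: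
  assumes "j \<le> M" "k \<le> M"
  shows "0 \<le> bernstein_weight M k j" "bernstein_weight M k j \<le> 1"
  using assms binomial_right_mono[of j M k] by (auto simp: bernstein_weight_def divide_le_eq)

text \<open>
  The coefficient is a product of \<open>k\<close> factors \<open>(j - i) / (M - i)\<close>, each of them close to \<open>j / M\<close> for
  large \<open>M\<close>.
\<close>

lemma bernstein_weight_approx:
  assumes "j \<le> M" "k \<le> D" "2 * D < M"
  shows "\<bar>bernstein_weight M k j - (real j / real M) ^ k\<bar> \<le> real k * (2 * real D / real M)"
  using \<open>k \<le> D\<close>
proof (induction k)
  case (Suc k)
  define a b where "a = bernstein_weight M k j" and "b = (real j / real M) ^ k"
  define c d where "c = real (j - k) / real (M - k)" and "d = real j / real M"
  have M: "real M > 0" "real (M - k) > 0" "k \<le> M" using Suc.prems assms by auto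
  have a: "0 \<le> a" "a \<le> 1" using bernstein_weight_range[of j M k] assms M by (auto simp: a_def)
  have d: "0 \<le> d" "d \<le> 1" using assms M by (auto simp: d_def divide_le_eq)
  have cd: "\<bar>c - d\<bar> \<le> 2 * real D / real M"
  proof -
    have half: "real k / real (M - k) \<le> 2 * real D / real M"
    proof -
      have "real k * real M \<le> real D * real M" using Suc.prems by (intro mult_right_mono) auto
      moreover have "real D * real M \<le> 2 * real D * real (M - k)"
      proof -
        have "real M \<le> 2 * real (M - k)" using Suc.prems assms by simp
        from mult_left_mono[OF this, of "real D"] show ?thesis by simp
      qed
      ultimately have "real k * real M \<le> 2 * real D * real (M - k)" by linarith
      moreover have "a / b \<le> c / d" if "a * d \<le> c * b" "b > 0" "d > 0" for a b c d :: real
        using that by (simp add: field_simps)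
      ultimately show ?thesis using M by blast
    qed
    have "\<bar>c - d\<bar> \<le> real k / real (M - k)"
    proof (cases "k \<le> j")
      case True
      have "d - c = (real k / real (M - k)) * ((real M - real j) / real M)"
        using True M by (simp add: c_def d_def of_nat_diff field_simps)
      moreover have "0 \<le> (real M - real j) / real M" "(real M - real j) / real M \<le> 1"
        using assms M by (auto simp: divide_le_eq)
      moreover have "0 \<le> real k / real (M - k)" by simp
      moreover have "\<bar>y - x\<bar> \<le> f" if "x - y = f * g" "0 \<le> g" "g \<le> 1" "0 \<le> f" for x y f g :: real
        using that mult_left_le[of g f] mult_nonneg_nonneg[of f g] by linarith
      ultimately show ?thesis by blast
    next
      case False
      then have "c = 0" by (simp add: c_def)
      moreover have "d \<le> real k / real (M - k)"
        unfolding d_def using False M by (intro frac_le) auto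
      ultimately show ?thesis using d by simp
    qed
    from this half show ?thesis by (rule order.trans)
  qed
  have "bernstein_weight M (Suc k) j - (real j / real M) ^ Suc k = a * (c - d) + (a - b) * d"
    using bernstein_weight_Suc[of k M j] Suc.prems assms by (simp add: a_def b_def c_def d_def algebra_simps)
  also have "\<bar>\<dots>\<bar> \<le> \<bar>a * (c - d)\<bar> + \<bar>(a - b) * d\<bar>" by (rule abs_triangle_ineq)
  also have "\<dots> \<le> \<bar>c - d\<bar> + \<bar>a - b\<bar>"
    unfolding abs_mult using a d by (intro add_mono mult_left_le_one_le mult_right_le_one_le) auto
  also have "\<dots> \<le> 2 * real D / real M + real k * (2 * real D / real M)"
    using cd Suc unfolding a_def b_def by (intro add_mono) auto
  finally show ?case by (simp add: distrib_right add_divide_distrib)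
qed (simp add: bernstein_weight_def)

definition bernstein_coeff :: "nat \<Rightarrow> ('w \<Rightarrow> nat) \<Rightarrow> 'w::finite rpoly \<Rightarrow> real" where
  "bernstein_coeff M J p = (\<Sum>t\<in>Poly_Mapping.keys p.
     Poly_Mapping.lookup p t * (\<Prod>w\<in>UNIV. bernstein_weight M (Poly_Mapping.lookup t w) (J w)))"

lemma lookup_le_deg:
  fixes p :: "'w::finite rpoly"
  assumes "deg_in UNIV p \<le> D" "t \<in> Poly_Mapping.keys p"
  shows "Poly_Mapping.lookup t w \<le> D"
proof -
  have "Poly_Mapping.lookup t w \<le> vdeg UNIV t"
    unfolding vdeg_def by (rule member_le_sum) auto
  then show ?thesis using assms by (auto simp: deg_in_le_iff)
qed

lemma peval_bernstein:
  fixes p :: "'w::finite rpoly"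
  assumes "deg_in UNIV p \<le> M"
  shows "peval u p = (\<Sum>J\<in>PiE UNIV (\<lambda>_. {..M}). bernstein_coeff M J p *
           (\<Prod>w\<in>UNIV. real (M choose J w) * u w ^ J w * (1 - u w) ^ (M - J w)))"
proof -
  have "mono_eval u t = (\<Sum>J\<in>PiE UNIV (\<lambda>_. {..M}). (\<Prod>w\<in>UNIV. bernstein_weight M (Poly_Mapping.lookup t w) (J w)) *
      (\<Prod>w\<in>UNIV. real (M choose J w) * u w ^ J w * (1 - u w) ^ (M - J w)))"
    if "t \<in> Poly_Mapping.keys p" for t
  proof -
    have "mono_eval u t = (\<Prod>w\<in>UNIV. \<Sum>j\<le>M. bernstein_weight M (Poly_Mapping.lookup t w) j *
        (real (M choose j) * u w ^ j * (1 - u w) ^ (M - j)))"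
      unfolding mono_eval_def
      using lookup_le_deg[OF assms that] by (intro prod.cong refl bernstein_power)
    also have "\<dots> = (\<Sum>J\<in>PiE UNIV (\<lambda>_. {..M}). \<Prod>w\<in>UNIV. bernstein_weight M (Poly_Mapping.lookup t w) (J w) *
        (real (M choose J w) * u w ^ J w * (1 - u w) ^ (M - J w)))"
      by (rule prod_sum_PiE) auto
    finally show ?thesis by (simp only: prod.distrib)
  qed
  then have "peval u p = (\<Sum>t\<in>Poly_Mapping.keys p. \<Sum>J\<in>PiE UNIV (\<lambda>_. {..M}).
      Poly_Mapping.lookup p t * (\<Prod>w\<in>UNIV. bernstein_weight M (Poly_Mapping.lookup t w) (J w)) *
      (\<Prod>w\<in>UNIV. real (M choose J w) * u w ^ J w * (1 - u w) ^ (M - J w)))"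
    unfolding peval_def by (simp add: sum_distrib_left mult.assoc)
  also have "\<dots> = (\<Sum>J\<in>PiE UNIV (\<lambda>_. {..M}). \<Sum>t\<in>Poly_Mapping.keys p.
      Poly_Mapping.lookup p t * (\<Prod>w\<in>UNIV. bernstein_weight M (Poly_Mapping.lookup t w) (J w)) *
      (\<Prod>w\<in>UNIV. real (M choose J w) * u w ^ J w * (1 - u w) ^ (M - J w)))"
    by (rule sum.swap)
  finally show ?thesis by (simp add: bernstein_coeff_def sum_distrib_right)
qed

text \<open>
  Hence a polynomial that is positive on the cube has positive Bernstein coefficients for
  large \<open>M\<close>. Unlike an approximation by Bernstein operators, the expansion is exact.
\<close>

lemma bernstein_coeff_approx:
  fixes p :: "'w::finite rpoly"
  assumes "e > 0"
  shows "\<exists>M0. \<forall>M\<ge>M0. \<forall>J. (\<forall>w. J w \<le> M) \<longrightarrow> \<bar>bernstein_coeff M J p - peval (\<lambda>w. real (J w) / real M) p\<bar> < e"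
proof -
  define D where "D = deg_in UNIV p"
  define c where "c = (\<Sum>t\<in>Poly_Mapping.keys p. \<bar>Poly_Mapping.lookup p t\<bar>) * (real CARD('w) * (real D * (2 * real D)))"
  have c: "c \<ge> 0" by (simp add: c_def sum_nonneg)
  obtain M1 :: nat where M1: "real M1 > c / e" using reals_Archimedean2 by blast
  show ?thesis
  proof (intro exI[of _ "Suc (M1 + 2 * D)"] allI impI)
    fix M J assume M: "Suc (M1 + 2 * D) \<le> M" and J: "\<forall>w :: 'w. J w \<le> M"
    have Mpos: "real M > 0" "2 * D < M" using M by auto
    have "bernstein_coeff M J p - peval (\<lambda>w. real (J w) / real M) p
        = (\<Sum>t\<in>Poly_Mapping.keys p. Poly_Mapping.lookup p t * ((\<Prod>w\<in>UNIV. bernstein_weight M (Poly_Mapping.lookup t w) (J w))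
            - (\<Prod>w\<in>UNIV. (real (J w) / real M) ^ Poly_Mapping.lookup t w)))"
      by (simp add: bernstein_coeff_def peval_def mono_eval_def right_diff_distrib sum_subtractf)
    also have "\<bar>\<dots>\<bar> \<le> (\<Sum>t\<in>Poly_Mapping.keys p. \<bar>Poly_Mapping.lookup p t\<bar> * (real CARD('w) * (real D * (2 * real D / real M))))"
    proof (rule order.trans[OF sum_abs], rule sum_mono)
      fix t assume t: "t \<in> Poly_Mapping.keys p"
      have tD: "Poly_Mapping.lookup t w \<le> D" for w
        using lookup_le_deg[OF _ t] by (simp add: D_def)
      have "norm ((\<Prod>w\<in>UNIV. bernstein_weight M (Poly_Mapping.lookup t w) (J w))
            - (\<Prod>w\<in>UNIV. (real (J w) / real M) ^ Poly_Mapping.lookup t w))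
          \<le> (\<Sum>w\<in>UNIV. norm (bernstein_weight M (Poly_Mapping.lookup t w) (J w) - (real (J w) / real M) ^ Poly_Mapping.lookup t w))"
      proof (rule norm_prod_diff)
        fix w
        have "Poly_Mapping.lookup t w \<le> M" using tD[of w] Mpos by linarith
        then show "norm (bernstein_weight M (Poly_Mapping.lookup t w) (J w)) \<le> 1"
          using bernstein_weight_range[of "J w" M "Poly_Mapping.lookup t w"] J by simp
        show "norm ((real (J w) / real M) ^ Poly_Mapping.lookup t w) \<le> 1"
          using J Mpos by (simp add: power_le_one divide_le_eq)
      qed
      also have "\<dots> \<le> (\<Sum>w\<in>(UNIV :: 'w set). real D * (2 * real D / real M))"
      proof (rule sum_mono)
        fix w :: 'w
        have "norm (bernstein_weight M (Poly_Mapping.lookup t w) (J w) - (real (J w) / real M) ^ Poly_Mapping.lookup t w)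
            \<le> real (Poly_Mapping.lookup t w) * (2 * real D / real M)"
          unfolding real_norm_def using J tD Mpos by (intro bernstein_weight_approx) auto
        also have "\<dots> \<le> real D * (2 * real D / real M)"
          using tD[of w] by (intro mult_right_mono) auto
        finally show "norm (bernstein_weight M (Poly_Mapping.lookup t w) (J w) - (real (J w) / real M) ^ Poly_Mapping.lookup t w)
            \<le> real D * (2 * real D / real M)" .
      qed
      finally have "\<bar>(\<Prod>w\<in>UNIV. bernstein_weight M (Poly_Mapping.lookup t w) (J w))
            - (\<Prod>w\<in>UNIV. (real (J w) / real M) ^ Poly_Mapping.lookup t w)\<bar>
          \<le> real CARD('w) * (real D * (2 * real D / real M))" by simp
      then show "\<bar>Poly_Mapping.lookup p t * ((\<Prod>w\<in>UNIV. bernstein_weight M (Poly_Mapping.lookup t w) (J w))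
            - (\<Prod>w\<in>UNIV. (real (J w) / real M) ^ Poly_Mapping.lookup t w))\<bar>
          \<le> \<bar>Poly_Mapping.lookup p t\<bar> * (real CARD('w) * (real D * (2 * real D / real M)))"
        unfolding abs_mult by (intro mult_left_mono) auto
    qed
    also have "\<dots> = c / real M" by (simp add: c_def sum_distrib_right sum_divide_distrib)
    also have "\<dots> < e"
    proof -
      have "c / e < real M" using M1 M by linarith
      then show ?thesis using assms Mpos by (simp add: divide_less_eq mult.commute)
    qed
    finally show "\<bar>bernstein_coeff M J p - peval (\<lambda>w. real (J w) / real M) p\<bar> < e" .
  qed
qed

section \<open>Bernstein products as sums of squares\<close>

text \<open>
  Homogeneous coordinates \<open>(1, x)\<close> with \<open>None\<close> for the coordinate \<open>1\<close>, so that the sum of their squares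
  is \<open>\<theta>\<close>.
\<close>

definition coord :: "'n option \<Rightarrow> 'n rpoly" where
  "coord a = (case a of None \<Rightarrow> 1 | Some v \<Rightarrow> Var v)"

lemma UNIV_option_sum: "(\<Sum>a\<in>UNIV. f a) = f None + (\<Sum>v\<in>UNIV. f (Some v))"
  for f :: "'n::finite option \<Rightarrow> 'b::comm_monoid_add"
  unfolding UNIV_option_conv by (subst sum.insert) (auto simp: sum.reindex)

lemma sum_coord_squares: "(\<Sum>a\<in>UNIV. (peval x (coord a))\<^sup>2) = peval x (theta :: 'n::finite rpoly)"
  unfolding UNIV_option_sum by (simp add: coord_def peval_theta)

lemma sos_theta_minus_coord: "sos (theta - (coord a)\<^sup>2 :: 'n::finite rpoly)"
  by (cases a) (simp_all add: coord_def sos_theta_minus sos_theta_minus_one)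

text \<open>
  A number \<open>t\<close> with \<open>t\<^sup>2 = \<theta>(x)\<close> plays the role of \<open>\<surd>\<theta>\<close>. The products below are polynomials in \<open>x\<close>
  and \<open>t\<close>, hence of the form \<open>p + t q\<close>.
\<close>

definition root_linear :: "(('n::finite \<Rightarrow> real) \<Rightarrow> real \<Rightarrow> real) \<Rightarrow> bool" where
  "root_linear f \<longleftrightarrow> (\<exists>p q. \<forall>x t. t\<^sup>2 = peval x theta \<longrightarrow> f x t = peval x p + t * peval x q)"

lemma root_linear_mult:
  assumes "root_linear f" "root_linear g"
  shows "root_linear (\<lambda>x t. f x t * g x t)"
proof -
  obtain p q p' q' where f: "\<And>x t. t\<^sup>2 = peval x theta \<Longrightarrow> f x t = peval x p + t * peval x q"
    and g: "\<And>x t. t\<^sup>2 = peval x theta \<Longrightarrow> g x t = peval x p' + t * peval x q'"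
    using assms unfolding root_linear_def by metis
  have "f x t * g x t = peval x (p * p' + theta * q * q') + t * peval x (p * q' + q * p')"
    if "t\<^sup>2 = peval x theta" for x t
    using f[OF that] g[OF that] by (simp add: that[symmetric] power2_eq_square algebra_simps)
  then show ?thesis unfolding root_linear_def by blast
qed

lemma root_linear_one: "root_linear (\<lambda>x t. 1)"
  unfolding root_linear_def by (intro exI[of _ 1] exI[of _ 0]) simp

lemma root_linear_power: "root_linear f \<Longrightarrow> root_linear (\<lambda>x t. f x t ^ n)"
  by (induction n) (auto intro: root_linear_mult root_linear_one)

lemma root_linear_plus_coord: "root_linear (\<lambda>x t. t + peval x p)"
  unfolding root_linear_def by (intro exI[of _ p] exI[of _ 1]) simp

lemma root_linear_minus_coord: "root_linear (\<lambda>x t. t - peval x p)"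
  unfolding root_linear_def by (intro exI[of _ "- p"] exI[of _ 1]) simp

text \<open>
  For odd \<open>j\<close> one factor \<open>(t + X) (t - X) = \<theta> - X\<^sup>2\<close> remains besides a square, and it is itself a sum
  of squares. The total degree \<open>2 m\<close> is even, so the two exponents have the same parity.
\<close>

lemma bernstein_factor_square:
  fixes a :: "'n::finite option"
  assumes "j \<le> 2 * m"
  shows "\<exists>\<sigma> f. sos \<sigma> \<and> root_linear f \<and> (\<forall>x t. t\<^sup>2 = peval x theta \<longrightarrow>
    (t + peval x (coord a)) ^ j * (t - peval x (coord a)) ^ (2 * m - j) = peval x \<sigma> * (f x t)\<^sup>2)"
proof (cases "even j")
  case True
  then obtain i where i: "j = 2 * i" by (elim evenE)
  let ?f = "\<lambda>x t. (t + peval x (coord a)) ^ i * (t - peval x (coord a)) ^ (m - i)"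
  have "2 * m - j = 2 * (m - i)" using i by simp
  then have "(t + peval x (coord a)) ^ j * (t - peval x (coord a)) ^ (2 * m - j) = peval x 1 * (?f x t)\<^sup>2" for x t
    by (simp add: i power_mult_distrib power_mult[symmetric] mult.commute)
  moreover have "root_linear ?f"
    by (intro root_linear_mult root_linear_power root_linear_plus_coord root_linear_minus_coord)
  ultimately show ?thesis using sos_one by blast
next
  case False
  then obtain i where i: "j = 2 * i + 1" by (elim oddE)
  let ?f = "\<lambda>x t. (t + peval x (coord a)) ^ i * (t - peval x (coord a)) ^ (m - i - 1)"
  have e: "2 * m - j = Suc (2 * (m - i - 1))" "j = Suc (2 * i)" using i assms by auto
  have "(t + peval x (coord a)) ^ j * (t - peval x (coord a)) ^ (2 * m - j)
      = peval x (theta - (coord a)\<^sup>2) * (?f x t)\<^sup>2" if "t\<^sup>2 = peval x theta" for x t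
  proof -
    define A B where "A = t + peval x (coord a)" and "B = t - peval x (coord a)"
    have "A * B = peval x (theta - (coord a)\<^sup>2)"
      by (simp add: A_def B_def that[symmetric] power2_eq_square algebra_simps)
    moreover have "A ^ j * B ^ (2 * m - j) = (A * B) * (A ^ i * B ^ (m - i - 1))\<^sup>2"
    proof -
      have "A ^ j = A * (A ^ i)\<^sup>2"
        unfolding e(2) power_Suc power_mult[symmetric] by (simp add: mult.commute)
      moreover have "B ^ (2 * m - j) = B * (B ^ (m - i - 1))\<^sup>2"
        unfolding e(1) power_Suc power_mult[symmetric] by (simp only: mult.commute)
      ultimately show ?thesis by (simp only: power_mult_distrib mult_ac)
    qed
    ultimately show ?thesis by (simp only: A_def B_def)
  qed
  moreover have "root_linear ?f"
    by (intro root_linear_mult root_linear_power root_linear_plus_coord root_linear_minus_coord)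
  ultimately show ?thesis using sos_theta_minus_coord[of a] by blast
qed

abbreviation bernstein_product where
  "bernstein_product A m J x t \<equiv>
     (\<Prod>a\<in>A. (t + peval x (coord a)) ^ J a * (t - peval x (coord a)) ^ (2 * m - J a))"

lemma bernstein_product_square:
  fixes A :: "'n::finite option set"
  assumes "finite A" "\<And>a. J a \<le> 2 * m"
  shows "\<exists>\<sigma> f. sos \<sigma> \<and> root_linear f \<and> (\<forall>x t. t\<^sup>2 = peval x theta \<longrightarrow>
    bernstein_product A m J x t = peval x \<sigma> * (f x t)\<^sup>2)"
  using assms(1)
proof (induction A rule: finite_induct)
  case empty
  show ?case
    by (intro exI[of _ 1] exI[of _ "\<lambda>_ _. 1"]) (simp add: sos_one root_linear_one)
next
  case (insert a A)
  obtain \<sigma> f where 1: "sos \<sigma>" "root_linear f" "\<And>x t. t\<^sup>2 = peval x theta \<Longrightarrow>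
    bernstein_product A m J x t = peval x \<sigma> * (f x t)\<^sup>2"
    using insert.IH by blast
  obtain \<sigma>' f' where 2: "sos \<sigma>'" "root_linear f'" "\<And>x t. t\<^sup>2 = peval x theta \<Longrightarrow>
    (t + peval x (coord a)) ^ J a * (t - peval x (coord a)) ^ (2 * m - J a) = peval x \<sigma>' * (f' x t)\<^sup>2"
    using bernstein_factor_square[OF assms(2)[of a], of a] by blast
  have "bernstein_product (insert a A) m J x t
      = peval x (\<sigma>' * \<sigma>) * (f' x t * f x t)\<^sup>2" if "t\<^sup>2 = peval x theta" for x t
    using insert.hyps 1(3)[OF that] 2(3)[OF that] by (simp add: power_mult_distrib mult_ac)
  then show ?case
    using sos_mult[OF 2(1) 1(1)] root_linear_mult[OF 2(2) 1(2)]
    by (intro exI[of _ "\<sigma>' * \<sigma>"] exI[of _ "\<lambda>x t. f' x t * f x t"]) simp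
qed

text \<open>
  Adding the values for \<open>t\<close> and \<open>- t\<close> removes \<open>t\<close>:
  \<open>(p + t q)\<^sup>2 + (p - t q)\<^sup>2 = 2 (p\<^sup>2 + \<theta> q\<^sup>2)\<close>.
\<close>

lemma bernstein_product_sos:
  fixes J :: "'n::finite option \<Rightarrow> nat"
  assumes "\<And>a. J a \<le> 2 * m"
  shows "\<exists>s. sos s \<and> (\<forall>x t. t\<^sup>2 = peval x theta \<longrightarrow>
    bernstein_product UNIV m J x t
    + bernstein_product UNIV m J x (- t) = 2 * peval x s)"
proof -
  obtain \<sigma> f where 1: "sos \<sigma>" "root_linear f" "\<And>x t. t\<^sup>2 = peval x theta \<Longrightarrow>
    bernstein_product UNIV m J x t = peval x \<sigma> * (f x t)\<^sup>2"
    using bernstein_product_square[where A = UNIV and J = J and m = m] assms by auto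
  obtain p q where pq: "\<And>x t. t\<^sup>2 = peval x theta \<Longrightarrow> f x t = peval x p + t * peval x q"
    using 1(2) unfolding root_linear_def by blast
  have "sos (\<sigma> * (p\<^sup>2 + theta * q\<^sup>2))"
    by (intro sos_mult sos_add sos_square sos_theta 1)
  moreover have "bernstein_product UNIV m J x t
    + bernstein_product UNIV m J x (- t)
    = 2 * peval x (\<sigma> * (p\<^sup>2 + theta * q\<^sup>2))" if t: "t\<^sup>2 = peval x theta" for x t
  proof -
    have t': "(- t)\<^sup>2 = peval x theta" using t by simp
    show ?thesis unfolding 1(3)[OF t] 1(3)[OF t'] pq[OF t] pq[OF t']
      by (simp add: t[symmetric] power2_eq_square algebra_simps)
  qed
  ultimately show ?thesis by blast
qed

definition homog :: "nat \<Rightarrow> 'n::finite rpoly \<Rightarrow> 'n option rpoly" where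
  "homog D q = (\<Sum>t\<in>Poly_Mapping.keys q. Const (Poly_Mapping.lookup q t)
     * (Var None ^ (D - vdeg UNIV t) * (\<Prod>v\<in>UNIV. Var (Some v) ^ Poly_Mapping.lookup t v)))"

lemma peval_homog:
  assumes "deg_in UNIV q \<le> D" "z None \<noteq> 0"
  shows "peval z (homog D q) = z None ^ D * peval (\<lambda>v. z (Some v) / z None) q"
proof -
  have "z None ^ (D - vdeg UNIV t) * (\<Prod>v\<in>UNIV. z (Some v) ^ Poly_Mapping.lookup t v)
      = z None ^ D * mono_eval (\<lambda>v. z (Some v) / z None) t" if "t \<in> Poly_Mapping.keys q" for t
  proof -
    have "vdeg UNIV t \<le> D" using assms(1) that by (simp add: deg_in_le_iff)
    then have "z None ^ D = z None ^ (D - vdeg UNIV t) * z None ^ vdeg UNIV t"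
      by (simp add: power_add[symmetric])
    moreover have "z None ^ vdeg UNIV t * mono_eval (\<lambda>v. z (Some v) / z None) t
        = (\<Prod>v\<in>UNIV. z (Some v) ^ Poly_Mapping.lookup t v)"
      unfolding vdeg_def power_sum mono_eval_def prod.distrib[symmetric]
      using assms(2) by (intro prod.cong) (auto simp: power_divide)
    ultimately show ?thesis by (simp add: mult.assoc)
  qed
  then have "peval z (homog D q)
      = (\<Sum>t\<in>Poly_Mapping.keys q. Poly_Mapping.lookup q t * (z None ^ D * mono_eval (\<lambda>v. z (Some v) / z None) t))"
    by (simp add: homog_def)
  then show ?thesis unfolding peval_def by (simp add: sum_distrib_left mult_ac)
qed

text \<open>
  For \<open>z\<^sub>0 \<noteq> 0\<close> this is the hypothesis at \<open>x = z / z\<^sub>0\<close>, scaled; the points at infinity follow by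
  continuity.
\<close>

lemma homog_positive:
  fixes Q :: "'p::finite \<Rightarrow> 'p \<Rightarrow> 'n::finite rpoly"
  assumes deg: "\<And>i j. deg_in UNIV (Q i j) \<le> 2 * l"
    and pos: "\<And>x. \<delta> * peval x theta ^ l * (\<Sum>i\<in>UNIV. (v i)\<^sup>2) \<le> (\<Sum>i\<in>UNIV. \<Sum>j\<in>UNIV. v i * v j * peval x (Q i j))"
  shows "\<delta> * (\<Sum>a\<in>UNIV. (z a)\<^sup>2) ^ l * (\<Sum>i\<in>UNIV. (v i)\<^sup>2)
    \<le> (\<Sum>i\<in>UNIV. \<Sum>j\<in>UNIV. v i * v j * peval z (homog (2 * l) (Q i j)))"
proof -
  have nz: "\<delta> * (\<Sum>a\<in>UNIV. (z a)\<^sup>2) ^ l * (\<Sum>i\<in>UNIV. (v i)\<^sup>2)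
    \<le> (\<Sum>i\<in>UNIV. \<Sum>j\<in>UNIV. v i * v j * peval z (homog (2 * l) (Q i j)))" if z: "z None \<noteq> 0" for z
  proof -
    define x where "x v = z (Some v) / z None" for v
    have "(\<Sum>a\<in>UNIV. (z a)\<^sup>2) = (z None)\<^sup>2 * peval x theta"
      using z by (simp add: UNIV_option_sum peval_theta x_def power_divide distrib_left sum_distrib_left)
    then have "\<delta> * (\<Sum>a\<in>UNIV. (z a)\<^sup>2) ^ l * (\<Sum>i\<in>UNIV. (v i)\<^sup>2)
        = z None ^ (2 * l) * (\<delta> * peval x theta ^ l * (\<Sum>i\<in>UNIV. (v i)\<^sup>2))"
      by (simp add: power_mult_distrib power_mult[symmetric] mult_ac)
    also have "\<dots> \<le> z None ^ (2 * l) * (\<Sum>i\<in>UNIV. \<Sum>j\<in>UNIV. v i * v j * peval x (Q i j))"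
      by (intro mult_left_mono pos) (simp add: power_mult)
    also have "\<dots> = (\<Sum>i\<in>UNIV. \<Sum>j\<in>UNIV. v i * v j * peval z (homog (2 * l) (Q i j)))"
      unfolding sum_distrib_left peval_homog[where z = z, OF deg z] x_def by (simp add: mult_ac)
    finally show ?thesis .
  qed
  have cont: "isCont (\<lambda>s. (\<Sum>i\<in>UNIV. \<Sum>j\<in>UNIV. v i * v j * peval (z(None := s)) (homog (2 * l) (Q i j)))
      - \<delta> * (\<Sum>a\<in>UNIV. ((z(None := s)) a)\<^sup>2) ^ l * (\<Sum>i\<in>UNIV. (v i)\<^sup>2)) (z None)"
  proof -
    have "continuous_on UNIV (\<lambda>s. (z(None := s)) a)" for a
      by (cases a) (simp_all add: continuous_intros)
    then have "continuous_on UNIV (\<lambda>s. (\<Sum>i\<in>UNIV. \<Sum>j\<in>UNIV. v i * v j * peval (z(None := s)) (homog (2 * l) (Q i j)))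
      - \<delta> * (\<Sum>a\<in>UNIV. ((z(None := s)) a)\<^sup>2) ^ l * (\<Sum>i\<in>UNIV. (v i)\<^sup>2))"
      by (intro continuous_intros)
    then show ?thesis by (simp add: continuous_on_eq_continuous_at)
  qed
  show ?thesis
  proof (cases "z None = 0")
    case True
    have ev: "\<forall>\<^sub>F s in at (z None). 0 \<le> (\<Sum>i\<in>UNIV. \<Sum>j\<in>UNIV. v i * v j * peval (z(None := s)) (homog (2 * l) (Q i j)))
      - \<delta> * (\<Sum>a\<in>UNIV. ((z(None := s)) a)\<^sup>2) ^ l * (\<Sum>i\<in>UNIV. (v i)\<^sup>2)"
      unfolding eventually_at
    proof (intro exI[of _ 1] conjI ballI impI)
      fix s assume "s \<noteq> z None \<and> dist s (z None) < 1"
      then have "(z(None := s)) None \<noteq> 0" using True by simp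
      from nz[where z = "z(None := s)", OF this] show "0 \<le> (\<Sum>i\<in>UNIV. \<Sum>j\<in>UNIV. v i * v j * peval (z(None := s)) (homog (2 * l) (Q i j)))
        - \<delta> * (\<Sum>a\<in>UNIV. ((z(None := s)) a)\<^sup>2) ^ l * (\<Sum>i\<in>UNIV. (v i)\<^sup>2)" by simp
    qed simp
    show ?thesis
      using tendsto_lowerbound[OF cont[unfolded isCont_def] ev] by simp
  qed (rule nz)
qed

section \<open>Uniform denominators for positive definite matrix polynomials\<close>

text \<open>
  Divided by \<open>\<surd>\<theta>\<close>, the homogeneous coordinates lie on the unit sphere, inside the cube \<open>[-1, 1]\<close> to
  the power \<open>n + 1\<close>. The homogenized matrix plus the square of \<open>1 - \<bar>z\<bar>\<^sup>2\<close> is definite on the whole cube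
  and agrees with \<open>Q / \<theta>\<^sup>l\<close> on the sphere. Its Bernstein coefficients of large degree are therefore
  positive semidefinite constant matrices, and its Bernstein polynomials, evaluated on the sphere, are
  products of the factors \<open>t + X\<close> and \<open>t - X\<close> up to powers of \<open>\<theta>\<close>.
\<close>

theorem matrix_reznick:
  fixes Q :: "'n::finite rpoly^'p::finite^'p"
  assumes sym: "\<And>i j. Q $ i $ j = Q $ j $ i"
    and deg: "\<And>i j. deg_in UNIV (Q $ i $ j) \<le> 2 * l" and "\<delta> > 0"
    and pos: "\<And>x v. \<delta> * peval x theta ^ l * (\<Sum>i\<in>UNIV. (v i)\<^sup>2)
      \<le> (\<Sum>i\<in>UNIV. \<Sum>j\<in>UNIV. v i * v j * peval x (Q $ i $ j))"
  shows "\<exists>N. sos_matrix (pscale (theta ^ N) Q)"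
proof -
  define R where "R = 1 - (\<Sum>a\<in>UNIV. Var a ^ 2 :: 'n option rpoly)"
  \<comment> \<open>The added square vanishes on the unit sphere and keeps the matrix definite near the origin.\<close>
  define H where "H i j = homog (2 * l) (Q $ i $ j) + (if i = j then R\<^sup>2 else 0)" for i j
  define \<Phi> where "\<Phi> i j = psubst (\<lambda>a. Const 2 * Var a - 1) (H i j)" for i j
  define \<delta>0 where "\<delta>0 = min (\<delta> * (1 / 2) ^ l) (1 / 4)"
  have \<delta>0: "\<delta>0 > 0" using \<open>\<delta> > 0\<close> by (simp add: \<delta>0_def)
  have Hpos: "\<delta>0 * (\<Sum>i\<in>UNIV. (v i)\<^sup>2) \<le> (\<Sum>i\<in>UNIV. \<Sum>j\<in>UNIV. v i * v j * peval z (H i j))" for z v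
  proof -
    define V where "V = (\<Sum>i\<in>UNIV. (v i)\<^sup>2)"
    define r where "r = (\<Sum>a\<in>UNIV. (z a)\<^sup>2)"
    have V: "V \<ge> 0" and r: "r \<ge> 0" by (simp_all add: V_def r_def sum_nonneg)
    have "(\<Sum>i\<in>UNIV. \<Sum>j\<in>UNIV. v i * v j * ((1 - r)\<^sup>2 * (if i = j then 1 else 0))) = V * (1 - r)\<^sup>2"
      unfolding quadratic_form_scalar V_def by (rule mult.commute)
    moreover have "peval z (H i j) = peval z (homog (2 * l) (Q $ i $ j)) + (1 - r)\<^sup>2 * (if i = j then 1 else 0)" for i j
      by (simp add: H_def R_def r_def)
    ultimately have "(\<Sum>i\<in>UNIV. \<Sum>j\<in>UNIV. v i * v j * peval z (H i j))
        = (\<Sum>i\<in>UNIV. \<Sum>j\<in>UNIV. v i * v j * peval z (homog (2 * l) (Q $ i $ j))) + V * (1 - r)\<^sup>2"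
      by (simp only: distrib_left sum.distrib)
    moreover have "\<delta> * r ^ l * V \<le> (\<Sum>i\<in>UNIV. \<Sum>j\<in>UNIV. v i * v j * peval z (homog (2 * l) (Q $ i $ j)))"
      unfolding r_def V_def by (rule homog_positive[where Q = "\<lambda>i j. Q $ i $ j", OF deg pos])
    moreover have "\<delta>0 * V \<le> \<delta> * r ^ l * V + V * (1 - r)\<^sup>2"
    proof -
      have "\<delta>0 \<le> \<delta> * r ^ l + (1 - r)\<^sup>2"
      proof (cases "r \<ge> 1 / 2")
        case True
        then have "\<delta> * (1 / 2) ^ l \<le> \<delta> * r ^ l"
          using \<open>\<delta> > 0\<close> by (intro mult_left_mono power_mono) auto
        moreover have "0 \<le> (1 - r)\<^sup>2" by simp
        ultimately show ?thesis unfolding \<delta>0_def by linarith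
      next
        case False
        then have "(1 / 2)\<^sup>2 \<le> (1 - r)\<^sup>2" by (intro power_mono) auto
        then have "1 / 4 \<le> (1 - r)\<^sup>2" by (simp add: power_divide)
        moreover have "0 \<le> \<delta> * r ^ l" using \<open>\<delta> > 0\<close> r by simp
        ultimately show ?thesis unfolding \<delta>0_def by linarith
      qed
      from mult_right_mono[OF this V] show ?thesis by (simp add: algebra_simps)
    qed
    ultimately show ?thesis by (simp add: V_def)
  qed
  have \<Phi>_eval: "peval u (\<Phi> i j) = peval (\<lambda>a. 2 * u a - 1) (H i j)" for u i j
    by (simp add: \<Phi>_def)
  \<comment> \<open>Errors of size \<open>e\<close> in the entries change the quadratic form by at most \<open>\<delta>0\<close> times the squared
    norm.\<close>
  define e where "e = \<delta>0 / (real CARD('p))\<^sup>2"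
  have e: "e > 0" using \<delta>0 by (simp add: e_def)
  have "\<exists>M0. \<forall>i j. \<forall>M\<ge>M0. \<forall>J. (\<forall>w. J w \<le> M) \<longrightarrow> \<bar>bernstein_coeff M J (\<Phi> i j) - peval (\<lambda>w. real (J w) / real M) (\<Phi> i j)\<bar> < e"
  proof -
    have "\<forall>i j. \<exists>M0. \<forall>M\<ge>M0. \<forall>J. (\<forall>w. J w \<le> M)
        \<longrightarrow> \<bar>bernstein_coeff M J (\<Phi> i j) - peval (\<lambda>w. real (J w) / real M) (\<Phi> i j)\<bar> < e"
      by (intro allI bernstein_coeff_approx e)
    then obtain M0 where M0: "\<forall>i j. \<forall>M\<ge>M0 i j. \<forall>J. (\<forall>w. J w \<le> M)
        \<longrightarrow> \<bar>bernstein_coeff M J (\<Phi> i j) - peval (\<lambda>w. real (J w) / real M) (\<Phi> i j)\<bar> < e"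
      unfolding choice_iff by (elim exE)
    define m0 where "m0 = (\<Sum>i\<in>UNIV. \<Sum>j\<in>UNIV. M0 i j)"
    have "M0 i j \<le> m0" for i j
    proof -
      have "M0 i j \<le> (\<Sum>j\<in>UNIV. M0 i j)" by (rule member_le_sum) auto
      also have "\<dots> \<le> m0" unfolding m0_def by (rule member_le_sum[where f = "\<lambda>i. \<Sum>j\<in>UNIV. M0 i j"]) auto
      finally show ?thesis .
    qed
    then have "M0 i j \<le> M" if "m0 \<le> M" for i j M
      using that order.trans by blast
    with M0 show ?thesis by blast
  qed
  then obtain M0 where M0: "\<forall>i j. \<forall>M\<ge>M0. \<forall>J. (\<forall>w. J w \<le> M)
      \<longrightarrow> \<bar>bernstein_coeff M J (\<Phi> i j) - peval (\<lambda>w. real (J w) / real M) (\<Phi> i j)\<bar> < e" by (elim exE)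
  define dmax where "dmax = (\<Sum>i\<in>UNIV. \<Sum>j\<in>UNIV. deg_in UNIV (\<Phi> i j))"
  have dmax: "deg_in UNIV (\<Phi> i j) \<le> dmax" for i j
  proof -
    have "deg_in UNIV (\<Phi> i j) \<le> (\<Sum>j\<in>UNIV. deg_in UNIV (\<Phi> i j))" by (rule member_le_sum) auto
    also have "\<dots> \<le> dmax" unfolding dmax_def
      by (rule member_le_sum[where f = "\<lambda>i. \<Sum>j\<in>UNIV. deg_in UNIV (\<Phi> i j)"]) auto
    finally show ?thesis .
  qed
  define m where "m = M0 + dmax + l + 1"
  define c where "c = CARD('n option)"
  have c: "c \<ge> 1" unfolding c_def by simp
  have mc: "l \<le> m * c" using mult_le_mono[of l m 1 c] c by (simp add: m_def)
  define \<J> where "\<J> = PiE (UNIV :: 'n option set) (\<lambda>_. {..2 * m})"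
  have J: "J a \<le> 2 * m" if "J \<in> \<J>" for J a
    using that by (auto simp: \<J>_def PiE_def Pi_def)
  define C where "C J i j = bernstein_coeff (2 * m) J (\<Phi> i j)" for J i j
  have Csos: "sos_matrix ((\<chi> i j. Const (C J i j)) :: 'n rpoly^'p^'p)" if "J \<in> \<J>" for J
  proof (rule sos_matrix_psd_const)
    have "\<Phi> i j = \<Phi> j i" for i j
      using sym[of i j] by (simp add: \<Phi>_def H_def)
    then show "C J i j = C J j i" for i j by (simp add: C_def)
    fix v :: "'p \<Rightarrow> real"
    define V where "V = (\<Sum>i\<in>UNIV. (v i)\<^sup>2)"
    define u where "u w = real (J w) / real (2 * m)" for w
    have "(\<Sum>i\<in>UNIV. \<Sum>j\<in>UNIV. v i * v j * (peval u (\<Phi> i j) - C J i j)) \<le> (\<Sum>i\<in>(UNIV :: 'p set). \<Sum>j\<in>(UNIV :: 'p set). V * e)"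
    proof (intro sum_mono)
      fix i j
      have "\<bar>v i * v j\<bar> \<le> V" unfolding V_def by (rule abs_mult_le_sum_squares)
      moreover have "\<bar>C J i j - peval u (\<Phi> i j)\<bar> < e"
      proof -
        have "M0 \<le> 2 * m" "\<forall>w. J w \<le> 2 * m" using J[OF that] by (auto simp: m_def)
        then show ?thesis unfolding C_def u_def using M0 by blast
      qed
      ultimately have "\<bar>v i * v j\<bar> * \<bar>peval u (\<Phi> i j) - C J i j\<bar> \<le> V * e"
        by (intro mult_mono) (auto simp: V_def sum_nonneg abs_minus_commute)
      then show "v i * v j * (peval u (\<Phi> i j) - C J i j) \<le> V * e"
        unfolding abs_mult[symmetric] by linarith
    qed
    also have "\<dots> = \<delta>0 * V" by (simp add: e_def power2_eq_square)
    also have "\<dots> \<le> (\<Sum>i\<in>UNIV. \<Sum>j\<in>UNIV. v i * v j * peval u (\<Phi> i j))"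
      unfolding \<Phi>_eval V_def by (rule Hpos)
    finally show "0 \<le> (\<Sum>i\<in>UNIV. \<Sum>j\<in>UNIV. v i * v j * C J i j)"
      by (simp add: right_diff_distrib sum_subtractf)
  qed
  have "\<forall>J\<in>\<J>. \<exists>s :: 'n rpoly. sos s \<and> (\<forall>x t. t\<^sup>2 = peval x theta \<longrightarrow>
      bernstein_product UNIV m J x t
      + bernstein_product UNIV m J x (- t)
      = 2 * peval x s)"
    using J by (intro ballI bernstein_product_sos) auto
  then obtain s :: "('n option \<Rightarrow> nat) \<Rightarrow> 'n rpoly" where "\<forall>J\<in>\<J>. sos (s J) \<and> (\<forall>x t. t\<^sup>2 = peval x theta \<longrightarrow>
      bernstein_product UNIV m J x t
      + bernstein_product UNIV m J x (- t)
      = 2 * peval x (s J))"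
    unfolding bchoice_iff by (elim exE)
  then have s: "\<And>J. J \<in> \<J> \<Longrightarrow> sos (s J)"
    and s_eval: "\<And>J x t. J \<in> \<J> \<Longrightarrow> t\<^sup>2 = peval x theta \<Longrightarrow>
      bernstein_product UNIV m J x t
      + bernstein_product UNIV m J x (- t)
      = 2 * peval x (s J)"
    by blast+
  define b where "b J = (\<Prod>a\<in>UNIV. real (2 * m choose J a))" for J :: "'n option \<Rightarrow> nat"
  have key: "4 ^ (m * c) * peval x theta ^ (m * c - l) * peval x (Q $ i $ j)
      = (\<Sum>J\<in>\<J>. C J i j * (b J * bernstein_product UNIV m J x t))"
    if t: "t\<^sup>2 = peval x theta" for x t i j
  proof -
    have t0: "t \<noteq> 0" using t theta_pos[of x] by auto
    define u where "u a = (1 + peval x (coord a) / t) / 2" for a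
    have z: "2 * u a - 1 = peval x (coord a) / t" for a
    proof -
      have "2 * ((1 + r) / 2) - 1 = r" for r :: real by (simp add: field_simps)
      then show ?thesis unfolding u_def .
    qed
    have "(\<Sum>a\<in>UNIV. (peval x (coord a) / t)\<^sup>2) = 1"
      using theta_pos[of x] by (simp add: power_divide t sum_divide_distrib[symmetric] sum_coord_squares)
    moreover have "peval (\<lambda>a. peval x (coord a) / t) (homog (2 * l) (Q $ i $ j)) = peval x (Q $ i $ j) / peval x theta ^ l"
      using t0 by (subst peval_homog[OF deg]) (simp_all add: coord_def power_divide power_mult t)
    ultimately have "peval x (Q $ i $ j) / peval x theta ^ l = peval u (\<Phi> i j)"
      unfolding \<Phi>_eval z by (simp add: H_def R_def)
    also have "\<dots> = (\<Sum>J\<in>\<J>. C J i j * (\<Prod>a\<in>UNIV. real (2 * m choose J a) * u a ^ J a * (1 - u a) ^ (2 * m - J a)))"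
      unfolding \<J>_def C_def using dmax[of i j] by (intro peval_bernstein) (simp add: m_def)
    finally have eq: "peval x (Q $ i $ j) / peval x theta ^ l = \<dots>" .
    have scale: "(2 * t) ^ (2 * m * c) * (\<Prod>a\<in>UNIV. real (2 * m choose J a) * u a ^ J a * (1 - u a) ^ (2 * m - J a))
        = b J * bernstein_product UNIV m J x t"
      if "J \<in> \<J>" for J
    proof -
      have "(2 * t) ^ (2 * m * c) = (\<Prod>a\<in>(UNIV :: 'n option set). (2 * t) ^ (2 * m))"
        unfolding c_def by (simp only: prod_constant power_mult)
      moreover have "(2 * t) ^ (2 * m) * (real (2 * m choose J a) * u a ^ J a * (1 - u a) ^ (2 * m - J a))
          = real (2 * m choose J a) * ((t + peval x (coord a)) ^ J a * (t - peval x (coord a)) ^ (2 * m - J a))" for a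
      proof -
        have "y ^ (2 * m) = y ^ J a * y ^ (2 * m - J a)" for y :: real
          using J[OF that, of a] by (simp add: power_add[symmetric])
        moreover have "2 * t * u a = t + peval x (coord a)" "2 * t * (1 - u a) = t - peval x (coord a)"
          using t0 by (simp_all add: u_def field_simps)
        moreover have "y ^ p * y ^ q * (B * A ^ p * A' ^ q) = B * ((y * A) ^ p * (y * A') ^ q)"
          for y A A' B :: real and p q
          by (simp add: power_mult_distrib mult_ac)
        ultimately show ?thesis by metis
      qed
      ultimately show ?thesis
        unfolding b_def by (simp only: prod.distrib[symmetric])
    qed
    have "4 ^ (m * c) * peval x theta ^ (m * c - l) * peval x (Q $ i $ j)
        = (2 * t) ^ (2 * m * c) * (peval x (Q $ i $ j) / peval x theta ^ l)"
    proof -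
      have "(2 * t) ^ (2 * m * c) = ((2 * t)\<^sup>2) ^ (m * c)" by (simp only: power_mult mult.assoc)
      also have "(2 * t)\<^sup>2 = 4 * peval x theta" by (simp add: power_mult_distrib t)
      also have "(4 * peval x theta) ^ (m * c) = 4 ^ (m * c) * (peval x theta ^ (m * c - l) * peval x theta ^ l)"
        using mc by (simp add: power_mult_distrib power_add[symmetric])
      finally show ?thesis using theta_pos[of x] by simp
    qed
    also have "\<dots> = (\<Sum>J\<in>\<J>. C J i j * ((2 * t) ^ (2 * m * c) *
        (\<Prod>a\<in>UNIV. real (2 * m choose J a) * u a ^ J a * (1 - u a) ^ (2 * m - J a))))"
      unfolding eq sum_distrib_left by (simp only: mult.left_commute)
    also have "\<dots> = (\<Sum>J\<in>\<J>. C J i j * (b J * bernstein_product UNIV m J x t))"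
      using scale by (intro sum.cong) auto
    finally show ?thesis .
  qed
  have "pscale (theta ^ (m * c - l)) Q
      = (\<Sum>J\<in>\<J>. pscale (Const (b J / 4 ^ (m * c)) * s J) (\<chi> i j. Const (C J i j)))"
  proof -
    have "peval x (theta ^ (m * c - l) * Q $ i $ j) = peval x (\<Sum>J\<in>\<J>. Const (b J / 4 ^ (m * c)) * s J * Const (C J i j))" for x i j
    proof -
      define t where "t = sqrt (peval x theta)"
      have t: "t\<^sup>2 = peval x theta" "(- t)\<^sup>2 = peval x theta"
        using theta_pos[of x] by (simp_all add: t_def)
      have "2 * (4 ^ (m * c) * peval x theta ^ (m * c - l) * peval x (Q $ i $ j))
          = (\<Sum>J\<in>\<J>. C J i j * (b J * (2 * peval x (s J))))"
      proof -
        let ?K = "4 ^ (m * c) * peval x theta ^ (m * c - l) * peval x (Q $ i $ j)"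
        have "2 * ?K = ?K + ?K" by simp
        also have "\<dots> = (\<Sum>J\<in>\<J>. C J i j * (b J *
          (bernstein_product UNIV m J x t
          + bernstein_product UNIV m J x (- t))))"
          unfolding distrib_left sum.distrib by (rule arg_cong2[where f = "(+)", OF key[OF t(1)] key[OF t(2)]])
        also have "\<dots> = (\<Sum>J\<in>\<J>. C J i j * (b J * (2 * peval x (s J))))"
          by (rule sum.cong[OF refl]) (simp only: s_eval[OF _ t(1)])
        finally show ?thesis .
      qed
      also have "\<dots> = 2 * (4 ^ (m * c) * (\<Sum>J\<in>\<J>. b J / 4 ^ (m * c) * peval x (s J) * C J i j))"
        by (simp add: sum_distrib_left mult_ac)
      finally have "4 ^ (m * c) * (peval x theta ^ (m * c - l) * peval x (Q $ i $ j))
          = 4 ^ (m * c) * (\<Sum>J\<in>\<J>. b J / 4 ^ (m * c) * peval x (s J) * C J i j)"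
        by simp
      then show ?thesis by simp
    qed
    then have "theta ^ (m * c - l) * Q $ i $ j = (\<Sum>J\<in>\<J>. Const (b J / 4 ^ (m * c)) * s J * Const (C J i j))" for i j
      by (rule rpoly_eqI)
    then show ?thesis by (simp add: vec_eq_iff)
  qed
  moreover have "sos_matrix (\<Sum>J\<in>\<J>. pscale (Const (b J / 4 ^ (m * c)) * s J) (\<chi> i j. Const (C J i j)))"
    by (intro sos_matrix_sum sos_matrix_pscale sos_mult sos_Const s Csos) (auto simp: b_def prod_nonneg)
  ultimately show ?thesis by metis
qed

section \<open>Integration over the parameter set\<close>

lemma mono_eval_case_sum:
  fixes t :: "('n::finite + 'm::finite) \<Rightarrow>\<^sub>0 nat"
  shows "mono_eval (case_sum x y) t
    = mono_eval x (Poly_Mapping.map_key Inl t) * mono_eval y (Poly_Mapping.map_key Inr t)"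
  unfolding mono_eval_def UNIV_Plus_UNIV[symmetric]
  by (subst prod.Plus) (auto simp: map_key.rep_eq)

lemma vdeg_Inl: "vdeg (range Inl) (t :: ('n::finite + 'm) \<Rightarrow>\<^sub>0 nat) = vdeg UNIV (Poly_Mapping.map_key Inl t)"
  unfolding vdeg_def by (subst sum.reindex) (auto simp: map_key.rep_eq)

lemma deg_in_y_integral_le:
  fixes h :: "('n::finite + 'm::finite) rpoly"
  assumes "deg_in (range Inl) h \<le> d"
  shows "deg_in UNIV (y_integral \<nu> Y h) \<le> d"
  unfolding y_integral_def
proof (intro deg_in_sum_le deg_in_mult_le[of _ _ d _ 0])
  show "deg_in UNIV (y_coeff h \<beta>) \<le> d" for \<beta>
    unfolding y_coeff_def
  proof (rule deg_in_sum_le)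
    fix t assume "t \<in> {t \<in> Poly_Mapping.keys h. Poly_Mapping.map_key Inr t = \<beta>}"
    then have "vdeg UNIV (Poly_Mapping.map_key Inl t) \<le> d"
      using assms unfolding deg_in_le_iff by (auto simp: vdeg_Inl)
    then show "deg_in UNIV (Poly_Mapping.single (Poly_Mapping.map_key Inl t) (Poly_Mapping.lookup h t)) \<le> d"
      by (simp add: deg_in_le_iff)
  qed
qed auto

lemma peval_y_integral:
  fixes h :: "('n::finite + 'm::finite) rpoly"
  assumes "\<And>p :: 'm rpoly. set_integrable \<nu> Y (\<lambda>y. peval (($) y) p)"
  shows "peval x (y_integral \<nu> Y h) = (LINT y:Y|\<nu>. peval (case_sum x (($) y)) h)"
proof -
  let ?K = "Poly_Mapping.keys h"
  let ?l = "\<lambda>t :: ('n + 'm) \<Rightarrow>\<^sub>0 nat. Poly_Mapping.map_key Inl t"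
  let ?r = "\<lambda>t :: ('n + 'm) \<Rightarrow>\<^sub>0 nat. Poly_Mapping.map_key Inr t"
  let ?I = "\<lambda>\<beta>. LINT y:Y|\<nu>. mono_eval (($) y) \<beta>"
  have int: "set_integrable \<nu> Y (\<lambda>y. mono_eval (($) y) \<beta>)" for \<beta>
    using assms[of "Poly_Mapping.single \<beta> 1"] by simp
  have "peval x (y_integral \<nu> Y h)
      = (\<Sum>\<beta>\<in>?r ` ?K. \<Sum>t\<in>{t\<in>?K. ?r t = \<beta>}. Poly_Mapping.lookup h t * mono_eval x (?l t) * ?I (?r t))"
    unfolding y_integral_def y_coeff_def by (simp add: sum_distrib_right)
  also have "\<dots> = (\<Sum>t\<in>?K. Poly_Mapping.lookup h t * mono_eval x (?l t) * ?I (?r t))"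
    by (intro sum.group) auto
  also have "\<dots> = (\<Sum>t\<in>?K. LINT y:Y|\<nu>. Poly_Mapping.lookup h t * mono_eval (case_sum x (($) y)) t)"
    by (simp add: mono_eval_case_sum mult.assoc[symmetric])
  also have "\<dots> = (LINT y:Y|\<nu>. peval (case_sum x (($) y)) h)"
  proof -
    have "integrable \<nu> (\<lambda>y. Poly_Mapping.lookup h t * mono_eval x (?l t)
        * (indicat_real Y y * mono_eval (($) y) (?r t)))" for t
      using int by (intro integrable_mult_right) (simp add: set_integrable_def)
    moreover have "Poly_Mapping.lookup h t * mono_eval x (?l t)
        * (indicat_real Y y * mono_eval (($) y) (?r t))
        = indicat_real Y y *\<^sub>R (Poly_Mapping.lookup h t * mono_eval (case_sum x (($) y)) t)" for t y
      by (simp add: mono_eval_case_sum)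
    ultimately have "integrable \<nu> (\<lambda>y. indicat_real Y y *\<^sub>R
        (Poly_Mapping.lookup h t * mono_eval (case_sum x (($) y)) t))" for t
      by simp
    then show ?thesis
      unfolding peval_def set_lebesgue_integral_def scaleR_sum_right
      by (rule Bochner_Integration.integral_sum[symmetric])
  qed
  finally show ?thesis .
qed

locale carleman_set =
  fixes Y :: "(real^'m::finite) set" and \<nu> :: "(real^'m) measure"
  assumes closed_Y: "closed Y"
    and sets_nu: "sets \<nu> = sets borel"
    and support: "measure_support \<nu> = Y"
    and finite_moments: "\<And>h :: 'm rpoly. (\<integral>\<^sup>+ y\<in>Y. ennreal \<bar>peval (($) y) h\<bar> \<partial>\<nu>) < \<infinity>"
    and carleman_Y: "\<And>j. carleman \<nu> Y j"
begin

lemma Y_sets [measurable]: "Y \<in> sets \<nu>"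
  using closed_Y by (simp add: sets_nu)

lemma measurable_borel_nu: "f \<in> borel_measurable borel \<Longrightarrow> f \<in> borel_measurable \<nu>"
  by (simp add: measurable_cong_sets[OF sets_nu])

lemma integrable_peval: "set_integrable \<nu> Y (\<lambda>y. peval (($) y) p)"
  unfolding set_integrable_def integrable_iff_bounded
proof
  show "(\<lambda>y. indicat_real Y y *\<^sub>R peval (($) y) p) \<in> borel_measurable \<nu>"
    by (intro borel_measurable_scaleR borel_measurable_indicator Y_sets
        measurable_borel_nu[OF borel_measurable_peval])
  have "(\<integral>\<^sup>+ y. ennreal (norm (indicat_real Y y *\<^sub>R peval (($) y) p)) \<partial>\<nu>)
      = (\<integral>\<^sup>+ y\<in>Y. ennreal \<bar>peval (($) y) p\<bar> \<partial>\<nu>)"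
    by (intro nn_integral_cong) (simp add: indicator_def)
  then show "(\<integral>\<^sup>+ y. ennreal (norm (indicat_real Y y *\<^sub>R peval (($) y) p)) \<partial>\<nu>) < \<infinity>"
    using finite_moments[of p] by simp
qed

definition \<mu> :: "(real^'m) measure" where
  "\<mu> = density \<nu> (\<lambda>y. ennreal (indicat_real Y y))"

lemma sets_mu: "sets \<mu> = sets borel"
  by (simp add: \<mu>_def sets_nu)

lemma integral_mu:
  fixes f :: "real^'m \<Rightarrow> real"
  shows "f \<in> borel_measurable borel \<Longrightarrow> (\<integral>y. f y \<partial>\<mu>) = (LINT y:Y|\<nu>. f y)"
  unfolding \<mu>_def set_lebesgue_integral_def
  by (intro integral_density measurable_borel_nu borel_measurable_indicator Y_sets AE_I2) auto

sublocale moments \<mu>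
proof
  show "sets \<mu> = sets borel" by (rule sets_mu)
  show "integrable \<mu> (\<lambda>y. peval (($) y) p)" for p
    unfolding \<mu>_def
    by (subst integrable_density)
      (use integrable_peval[of p] in \<open>auto simp: set_integrable_def
        intro!: measurable_borel_nu borel_measurable_indicator Y_sets\<close>)
qed

lemma moment_eq: "moment k n = (LINT y:Y|\<nu>. (y $ k) ^ (2 * n))"
  unfolding moment_def
  by (rule integral_mu) (intro tame_measurable tame_intros)

sublocale carleman_moments \<mu>
proof
  fix k :: 'm
  have "suminf (\<lambda>d. inverse (ennreal (moment k (Suc d) powr (1 / real (2 * Suc d))))) = \<infinity>"
    using carleman_Y[of k] unfolding carleman_def moment_eq .
  then have "\<not> summable (\<lambda>n. normalized_moment k (Suc n) powr (- 1 / (2 * real (Suc n))))"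
    unfolding normalized_moment_def
    by (intro not_summable_of_carleman_series moment_nonneg moment_convex) (simp_all add: moment_nonneg)
  then show "\<not> summable (\<lambda>n. (normalized_moment k (2 * n) / normalized_moment k (2 * Suc n)) powr (1 / 4))"
    by (intro not_summable_even_ratios normalized_moment_pos normalized_moment_zero normalized_moment_convex)
qed

text \<open>
  A union of open null sets is a null set because countably many of them already cover it.
\<close>

lemma emeasure_Compl_Y: "emeasure \<nu> (- Y) = 0"
proof -
  define \<F> where "\<F> = {U. open U \<and> emeasure \<nu> U = 0}"
  obtain \<F>' where \<F>': "\<F>' \<subseteq> \<F>" "countable \<F>'" "\<Union>\<F>' = \<Union>\<F>"
    using Lindelof[of \<F>] by (auto simp: \<F>_def)
  have "- Y \<subseteq> \<Union>\<F>"
  proof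
    fix y assume "y \<in> - Y"
    then obtain U where "open U" "y \<in> U" "\<not> emeasure \<nu> U > 0"
      unfolding support[symmetric] measure_support_def by auto
    then show "y \<in> \<Union>\<F>" by (auto simp: \<F>_def)
  qed
  moreover have "\<Union>\<F>' \<in> null_sets \<nu>"
  proof -
    have "U \<in> null_sets \<nu>" if "U \<in> \<F>'" for U
      using that \<F>'(1) by (auto simp: \<F>_def sets_nu intro!: null_setsI)
    from null_sets_UN'[OF \<F>'(2), of "\<lambda>U. U", OF this] show ?thesis by simp
  qed
  moreover have "- Y \<in> sets \<nu>" using closed_Y by (simp add: sets_nu)
  ultimately have "- Y \<in> null_sets \<nu>"
    unfolding \<F>'(3) by (metis null_sets_subset)
  then show ?thesis by (rule null_setsD1)
qed

lemma measure_mu_ball_pos: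
  assumes "a \<in> Y" "r > 0"
  shows "measure \<mu> (ball a r) > 0"
proof -
  have B: "ball a r \<in> sets \<nu>" by (simp add: sets_nu)
  have "emeasure \<nu> (ball a r) > 0"
    using assms unfolding support[symmetric] measure_support_def by auto
  also have "emeasure \<nu> (ball a r) \<le> emeasure \<nu> (Y \<inter> ball a r) + emeasure \<nu> (- Y)"
    using B closed_Y
    by (intro order.trans[OF emeasure_mono emeasure_subadditive]) (auto simp: sets_nu)
  also have "\<dots> = emeasure \<nu> (Y \<inter> ball a r)" by (simp add: emeasure_Compl_Y)
  also have "\<dots> = emeasure \<mu> (ball a r)"
    unfolding \<mu>_def using B
    by (subst emeasure_density)
      (auto simp: indicator_inter_arith[symmetric] ennreal_mult[symmetric] ennreal_indicator
        intro!: measurable_borel_nu)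
  finally have pos: "emeasure \<mu> (ball a r) > 0" .
  have "integrable \<mu> (\<lambda>y. peval (($) y) 1)" by (rule integrable_peval)
  then have "finite_measure \<mu>"
    by (intro finite_measureI) (auto simp: integrable_iff_bounded)
  then show ?thesis
    using pos by (simp add: finite_measure.emeasure_eq_measure)
qed

lemma exists_square_negative:
  assumes "y0 \<in> Y" "peval (($) y0) g < 0"
  shows "\<exists>p. (LINT y:Y|\<nu>. (peval (($) y) p)\<^sup>2 * peval (($) y) g) < 0"
proof -
  obtain p where "(\<integral>y. (peval (($) y) p)\<^sup>2 * peval (($) y) g \<partial>\<mu>) < 0"
    using exists_square_negative_integral[OF assms(2) measure_mu_ball_pos[OF assms(1)]] by blast
  then show ?thesis
    by (subst (asm) integral_mu) (auto intro!: tame_measurable tame_intros)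
qed

end

definition embed_x :: "'n::finite rpoly \<Rightarrow> ('n + 'm::finite) rpoly" where
  "embed_x = psubst (\<lambda>i. Var (Inl i))"

definition embed_y :: "'m::finite rpoly \<Rightarrow> ('n::finite + 'm) rpoly" where
  "embed_y = psubst (\<lambda>i. Var (Inr i))"

lemma peval_embed_x [simp]: "peval f (embed_x p) = peval (\<lambda>i. f (Inl i)) p"
  by (simp add: embed_x_def)

lemma peval_embed_y [simp]: "peval f (embed_y p) = peval (\<lambda>i. f (Inr i)) p"
  by (simp add: embed_y_def)

lemma deg_in_embed_x:
  fixes p :: "'n::finite rpoly"
  assumes "deg_in UNIV p \<le> d"
  shows "deg_in (range Inl) (embed_x p :: ('n + 'm::finite) rpoly) \<le> d"
    "deg_in (range Inr) (embed_x p :: ('n + 'm) rpoly) \<le> 0"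
  unfolding embed_x_def
proof -
  have 1: "deg_in (range Inl) (Var (Inl i) :: ('n + 'm) rpoly) \<le> (if i \<in> UNIV then 1 else 0)" for i :: 'n
    using deg_in_Var_le[of "range Inl" "Inl i"] by simp
  show "deg_in (range Inl) (psubst (\<lambda>i. Var (Inl i)) p :: ('n + 'm) rpoly) \<le> d"
    by (rule deg_in_psubst_le[OF 1 assms])
  have 2: "deg_in (range Inr) (Var (Inl i) :: ('n + 'm) rpoly) \<le> (if i \<in> {} then 1 else 0)" for i :: 'n
  proof -
    have "(Inl i :: 'n + 'm) \<notin> range Inr" by auto
    then show ?thesis using deg_in_Var_le[where V = "range Inr" and v = "Inl i :: 'n + 'm"] by simp
  qed
  show "deg_in (range Inr) (psubst (\<lambda>i. Var (Inl i)) p :: ('n + 'm) rpoly) \<le> 0"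
  proof (rule deg_in_psubst_le[OF 2])
    show "deg_in {} p \<le> 0" by (subst deg_in_le_iff) (simp add: vdeg_def)
  qed
qed

lemma deg_in_embed_y:
  fixes p :: "'m::finite rpoly"
  assumes "deg_in UNIV p \<le> d"
  shows "deg_in (range Inr) (embed_y p :: ('n::finite + 'm) rpoly) \<le> d"
    "deg_in (range Inl) (embed_y p :: ('n + 'm) rpoly) \<le> 0"
  unfolding embed_y_def
proof -
  have 1: "deg_in (range Inr) (Var (Inr i) :: ('n + 'm) rpoly) \<le> (if i \<in> UNIV then 1 else 0)" for i :: 'm
    using deg_in_Var_le[of "range Inr" "Inr i"] by simp
  show "deg_in (range Inr) (psubst (\<lambda>i. Var (Inr i)) p :: ('n + 'm) rpoly) \<le> d"
    by (rule deg_in_psubst_le[OF 1 assms])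
  have 2: "deg_in (range Inl) (Var (Inr i) :: ('n + 'm) rpoly) \<le> (if i \<in> {} then 1 else 0)" for i :: 'm
  proof -
    have "(Inr i :: 'n + 'm) \<notin> range Inl" by auto
    then show ?thesis using deg_in_Var_le[where V = "range Inl" and v = "Inr i :: 'n + 'm"] by simp
  qed
  show "deg_in (range Inl) (psubst (\<lambda>i. Var (Inr i)) p :: ('n + 'm) rpoly) \<le> 0"
  proof (rule deg_in_psubst_le[OF 2])
    show "deg_in {} p \<le> 0" by (subst deg_in_le_iff) (simp add: vdeg_def)
  qed
qed

lemma sos_embed_x_theta: "sos (embed_x (theta :: 'n::finite rpoly) :: ('n + 'm::finite) rpoly)"
proof -
  have "(embed_x (theta :: 'n rpoly) :: ('n + 'm) rpoly) = 1 + (\<Sum>i\<in>UNIV. (Var (Inl i))\<^sup>2)"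
    by (rule rpoly_eqI) (simp add: peval_theta)
  then show ?thesis by (simp add: sos_add sos_one sos_sum sos_square)
qed

lemma block_inner_nth:
  "block_inner S G $ i $ j = (\<Sum>k\<in>UNIV. \<Sum>l\<in>UNIV. S $ (j, l) $ (i, k) * G $ l $ k)"
proof -
  have "(\<Sum>b\<in>UNIV. S $ b $ (i, k) * (mat 1 $ fst b $ j * G $ snd b $ k)) = (\<Sum>l\<in>UNIV. S $ (j, l) $ (i, k) * G $ l $ k)" for k
  proof -
    have "(\<Sum>b\<in>UNIV. S $ b $ (i, k) * (mat 1 $ fst b $ j * G $ snd b $ k))
        = (\<Sum>a\<in>UNIV. \<Sum>l\<in>UNIV. if a = j then S $ (a, l) $ (i, k) * G $ l $ k else 0)"
      unfolding sum.cartesian_product UNIV_Times_UNIV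
      by (rule sum.cong) (auto simp: mat_def)
    also have "\<dots> = (\<Sum>l\<in>UNIV. S $ (j, l) $ (i, k) * G $ l $ k)"
      by (subst sum.swap) simp
    finally show ?thesis .
  qed
  then show ?thesis
    by (simp add: block_inner_def block_trace_def trace_def matrix_matrix_mult_def transpose_def kron_def)
qed

context carleman_set
begin

lemma y_integral_embed_sum:
  "y_integral \<nu> Y (\<Sum>i\<in>I. embed_x (q i) * h i) = (\<Sum>i\<in>I. q i * y_integral \<nu> Y (h i :: ('n::finite + 'm) rpoly))"
proof (rule rpoly_eqI)
  fix x :: "'n \<Rightarrow> real"
  have int: "integrable \<nu> (\<lambda>y. indicat_real Y y *\<^sub>R peval (case_sum x (($) y)) (h i))" for i
  proof -
    define r where "r = psubst (\<lambda>v. case v of Inl a \<Rightarrow> Const (x a) | Inr b \<Rightarrow> Var b) (h i)"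
    have "peval (($) y) r = peval (case_sum x (($) y)) (h i)" for y :: "real^'m"
      unfolding r_def peval_psubst
      by (rule arg_cong[where f = "\<lambda>f. peval f (h i)"]) (auto simp: fun_eq_iff split: sum.splits)
    then show ?thesis
      using integrable_peval[of r] by (simp add: set_integrable_def)
  qed
  have "peval x (y_integral \<nu> Y (\<Sum>i\<in>I. embed_x (q i) * h i))
      = (\<integral>y. (\<Sum>i\<in>I. peval x (q i) * (indicat_real Y y *\<^sub>R peval (case_sum x (($) y)) (h i))) \<partial>\<nu>)"
    unfolding peval_y_integral[OF integrable_peval] set_lebesgue_integral_def
    by (intro Bochner_Integration.integral_cong refl) (simp add: sum_distrib_left mult.left_commute)
  also have "\<dots> = (\<Sum>i\<in>I. \<integral>y. peval x (q i) * (indicat_real Y y *\<^sub>R peval (case_sum x (($) y)) (h i)) \<partial>\<nu>)"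
    by (intro Bochner_Integration.integral_sum integrable_mult_right int)
  also have "\<dots> = (\<Sum>i\<in>I. peval x (q i) * (LINT y:Y|\<nu>. peval (case_sum x (($) y)) (h i)))"
    unfolding set_lebesgue_integral_def by (simp only: integral_mult_right_zero)
  finally show "peval x (y_integral \<nu> Y (\<Sum>i\<in>I. embed_x (q i) * h i))
      = peval x (\<Sum>i\<in>I. q i * y_integral \<nu> Y (h i))"
    by (simp add: peval_y_integral[OF integrable_peval])
qed

text \<open>
  The form \<open>p(y)\<^sup>2 v\<^sup>T G(x, y) v\<close>, which is nonnegative for \<open>x\<close> in the feasible set and \<open>y \<in> Y\<close>; its
  integral over \<open>y\<close> is called a separator.
\<close>

definition witness :: "('n::finite + 'm) rpoly^'q::finite^'q \<Rightarrow> 'm rpoly \<Rightarrow> real^'q \<Rightarrow> ('n + 'm) rpoly" where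
  "witness G p v = (embed_y p)\<^sup>2 * (\<Sum>k\<in>UNIV. \<Sum>l\<in>UNIV. Const (v $ k * v $ l) * G $ k $ l)"

definition separator :: "('n::finite + 'm) rpoly^'q::finite^'q \<Rightarrow> 'm rpoly \<Rightarrow> real^'q \<Rightarrow> 'n rpoly" where
  "separator G p v = y_integral \<nu> Y (witness G p v)"

lemma deg_witness:
  fixes G :: "('n::finite + 'm) rpoly^'q::finite^'q"
  shows "deg_in (range Inl) (witness G p v) \<le> 2 * d_G G - 1"
proof -
  have "deg_in (range Inl) (G $ k $ l) \<le> 2 * d_G G - 1" for k l
    using deg_in_less_half_deg_in[of "range Inl" G k l] by (simp add: d_G_def)
  then have "deg_in (range Inl) (Const (v $ k * v $ l) * G $ k $ l) \<le> 2 * d_G G - 1" for k l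
    by (intro deg_in_mult_le[of _ _ 0]) auto
  then have "deg_in (range Inl) (\<Sum>k\<in>UNIV. \<Sum>l\<in>UNIV. Const (v $ k * v $ l) * G $ k $ l) \<le> 2 * d_G G - 1"
    by (intro deg_in_sum_le)
  moreover have "deg_in (range Inl) (embed_y p :: ('n + 'm) rpoly) \<le> 0"
    by (rule deg_in_embed_y(2)[OF order.refl])
  then have "deg_in (range Inl) ((embed_y p :: ('n + 'm) rpoly)\<^sup>2) \<le> 0"
    by (rule deg_in_power_le) simp
  ultimately show ?thesis
    unfolding witness_def by (intro deg_in_mult_le[of _ _ 0]) auto
qed

lemma deg_separator:
  fixes G :: "('n::finite + 'm) rpoly^'q::finite^'q"
  shows "deg_in UNIV (separator G p v) \<le> 2 * d_G G - 1"
  unfolding separator_def by (intro deg_in_y_integral_le deg_witness)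

lemma peval_separator:
  fixes G :: "('n::finite + 'm) rpoly^'q::finite^'q"
  shows "peval x (separator G p v) = (LINT y:Y|\<nu>. (peval (($) y) p)\<^sup>2 *
    (\<Sum>k\<in>UNIV. \<Sum>l\<in>UNIV. v $ k * v $ l * peval (case_sum x (($) y)) (G $ k $ l)))"
  unfolding separator_def peval_y_integral[OF integrable_peval] by (simp add: witness_def)

text \<open>
  Failure of \<open>G(x\<^sub>0, y) \<ge> 0\<close> at a single \<open>y\<^sub>0 \<in> Y\<close> is turned into negativity of an integral over \<open>Y\<close>; the
  growth bound is obtained by scaling \<open>p\<close>.
\<close>

lemma exists_separator:
  fixes G :: "('n::finite + 'm) rpoly^'q::finite^'q"
  assumes "transpose G = G" "x0 \<notin> feasible_x Y G"
  shows "\<exists>p v. peval (($) x0) (separator G p v) < 0 \<and>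
    (\<forall>x. \<bar>peval x (separator G p v)\<bar> \<le> peval x theta ^ d_G G)"
proof -
  obtain y0 where y0: "y0 \<in> Y" "\<not> psd_matrix (map_matrix (peval (case_sum (($) x0) (($) y0))) G)"
    using assms(2) by (auto simp: feasible_x_def)
  define A where "A = map_matrix (peval (case_sum (($) x0) (($) y0))) G"
  have "transpose (map_matrix f G) = map_matrix f (transpose G)" for f :: "('n + 'm) rpoly \<Rightarrow> real"
    by (simp add: vec_eq_iff transpose_def)
  then have "transpose A = A" by (simp only: A_def assms(1))
  then have "\<not> (\<forall>v. 0 \<le> v \<bullet> (A *v v))"
    using y0(2) unfolding A_def[symmetric] psd_matrix_def by blast
  then obtain v where v: "v \<bullet> (A *v v) < 0" by (auto simp: not_le)
  define g where "g = psubst (\<lambda>w. case w of Inl a \<Rightarrow> Const (x0 $ a) | Inr b \<Rightarrow> Var b)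
    (\<Sum>k\<in>UNIV. \<Sum>l\<in>UNIV. Const (v $ k * v $ l) * G $ k $ l)"
  have g: "peval (($) y) g = (\<Sum>k\<in>UNIV. \<Sum>l\<in>UNIV. v $ k * v $ l * peval (case_sum (($) x0) (($) y)) (G $ k $ l))" for y :: "real^'m"
  proof -
    have "(\<lambda>w. peval (($) y) (case w of Inl a \<Rightarrow> Const (x0 $ a) | Inr b \<Rightarrow> Var b)) = case_sum (($) x0) (($) y)"
      by (auto simp: fun_eq_iff split: sum.splits)
    then show ?thesis by (simp add: g_def)
  qed
  have "peval (($) y0) g = v \<bullet> (A *v v)"
    unfolding g by (simp add: A_def inner_vec_def matrix_vector_mult_def sum_distrib_left mult_ac)
  then obtain p where p: "(LINT y:Y|\<nu>. (peval (($) y) p)\<^sup>2 * peval (($) y) g) < 0"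
    using exists_square_negative[OF y0(1), of g] v by auto
  have "deg_in UNIV (separator G p v) \<le> 2 * d_G G"
    using deg_separator[of G p v] by linarith
  from peval_growth[OF this]
  obtain B where B: "B \<ge> 0" "\<And>x. \<bar>peval x (separator G p v)\<bar> \<le> B * sqrt (peval x theta) ^ (2 * d_G G)"
    by blast
  \<comment> \<open>Scaling \<open>p\<close> by \<open>r\<close> divides the separator by \<open>B + 1\<close>.\<close>
  define r where "r = 1 / sqrt (B + 1)"
  have r: "r > 0" "r\<^sup>2 = 1 / (B + 1)" using B(1) by (simp_all add: r_def power_divide)
  have scale: "peval x (separator G (Const r * p) v) = r\<^sup>2 * peval x (separator G p v)" for x
  proof -
    have "(\<lambda>y. indicat_real Y y *\<^sub>R ((peval (($) y) (Const r * p))\<^sup>2 * u y))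
        = (\<lambda>y. r\<^sup>2 * (indicat_real Y y *\<^sub>R ((peval (($) y) p)\<^sup>2 * u y)))" for u
      by (simp add: fun_eq_iff power_mult_distrib)
    then show ?thesis
      unfolding peval_separator set_lebesgue_integral_def by simp
  qed
  have "peval (($) x0) (separator G (Const r * p) v) < 0"
  proof -
    have "peval (($) x0) (separator G p v) < 0" using p by (simp add: peval_separator g)
    then show ?thesis unfolding scale using r(1) by (intro mult_pos_neg) auto
  qed
  moreover have "\<bar>peval x (separator G (Const r * p) v)\<bar> \<le> peval x theta ^ d_G G" for x
  proof -
    have "\<bar>peval x (separator G p v)\<bar> \<le> B * peval x theta ^ d_G G"
      using B(2)[of x] theta_pos[of x] by (simp add: power_mult)
    also have "\<dots> \<le> (B + 1) * peval x theta ^ d_G G"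
      using theta_pos[of x] by (intro mult_right_mono) auto
    finally show ?thesis
      unfolding scale r(2) using B(1) by (simp add: abs_mult divide_le_eq mult.commute)
  qed
  ultimately show ?thesis by blast
qed

end

section \<open>A Positivstellensatz with quantified constraints\<close>

context carleman_set
begin

text \<open>
  With \<open>S\<close> a sum of matrices \<open>q (I \<otimes> v v\<^sup>T) p\<^sup>2\<close>, the integral term of the relaxation becomes a scalar
  combination of separators times the identity.
\<close>

lemma exists_certificate:
  fixes G :: "('n::finite + 'm) rpoly^'q::finite^'q" and T :: "'i \<Rightarrow> 'n rpoly"
  assumes c: "c \<ge> 0"
    and T: "\<And>h. h \<in> D \<Longrightarrow> deg_in UNIV (T h) \<le> t" and a: "2 * e + 2 * t \<le> a"
    and p: "\<And>h. h \<in> D \<Longrightarrow> 2 * deg_in UNIV (p h) \<le> b"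
  shows "\<exists>S :: ('n + 'm) rpoly^('p::finite \<times> 'q)^('p \<times> 'q). sos_matrix S
    \<and> map_matrix (y_integral \<nu> Y) (block_inner S G)
        = pscale (\<Sum>h\<in>D. Const c * theta ^ e * (T h)\<^sup>2 * separator G (p h) (v h)) (mat 1)
    \<and> mdeg_in (range Inl) S \<le> a \<and> mdeg_in (range Inr) S \<le> b"
proof -
  define q where "q h = Const c * theta ^ e * (T h)\<^sup>2" for h
  define R :: "'i \<Rightarrow> 'p \<Rightarrow> ('n + 'm) rpoly^('p \<times> 'q)" where
    "R h a = (\<chi> b. if fst b = a then Const (v h $ snd b) * (embed_x (T h) * embed_y (p h)) else 0)" for h a
  define S where "S = (\<Sum>h\<in>D. \<Sum>a\<in>UNIV. pscale (Const c * embed_x theta ^ e) (rank_one (R h a)))"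
  have "sos_matrix S"
    unfolding S_def
    by (intro sos_matrix_sum sos_matrix_pscale sos_mult sos_Const c sos_power sos_embed_x_theta sos_matrix_rank_one)
  have entry: "S $ (j, l) $ (i, k)
      = (if i = j then \<Sum>h\<in>D. embed_x (q h) * ((embed_y (p h))\<^sup>2 * Const (v h $ l * v h $ k)) else 0)" for i j k l
  proof -
    have "(\<Sum>a\<in>UNIV. (Const c * embed_x theta ^ e) * (R h a $ (j, l) * R h a $ (i, k)))
        = (if i = j then embed_x (q h) * ((embed_y (p h))\<^sup>2 * Const (v h $ l * v h $ k)) else 0)" for h
    proof -
      have "(\<Sum>a\<in>UNIV. (Const c * embed_x theta ^ e) * (R h a $ (j, l) * R h a $ (i, k)))
          = (\<Sum>a\<in>UNIV. if a = j then (if i = j then embed_x (q h) * ((embed_y (p h))\<^sup>2 * Const (v h $ l * v h $ k)) else 0) else 0)"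
      proof (rule sum.cong[OF refl])
        fix a :: 'p
        have "(Const c * embed_x theta ^ e) *
            ((Const (v h $ l) * (embed_x (T h) * embed_y (p h))) * (Const (v h $ k) * (embed_x (T h) * embed_y (p h))))
            = embed_x (q h) * ((embed_y (p h))\<^sup>2 * Const (v h $ l * v h $ k))"
          by (rule rpoly_eqI) (simp add: q_def power2_eq_square)
        then show "(Const c * embed_x theta ^ e) * (R h a $ (j, l) * R h a $ (i, k))
          = (if a = j then (if i = j then embed_x (q h) * ((embed_y (p h))\<^sup>2 * Const (v h $ l * v h $ k)) else 0) else 0)"
          by (auto simp: R_def)
      qed
      then show ?thesis by simp
    qed
    then show ?thesis by (simp add: S_def)
  qed
  have block: "block_inner S G $ i $ j = (if i = j then \<Sum>h\<in>D. embed_x (q h) * witness G (p h) (v h) else 0)" for i j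
  proof (cases "i = j")
    case True
    have "block_inner S G $ i $ j
        = (\<Sum>k\<in>UNIV. \<Sum>l\<in>UNIV. \<Sum>h\<in>D. embed_x (q h) * ((embed_y (p h))\<^sup>2 * Const (v h $ l * v h $ k)) * G $ l $ k)"
      unfolding block_inner_nth entry using True by (simp add: sum_distrib_right)
    also have "\<dots> = (\<Sum>l\<in>UNIV. \<Sum>k\<in>UNIV. \<Sum>h\<in>D. embed_x (q h) * ((embed_y (p h))\<^sup>2 * Const (v h $ l * v h $ k)) * G $ l $ k)"
      by (rule sum.swap)
    also have "\<dots> = (\<Sum>l\<in>UNIV. \<Sum>h\<in>D. \<Sum>k\<in>UNIV. embed_x (q h) * ((embed_y (p h))\<^sup>2 * Const (v h $ l * v h $ k)) * G $ l $ k)"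
      by (intro sum.cong refl sum.swap)
    also have "\<dots> = (\<Sum>h\<in>D. \<Sum>l\<in>UNIV. \<Sum>k\<in>UNIV. embed_x (q h) * ((embed_y (p h))\<^sup>2 * Const (v h $ l * v h $ k)) * G $ l $ k)"
      by (rule sum.swap)
    also have "\<dots> = (\<Sum>h\<in>D. embed_x (q h) * witness G (p h) (v h))"
      by (simp add: witness_def sum_distrib_left mult.assoc)
    finally show ?thesis using True by simp
  next
    case False
    then show ?thesis by (simp add: block_inner_nth entry)
  qed
  have zero: "y_integral \<nu> Y 0 = (0 :: 'n rpoly)" by (simp add: y_integral_def)
  have "map_matrix (y_integral \<nu> Y) (block_inner S G)
      = pscale (\<Sum>h\<in>D. q h * separator G (p h) (v h)) (mat 1)"
    by (simp add: vec_eq_iff block mat_def y_integral_embed_sum separator_def zero)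
  moreover have "mdeg_in (range Inl) S \<le> a"
  proof -
    have "deg_in UNIV (q h) \<le> a" if "h \<in> D" for h
      unfolding q_def
      by (intro deg_in_mult_le[of _ _ "2 * e" _ "2 * t"] deg_in_mult_le[of _ _ 0 _ "2 * e"] deg_in_power_le[OF T[OF that]]
          deg_in_power_le[OF deg_in_theta]) (use a in auto)
    then have q: "deg_in (range Inl) (embed_x (q h) :: ('n + 'm) rpoly) \<le> a" if "h \<in> D" for h
      using that by (intro deg_in_embed_x(1)) auto
    have r: "deg_in (range Inl) ((embed_y (p h) :: ('n + 'm) rpoly)\<^sup>2 * Const z) \<le> 0" for h z
      by (intro deg_in_mult_le[of _ _ 0 _ 0] deg_in_power_le[OF deg_in_embed_y(2)[OF order.refl]]) auto
    have "deg_in (range Inl) (embed_x (q h) * ((embed_y (p h) :: ('n + 'm) rpoly)\<^sup>2 * Const z)) \<le> a" if "h \<in> D" for h z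
      by (rule deg_in_mult_le[OF q[OF that] r]) simp
    then have "deg_in (range Inl) (S $ (j, l) $ (i, k)) \<le> a" for i j k l
      unfolding entry by (auto intro!: deg_in_sum_le)
    then show ?thesis unfolding mdeg_in_le_iff by (metis surj_pair)
  qed
  moreover have "mdeg_in (range Inr) S \<le> b"
  proof -
    have q: "deg_in (range Inr) (embed_x (q h) :: ('n + 'm) rpoly) \<le> 0" for h
      by (rule deg_in_embed_x(2)[OF order.refl])
    have r: "deg_in (range Inr) ((embed_y (p h) :: ('n + 'm) rpoly)\<^sup>2 * Const z) \<le> b" if "h \<in> D" for h z
      using p[OF that]
      by (intro deg_in_mult_le[of _ _ b _ 0] deg_in_power_le[OF deg_in_embed_y(1)[OF order.refl]]) auto
    have "deg_in (range Inr) (embed_x (q h) * ((embed_y (p h) :: ('n + 'm) rpoly)\<^sup>2 * Const z)) \<le> b" if "h \<in> D" for h z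
      by (rule deg_in_mult_le[OF q r[OF that]]) simp
    then have "deg_in (range Inr) (S $ (j, l) $ (i, k)) \<le> b" for i j k l
      unfolding entry by (auto intro!: deg_in_sum_le)
    then show ?thesis unfolding mdeg_in_le_iff by (metis surj_pair)
  qed
  ultimately show ?thesis
    using \<open>sos_matrix S\<close> unfolding q_def by (intro exI[of _ S]) simp
qed

end

text \<open>
  By Bernoulli's inequality, \<open>(1 - t)\<^sup>n (1 + n t) \<le> (1 - t\<^sup>2)\<^sup>n \<le> 1\<close>.
\<close>

lemma power_mult_le_inverse:
  fixes t :: real
  assumes "- 1 \<le> t" "t \<le> 1" "n > 0" "even n"
  shows "(1 - t) ^ n * t \<le> 1 / real n"
proof (cases "t \<ge> 0")
  case True
  have "(1 - t) ^ n * (1 + real n * t) \<le> (1 - t) ^ n * (1 + t) ^ n"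
    using Bernoulli_inequality[of t n] assms by (intro mult_left_mono) auto
  also have "\<dots> = (1 - t * t) ^ n"
    by (simp add: power_mult_distrib[symmetric] algebra_simps)
  also have "\<dots> \<le> 1"
    using True assms mult_le_one[of t t] by (intro power_le_one) auto
  finally have "(1 - t) ^ n + real n * ((1 - t) ^ n * t) \<le> 1" by (simp add: algebra_simps)
  moreover have "(1 - t) ^ n \<ge> 0" using assms by simp
  ultimately have "real n * ((1 - t) ^ n * t) \<le> 1" by linarith
  then show ?thesis using assms by (simp add: le_divide_eq mult.commute)
next
  case False
  then have "(1 - t) ^ n * t \<le> 0"
    using assms by (intro mult_nonneg_nonpos) auto
  also have "0 \<le> 1 / real n" by simp
  finally show ?thesis .
qed

lemma quadratic_growth:
  fixes P :: "'n::finite rpoly^'p::finite^'p"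
  assumes "\<And>i j. deg_in UNIV (P $ i $ j) \<le> d"
  shows "\<exists>B\<ge>0. \<forall>x u. \<bar>\<Sum>i\<in>UNIV. \<Sum>j\<in>UNIV. u i * u j * peval x (P $ i $ j)\<bar>
    \<le> B * sqrt (peval x theta) ^ d * (\<Sum>i\<in>UNIV. (u i)\<^sup>2)"
proof -
  have "\<forall>i j. \<exists>B. B \<ge> 0 \<and> (\<forall>x. \<bar>peval x (P $ i $ j)\<bar> \<le> B * sqrt (peval x theta) ^ d)"
    using peval_growth[OF assms] by metis
  then obtain B where B: "\<forall>i j. B i j \<ge> 0 \<and> (\<forall>x. \<bar>peval x (P $ i $ j)\<bar> \<le> B i j * sqrt (peval x theta) ^ d)"
    unfolding choice_iff by (elim exE)
  define C where "C = (\<Sum>i\<in>UNIV. \<Sum>j\<in>UNIV. B i j)"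
  have "\<bar>\<Sum>i\<in>UNIV. \<Sum>j\<in>UNIV. u i * u j * peval x (P $ i $ j)\<bar>
    \<le> C * sqrt (peval x theta) ^ d * (\<Sum>i\<in>UNIV. (u i)\<^sup>2)" for x u
  proof -
    define V where "V = (\<Sum>i\<in>UNIV. (u i)\<^sup>2)"
    have V: "V \<ge> 0" by (simp add: V_def sum_nonneg)
    have "\<bar>\<Sum>i\<in>UNIV. \<Sum>j\<in>UNIV. u i * u j * peval x (P $ i $ j)\<bar>
        \<le> (\<Sum>i\<in>UNIV. \<Sum>j\<in>UNIV. \<bar>u i * u j * peval x (P $ i $ j)\<bar>)"
      by (intro order.trans[OF sum_abs] sum_mono order.refl)
    also have "\<dots> \<le> (\<Sum>i\<in>UNIV. \<Sum>j\<in>UNIV. V * (B i j * sqrt (peval x theta) ^ d))"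
    proof (intro sum_mono)
      fix i j
      have "\<bar>u i * u j\<bar> \<le> V" unfolding V_def by (rule abs_mult_le_sum_squares)
      then show "\<bar>u i * u j * peval x (P $ i $ j)\<bar> \<le> V * (B i j * sqrt (peval x theta) ^ d)"
        unfolding abs_mult[of "u i * u j"] using B V by (intro mult_mono) auto
    qed
    also have "\<dots> = C * sqrt (peval x theta) ^ d * V"
      by (simp add: C_def sum_distrib_left sum_distrib_right mult_ac)
    finally show ?thesis by (simp only: V_def)
  qed
  moreover have "C \<ge> 0" unfolding C_def using B by (intro sum_nonneg) auto
  ultimately show ?thesis by blast
qed

context carleman_set
begin

text \<open>
  Three regions cover the space: outside a ball \<open>P\<close> is small against \<open>\<theta>\<^sup>d\<close>, close to a feasible point
  it is almost nonnegative, and close to any other point some separator is negative. Compactness of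
  the ball reduces the last case to finitely many separators and to a uniform bound \<open>\<kappa>\<close>.
\<close>

lemma finite_separation:
  fixes G :: "('n::finite + 'm) rpoly^'q::finite^'q" and P :: "'n rpoly^'p::finite^'p"
  assumes G: "transpose G = G" and d: "d \<ge> 1" and "\<epsilon> > 0" and B: "B \<ge> 0"
    and growth: "\<And>x u. \<bar>\<Sum>i\<in>UNIV. \<Sum>j\<in>UNIV. u i * u j * peval x (P $ i $ j)\<bar>
      \<le> B * sqrt (peval x theta) ^ (2 * d - 1) * (\<Sum>i\<in>UNIV. (u i)\<^sup>2)"
    and psd: "\<And>x u. x \<in> feasible_x Y G \<Longrightarrow> 0 \<le> (\<Sum>i\<in>UNIV. \<Sum>j\<in>UNIV. u i * u j * peval (($) x) (P $ i $ j))"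
  shows "\<exists>(D :: (real^'n) set) p v \<kappa>. finite D \<and> \<kappa> > 0
    \<and> (\<forall>h\<in>D. \<forall>x. \<bar>peval x (separator G (p h) (v h))\<bar> \<le> peval x theta ^ d_G G)
    \<and> (\<forall>x. (\<forall>u. - (\<epsilon> / 2) * peval x theta ^ d * (\<Sum>i\<in>UNIV. (u i)\<^sup>2)
              \<le> (\<Sum>i\<in>UNIV. \<Sum>j\<in>UNIV. u i * u j * peval x (P $ i $ j)))
         \<or> (\<exists>h\<in>D. peval x (separator G (p h) (v h)) \<le> - \<kappa> * peval x theta ^ d_G G))"
proof -
  define X where "X = feasible_x Y G"
  have "\<forall>x0. \<exists>w. x0 \<notin> X \<longrightarrow> peval (($) x0) (separator G (fst w) (snd w)) < 0 \<and>
    (\<forall>x. \<bar>peval x (separator G (fst w) (snd w))\<bar> \<le> peval x theta ^ d_G G)"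
  proof
    fix x0
    show "\<exists>w. x0 \<notin> X \<longrightarrow> peval (($) x0) (separator G (fst w) (snd w)) < 0 \<and>
      (\<forall>x. \<bar>peval x (separator G (fst w) (snd w))\<bar> \<le> peval x theta ^ d_G G)"
    proof (cases "x0 \<in> X")
      case False
      then obtain p v where "peval (($) x0) (separator G p v) < 0 \<and>
          (\<forall>x. \<bar>peval x (separator G p v)\<bar> \<le> peval x theta ^ d_G G)"
        using exists_separator[OF G] unfolding X_def by blast
      then show ?thesis by (intro exI[of _ "(p, v)"]) simp
    qed simp
  qed
  then obtain w where w: "\<forall>x0. x0 \<notin> X \<longrightarrow> peval (($) x0) (separator G (fst (w x0)) (snd (w x0))) < 0 \<and>
    (\<forall>x. \<bar>peval x (separator G (fst (w x0)) (snd (w x0)))\<bar> \<le> peval x theta ^ d_G G)"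
    unfolding choice_iff by (elim exE)
  define sep where "sep h = separator G (fst (w h)) (snd (w h))" for h
  define \<kappa> where "\<kappa> h = - peval (($) h) (sep h) / (2 * peval (($) h) theta ^ d_G G)" for h
  have sep_neg: "peval (($) h) (sep h) < 0" if "h \<notin> X" for h
    using w that unfolding sep_def by blast
  have \<kappa>: "\<kappa> h > 0" if "h \<notin> X" for h
    using sep_neg[OF that] theta_pos[of "($) h"] by (simp add: \<kappa>_def divide_neg_pos)
  define f where "f h = (if h \<in> X
      then {x. (\<Sum>i\<in>UNIV. \<Sum>j\<in>UNIV. \<bar>peval (($) x) (P $ i $ j) - peval (($) h) (P $ i $ j)\<bar>) < \<epsilon> / 2}
      else {x. peval (($) x) (sep h) < - \<kappa> h * peval (($) x) theta ^ d_G G})" for h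
  \<comment> \<open>Outside this radius the growth bound gives the first alternative.\<close>
  define R where "R = 2 * B / \<epsilon>"
  have cont: "continuous_on UNIV (\<lambda>x :: real^'n. peval (($) x) p)" for p
    by (intro continuous_intros)
  have op: "open (f h)" for h
    unfolding f_def by (cases "h \<in> X") (auto intro!: open_Collect_less continuous_intros cont)
  have self: "h \<in> f h" for h
  proof (cases "h \<in> X")
    case False
    have "- \<kappa> h * peval (($) h) theta ^ d_G G = peval (($) h) (sep h) / 2"
      using theta_pos[of "($) h"] by (simp add: \<kappa>_def)
    then show ?thesis using False sep_neg[OF False] by (simp add: f_def)
  qed (use \<open>\<epsilon> > 0\<close> in \<open>simp add: f_def\<close>)
  have "cball 0 R \<subseteq> (\<Union>h\<in>cball 0 R. f h)" using self by blast
  with compact_cball op obtain C where C: "finite C" "cball 0 R \<subseteq> (\<Union>h\<in>C. f h)"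
    by (rule compactE_image)
  define D where "D = C - X"
  define \<kappa>0 where "\<kappa>0 = Min (insert 1 (\<kappa> ` D))"
  have D: "finite D" using C by (simp add: D_def)
  have \<kappa>0: "\<kappa>0 > 0"
    unfolding \<kappa>0_def using D \<kappa> by (subst Min_gr_iff) (auto simp: D_def)
  have main: "(\<forall>u. - (\<epsilon> / 2) * peval (($) x) theta ^ d * (\<Sum>i\<in>UNIV. (u i)\<^sup>2)
              \<le> (\<Sum>i\<in>UNIV. \<Sum>j\<in>UNIV. u i * u j * peval (($) x) (P $ i $ j)))
         \<or> (\<exists>h\<in>D. peval (($) x) (sep h) \<le> - \<kappa>0 * peval (($) x) theta ^ d_G G)" for x :: "real^'n"
  proof (cases "norm x \<le> R")
    case True
    then obtain h where h: "h \<in> C" "x \<in> f h" using C(2) by auto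
    show ?thesis
    proof (cases "h \<in> X")
      case True
      have "- (\<epsilon> / 2) * peval (($) x) theta ^ d * (\<Sum>i\<in>UNIV. (u i)\<^sup>2)
              \<le> (\<Sum>i\<in>UNIV. \<Sum>j\<in>UNIV. u i * u j * peval (($) x) (P $ i $ j))" for u
      proof -
        define V where "V = (\<Sum>i\<in>UNIV. (u i)\<^sup>2)"
        have V: "V \<ge> 0" by (simp add: V_def sum_nonneg)
        have "(\<Sum>i\<in>UNIV. \<Sum>j\<in>UNIV. u i * u j * peval (($) h) (P $ i $ j))
              - (\<Sum>i\<in>UNIV. \<Sum>j\<in>UNIV. u i * u j * peval (($) x) (P $ i $ j))
            = (\<Sum>i\<in>UNIV. \<Sum>j\<in>UNIV. u i * u j * (peval (($) h) (P $ i $ j) - peval (($) x) (P $ i $ j)))"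
          by (simp add: sum_subtractf right_diff_distrib)
        also have "\<dots> \<le> (\<Sum>i\<in>UNIV. \<Sum>j\<in>UNIV. V * \<bar>peval (($) x) (P $ i $ j) - peval (($) h) (P $ i $ j)\<bar>)"
        proof (intro sum_mono)
          fix i j
          have "\<bar>u i * u j\<bar> \<le> V" unfolding V_def by (rule abs_mult_le_sum_squares)
          then have "\<bar>u i * u j\<bar> * \<bar>peval (($) h) (P $ i $ j) - peval (($) x) (P $ i $ j)\<bar>
              \<le> V * \<bar>peval (($) h) (P $ i $ j) - peval (($) x) (P $ i $ j)\<bar>"
            by (rule mult_right_mono) simp
          then show "u i * u j * (peval (($) h) (P $ i $ j) - peval (($) x) (P $ i $ j))
              \<le> V * \<bar>peval (($) x) (P $ i $ j) - peval (($) h) (P $ i $ j)\<bar>"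
            unfolding abs_mult[symmetric] abs_minus_commute[of "peval (($) x) _"] by linarith
        qed
        also have "\<dots> = V * (\<Sum>i\<in>UNIV. \<Sum>j\<in>UNIV. \<bar>peval (($) x) (P $ i $ j) - peval (($) h) (P $ i $ j)\<bar>)"
          by (simp only: sum_distrib_left)
        also have "\<dots> \<le> V * (\<epsilon> / 2)"
          using h(2) True V unfolding f_def by (intro mult_left_mono) auto
        also have "\<dots> \<le> (\<epsilon> / 2) * peval (($) x) theta ^ d * V"
        proof -
          have "1 \<le> peval (($) x) theta ^ d" by (rule one_le_power[OF theta_ge_1])
          from mult_left_mono[OF this, of "V * (\<epsilon> / 2)"] show ?thesis
            using V \<open>\<epsilon> > 0\<close> by (simp add: mult_ac)
        qed
        finally show ?thesis
          using psd[of h u] True unfolding X_def V_def by simp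
      qed
      then show ?thesis by blast
    next
      case False
      then have hD: "h \<in> D" using h(1) by (simp add: D_def)
      then have "\<kappa>0 \<le> \<kappa> h" unfolding \<kappa>0_def using D by (intro Min_le) auto
      then have "\<kappa>0 * peval (($) x) theta ^ d_G G \<le> \<kappa> h * peval (($) x) theta ^ d_G G"
        using theta_pos[of "($) x"] by (intro mult_right_mono) auto
      moreover have "peval (($) x) (sep h) < - \<kappa> h * peval (($) x) theta ^ d_G G"
        using h(2) False by (simp add: f_def)
      ultimately have "peval (($) x) (sep h) \<le> - \<kappa>0 * peval (($) x) theta ^ d_G G" by linarith
      with hD show ?thesis by blast
    qed
  next
    case False
    define s where "s = sqrt (peval (($) x) theta)"
    have "norm x \<le> s" unfolding s_def by (intro real_le_rsqrt) (simp add: peval_theta_vec)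
    then have "R \<le> s" using False by linarith
    then have Bs: "B \<le> (\<epsilon> / 2) * s" using \<open>\<epsilon> > 0\<close> by (simp add: R_def divide_le_eq mult_ac)
    have s: "s \<ge> 0" "s\<^sup>2 = peval (($) x) theta"
      using theta_pos[of "($) x"] by (simp_all add: s_def)
    have "s * s ^ (2 * d - 1) = s ^ (2 * d)"
      using d by (simp add: power_Suc[symmetric] del: power_Suc)
    also have "\<dots> = peval (($) x) theta ^ d" by (simp only: power_mult s(2))
    finally have sd: "s * s ^ (2 * d - 1) = peval (($) x) theta ^ d" .
    have "- (\<epsilon> / 2) * peval (($) x) theta ^ d * (\<Sum>i\<in>UNIV. (u i)\<^sup>2)
              \<le> (\<Sum>i\<in>UNIV. \<Sum>j\<in>UNIV. u i * u j * peval (($) x) (P $ i $ j))" for u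
    proof -
      have "B * s ^ (2 * d - 1) * (\<Sum>i\<in>UNIV. (u i)\<^sup>2) \<le> (\<epsilon> / 2) * s * s ^ (2 * d - 1) * (\<Sum>i\<in>UNIV. (u i)\<^sup>2)"
        using Bs s by (intro mult_right_mono) (auto simp: sum_nonneg)
      also have "\<dots> = (\<epsilon> / 2) * peval (($) x) theta ^ d * (\<Sum>i\<in>UNIV. (u i)\<^sup>2)"
        by (simp only: sd[symmetric] mult.assoc)
      finally show ?thesis using growth[of u "($) x"] unfolding s_def by linarith
    qed
    then show ?thesis by blast
  qed
  have "(\<forall>u. - (\<epsilon> / 2) * peval x theta ^ d * (\<Sum>i\<in>UNIV. (u i)\<^sup>2)
              \<le> (\<Sum>i\<in>UNIV. \<Sum>j\<in>UNIV. u i * u j * peval x (P $ i $ j)))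
         \<or> (\<exists>h\<in>D. peval x (sep h) \<le> - \<kappa>0 * peval x theta ^ d_G G)" for x :: "'n \<Rightarrow> real"
  proof -
    have "(($) (\<chi> i. x i)) = x" by (simp add: fun_eq_iff)
    with main[of "\<chi> i. x i"] show ?thesis by simp
  qed
  moreover have "\<bar>peval x (sep h)\<bar> \<le> peval x theta ^ d_G G" if "h \<in> D" for h x
    using w that unfolding sep_def D_def by blast
  ultimately show ?thesis
    using D \<kappa>0 unfolding sep_def
    by (intro exI[of _ D] exI[of _ "\<lambda>h. fst (w h)"] exI[of _ "\<lambda>h. snd (w h)"] exI[of _ \<kappa>0]) blast
qed

text \<open>
  The constants \<open>c\<close> and \<open>k\<close> are chosen such that subtracting \<open>c (\<theta>\<^sup>e - g)\<^sup>2\<^sup>k g\<close> for the finitely many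
  separators \<open>g\<close> outweighs the negative values of \<open>P\<close> and costs at most \<open>\<epsilon> / 4\<close> elsewhere. What
  is left is bounded below by \<open>\<epsilon> / 4\<close> relative to \<open>\<theta>\<^sup>L\<close>, and Reznick's theorem applies.
\<close>

theorem positivstellensatz:
  fixes G :: "('n::finite + 'm) rpoly^'q::finite^'q" and P :: "'n rpoly^'p::finite^'p"
  assumes G: "transpose G = G" and sym: "\<And>i j. P $ i $ j = P $ j $ i"
    and d: "d \<ge> 1" and deg: "\<And>i j. deg_in UNIV (P $ i $ j) \<le> 2 * d - 1" and \<epsilon>: "\<epsilon> > 0"
    and psd: "\<And>x u. x \<in> feasible_x Y G \<Longrightarrow> 0 \<le> (\<Sum>i\<in>UNIV. \<Sum>j\<in>UNIV. u i * u j * peval (($) x) (P $ i $ j))"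
  shows "\<exists>l\<ge>l0. \<exists>(S\<^sub>0 :: 'n rpoly^'p^'p) (S :: ('n + 'm) rpoly^('p \<times> 'q)^('p \<times> 'q)).
    sos_matrix S\<^sub>0 \<and> sos_matrix S \<and>
    pscale (theta ^ (l - d)) (P + pscale (Const \<epsilon> * theta ^ d) (mat 1))
      = S\<^sub>0 + map_matrix (y_integral \<nu> Y) (block_inner S G) \<and>
    mdeg_in UNIV S\<^sub>0 \<le> 2 * l \<and>
    mdeg_in (range Inl) S \<le> 2 * (l - d_G G) \<and> mdeg_in (range Inr) S \<le> 2 * (l - half_deg_y G)"
proof -
  obtain B where B: "B \<ge> 0" and growth: "\<And>x u. \<bar>\<Sum>i\<in>UNIV. \<Sum>j\<in>UNIV. u i * u j * peval x (P $ i $ j)\<bar>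
    \<le> B * sqrt (peval x theta) ^ (2 * d - 1) * (\<Sum>i\<in>UNIV. (u i)\<^sup>2)"
    using quadratic_growth[OF deg] by blast
  obtain D :: "(real^'n) set" and p v \<kappa> where D: "finite D" and \<kappa>: "\<kappa> > 0"
    and sep_le: "\<And>h x. h \<in> D \<Longrightarrow> \<bar>peval x (separator G (p h) (v h))\<bar> \<le> peval x theta ^ d_G G"
    and sep: "\<And>x. (\<forall>u. - (\<epsilon> / 2) * peval x theta ^ d * (\<Sum>i\<in>UNIV. (u i)\<^sup>2)
              \<le> (\<Sum>i\<in>UNIV. \<Sum>j\<in>UNIV. u i * u j * peval x (P $ i $ j)))
         \<or> (\<exists>h\<in>D. peval x (separator G (p h) (v h)) \<le> - \<kappa> * peval x theta ^ d_G G)"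
    using finite_separation[OF G d \<epsilon> B growth psd] by blast
  define g where "g h = separator G (p h) (v h)" for h
  define dG where "dG = d_G G"
  \<comment> \<open>A separator that is at most \<open>- \<kappa>\<close> then contributes at least \<open>B\<close>, the size of \<open>P\<close>.\<close>
  define c where "c = B / \<kappa>"
  have c: "c \<ge> 0" "c * \<kappa> = B" using B \<kappa> by (simp_all add: c_def)
  obtain k0 :: nat where k0: "real k0 > c * real (card D) / (\<epsilon> / 4)" using reals_Archimedean2 by blast
  define k where "k = Suc k0"
  have k: "k > 0" "c * real (card D) / real (2 * k) \<le> \<epsilon> / 4"
  proof -
    have "c * real (card D) / (\<epsilon> / 4) \<le> real (2 * k)" using k0 by (simp add: k_def)
    then have "c * real (card D) \<le> real (2 * k) * (\<epsilon> / 4)" using \<epsilon> by (simp add: divide_le_eq)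
    then show "c * real (card D) / real (2 * k) \<le> \<epsilon> / 4"
      by (simp add: divide_le_eq k_def mult.commute del: of_nat_mult of_nat_Suc)
  qed (simp add: k_def)
  define m where "m = (\<Sum>h\<in>D. deg_in UNIV (p h))"
  have m: "deg_in UNIV (p h) \<le> m" if "h \<in> D" for h
    unfolding m_def using D that by (intro member_le_sum) auto
  \<comment> \<open>Large enough for all degree bounds and for the prescribed level.\<close>
  define L where "L = l0 + d + (2 * k + 1) * dG + half_deg_y G + m"
  define e where "e = L - (2 * k + 1) * dG"
  have L: "L = e + (2 * k + 1) * dG" "L = (L - d) + d" "d \<le> L" by (simp_all add: L_def e_def)
  define T where "T h = (theta ^ dG - g h) ^ k" for h
  define \<Phi> where "\<Phi> = (\<Sum>h\<in>D. Const c * theta ^ e * (T h)\<^sup>2 * g h)"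
  define A where "A = P + pscale (Const \<epsilon> * theta ^ d) (mat 1)"
  define Q where "Q = pscale (theta ^ (L - d)) A - pscale \<Phi> (mat 1)"
  have deg_g: "deg_in UNIV (g h) \<le> 2 * dG" for h
    using deg_separator[of G "p h" "v h"] by (simp add: g_def dG_def)
  have deg_th: "deg_in UNIV (theta ^ n :: 'n rpoly) \<le> 2 * n" for n
    by (rule deg_in_power_le[OF deg_in_theta]) simp
  have deg_T: "deg_in UNIV (T h) \<le> 2 * dG * k" for h
    unfolding T_def by (rule deg_in_power_le[of _ _ "2 * dG"]) (auto intro: deg_in_diff_le deg_th deg_g)
  have deg_Phi: "deg_in UNIV \<Phi> \<le> 2 * L"
    unfolding \<Phi>_def
  proof (rule deg_in_sum_le)
    fix h assume "h \<in> D"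
    have "deg_in UNIV (Const c * theta ^ e :: 'n rpoly) \<le> 2 * e"
      by (rule deg_in_mult_le[of _ _ 0 _ "2 * e"]) (auto intro: deg_th)
    then have "deg_in UNIV (Const c * theta ^ e * (T h)\<^sup>2) \<le> 2 * e + 2 * dG * k * 2"
      by (rule deg_in_mult_le[OF _ deg_in_power_le[OF deg_T order.refl]]) simp
    then show "deg_in UNIV (Const c * theta ^ e * (T h)\<^sup>2 * g h) \<le> 2 * L"
      by (rule deg_in_mult_le[OF _ deg_g]) (simp add: L(1) algebra_simps)
  qed
  have deg_A: "deg_in UNIV (A $ i $ j) \<le> 2 * d" for i j
  proof -
    have "deg_in UNIV (Const \<epsilon> * theta ^ d * (mat 1 :: 'n rpoly^'p^'p) $ i $ j) \<le> 2 * d"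
      by (rule deg_in_mult_le[of _ _ "2 * d" _ 0])
        (auto simp: mat_def intro: deg_in_mult_le[of _ _ 0 _ "2 * d"] deg_th)
    moreover have "deg_in UNIV (P $ i $ j) \<le> 2 * d" using deg[of i j] by linarith
    ultimately show ?thesis unfolding A_def by (auto intro: deg_in_add_le)
  qed
  have deg_scaled: "deg_in UNIV (theta ^ (l - d) * A $ i $ j) \<le> 2 * l" if "d \<le> l" for l i j
    by (rule deg_in_mult_le[OF deg_th deg_A]) (use that in simp)
  have deg_Q: "deg_in UNIV (Q $ i $ j) \<le> 2 * L" for i j
  proof -
    have "deg_in UNIV (\<Phi> * (mat 1 :: 'n rpoly^'p^'p) $ i $ j) \<le> 2 * L"
      by (rule deg_in_mult_le[OF deg_Phi, of _ 0]) (auto simp: mat_def)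
    then show ?thesis
      unfolding Q_def using deg_scaled[OF L(3)] by (auto intro: deg_in_diff_le)
  qed
  have sym_Q: "Q $ i $ j = Q $ j $ i" for i j
    using sym[of i j] by (simp add: Q_def A_def mat_def)
  have pos: "\<epsilon> / 4 * peval x theta ^ L * (\<Sum>i\<in>UNIV. (u i)\<^sup>2)
      \<le> (\<Sum>i\<in>UNIV. \<Sum>j\<in>UNIV. u i * u j * peval x (Q $ i $ j))" for x u
  proof -
    define V where "V = (\<Sum>i\<in>UNIV. (u i)\<^sup>2)"
    have V: "V \<ge> 0" by (simp add: V_def sum_nonneg)
    define th where "th = peval x theta"
    have th: "th \<ge> 1" unfolding th_def by (rule theta_ge_1)
    define qP where "qP = (\<Sum>i\<in>UNIV. \<Sum>j\<in>UNIV. u i * u j * peval x (P $ i $ j))"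
    have diag: "(\<Sum>i\<in>UNIV. \<Sum>j\<in>UNIV. u i * u j * (r * (if i = j then 1 else 0))) = r * V" for r
      unfolding V_def by (rule quadratic_form_scalar)
    let ?\<psi> = "\<lambda>h. (1 - peval x (g h) / th ^ dG) ^ (2 * k) * (peval x (g h) / th ^ dG)"
    define \<phi> where "\<phi> = (\<Sum>h\<in>D. c * ?\<psi> h)"
    have Phi: "peval x \<Phi> = th ^ L * \<phi>"
    proof -
      have "peval x (Const c * theta ^ e * (T h)\<^sup>2 * g h)
          = th ^ L * (c * ?\<psi> h)" for h
      proof -
        define r where "r = th ^ dG"
        have r: "r > 0" using th by (simp add: r_def)
        have "th ^ L = th ^ e * (r ^ (2 * k) * r)"
          unfolding L(1) r_def by (simp add: power_add power_mult[symmetric] mult.commute)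
        moreover have "(r - y) ^ (2 * k) = r ^ (2 * k) * (1 - y / r) ^ (2 * k)" for y
          using r by (simp add: power_mult_distrib[symmetric] right_diff_distrib)
        moreover have "y = r * (y / r)" for y using r by simp
        moreover have "peval x ((T h)\<^sup>2) = (r - peval x (g h)) ^ (2 * k)"
          by (simp add: T_def r_def th_def power_mult[symmetric] mult.commute)
        ultimately show ?thesis
          unfolding r_def[symmetric] by (simp add: th_def[symmetric])
      qed
      then show ?thesis by (simp only: \<Phi>_def \<phi>_def peval_sum sum_distrib_left)
    qed
    have "(\<Sum>i\<in>UNIV. \<Sum>j\<in>UNIV. u i * u j * peval x (Q $ i $ j)) = th ^ (L - d) * (qP + \<epsilon> * th ^ d * V) - th ^ L * \<phi> * V"
    proof -
      have "u i * u j * peval x (Q $ i $ j) = th ^ (L - d) * (u i * u j * peval x (P $ i $ j))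
          + u i * u j * ((th ^ (L - d) * (\<epsilon> * th ^ d) - th ^ L * \<phi>) * (if i = j then 1 else 0))" for i j
        by (simp add: Q_def A_def Phi th_def[symmetric] mat_def algebra_simps)
      then have "(\<Sum>i\<in>UNIV. \<Sum>j\<in>UNIV. u i * u j * peval x (Q $ i $ j))
          = th ^ (L - d) * qP + (th ^ (L - d) * (\<epsilon> * th ^ d) - th ^ L * \<phi>) * V"
        by (simp only: sum.distrib sum_distrib_left[symmetric] qP_def diag)
      then show ?thesis by (simp add: algebra_simps)
    qed
    moreover have "th ^ (L - d) * (qP + \<epsilon> * th ^ d * V) - th ^ L * \<phi> * V \<ge> \<epsilon> / 4 * th ^ L * V"
    proof -
      have thL: "th ^ L = th ^ (L - d) * th ^ d" using L(3) by (simp add: power_add[symmetric])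
      have term_le: "c * ?\<psi> h \<le> c / real (2 * k)"
        if "h \<in> D" for h
      proof -
        have "\<bar>peval x (g h) / th ^ dG\<bar> \<le> 1"
          using sep_le[OF that, of x] th unfolding g_def dG_def th_def by (simp add: divide_le_eq)
        then have "?\<psi> h \<le> 1 / real (2 * k)"
          using k(1) unfolding abs_le_iff by (intro power_mult_le_inverse) auto
        from mult_left_mono[OF this c(1)] show ?thesis by simp
      qed
      have "- (qP + (\<epsilon> - \<phi>) * th ^ d * V) \<le> - (\<epsilon> / 4 * th ^ d * V)"
      proof -
        have lower: "\<rho> * th ^ d * V \<le> qP \<Longrightarrow> \<epsilon> / 4 \<le> \<rho> + \<epsilon> - \<phi> \<Longrightarrow> ?thesis" for \<rho>
        proof -
          assume 1: "\<rho> * th ^ d * V \<le> qP" and 2: "\<epsilon> / 4 \<le> \<rho> + \<epsilon> - \<phi>"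
          have "\<epsilon> / 4 * (th ^ d * V) \<le> (\<rho> + \<epsilon> - \<phi>) * (th ^ d * V)"
            using 2 th V by (intro mult_right_mono) auto
          then show ?thesis using 1 by (simp add: algebra_simps)
        qed
        from sep[of x] show ?thesis
        proof
          assume *: "\<forall>u. - (\<epsilon> / 2) * peval x theta ^ d * (\<Sum>i\<in>UNIV. (u i)\<^sup>2)
              \<le> (\<Sum>i\<in>UNIV. \<Sum>j\<in>UNIV. u i * u j * peval x (P $ i $ j))"
          have "\<phi> \<le> (\<Sum>h\<in>D. c / real (2 * k))" unfolding \<phi>_def by (intro sum_mono term_le)
          also have "\<dots> \<le> \<epsilon> / 4" using k(2) by (simp add: mult.commute)
          finally have "\<epsilon> / 4 \<le> - (\<epsilon> / 2) + \<epsilon> - \<phi>" by simp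
          moreover have "- (\<epsilon> / 2) * th ^ d * V \<le> qP" using * unfolding th_def V_def qP_def by blast
          ultimately show ?thesis by (intro lower)
        next
          assume "\<exists>h\<in>D. peval x (separator G (p h) (v h)) \<le> - \<kappa> * peval x theta ^ d_G G"
          then obtain h where h: "h \<in> D" "peval x (g h) \<le> - \<kappa> * th ^ dG"
            unfolding g_def dG_def th_def by blast
          have "peval x (g h) / th ^ dG \<le> - \<kappa>" using h(2) th by (simp add: divide_le_eq)
          moreover have "(1 - y) ^ (2 * k) * y \<le> y" if "y \<le> 0" for y :: real
          proof -
            have "1 \<le> (1 - y) ^ (2 * k)" using that by (intro one_le_power) simp
            from mult_right_mono_neg[OF this that] show ?thesis by simp
          qed
          ultimately have "?\<psi> h \<le> - \<kappa>"
            using \<kappa> by (meson le_less_trans less_imp_le neg_less_0_iff_less order.trans)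
          from mult_left_mono[OF this c(1)]
          have th1: "c * ?\<psi> h \<le> - B"
            using c(2) by simp
          have "\<phi> = c * ?\<psi> h
              + (\<Sum>h\<in>D - {h}. c * ?\<psi> h)"
            unfolding \<phi>_def using D h(1) by (rule sum.remove)
          also have "(\<Sum>h\<in>D - {h}. c * ?\<psi> h)
              \<le> (\<Sum>h\<in>D - {h}. c / real (2 * k))"
            by (intro sum_mono term_le) auto
          also have "\<dots> \<le> (\<Sum>h\<in>D. c / real (2 * k))"
            using D c by (intro sum_mono2) auto
          also have "\<dots> \<le> \<epsilon> / 4" using k(2) by (simp add: mult.commute)
          finally have "\<epsilon> / 4 \<le> - B + \<epsilon> - \<phi>" using th1 \<epsilon> by linarith
          moreover have "- B * th ^ d * V \<le> qP"
          proof -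
            have s1: "1 \<le> sqrt th" using th by simp
            have "sqrt th ^ (2 * d - 1) \<le> sqrt th ^ (2 * d)" using s1 by (intro power_increasing) auto
            also have "\<dots> = th ^ d" using th by (simp add: power_mult)
            finally have "B * sqrt th ^ (2 * d - 1) * V \<le> B * th ^ d * V"
              using B V by (intro mult_right_mono mult_left_mono)
            then show ?thesis using growth[of u x] unfolding th_def[symmetric] V_def[symmetric] qP_def[symmetric] by linarith
          qed
          ultimately show ?thesis by (intro lower)
        qed
      qed
      then have "\<epsilon> / 4 * th ^ d * V \<le> qP + (\<epsilon> - \<phi>) * th ^ d * V" by linarith
      from mult_left_mono[OF this, of "th ^ (L - d)"] th
      have "th ^ (L - d) * (\<epsilon> / 4 * th ^ d * V) \<le> th ^ (L - d) * (qP + (\<epsilon> - \<phi>) * th ^ d * V)" by simp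
      then show ?thesis unfolding thL by (simp add: algebra_simps)
    qed
    ultimately show ?thesis unfolding V_def th_def by simp
  qed
  obtain N where N: "sos_matrix (pscale (theta ^ N) Q)"
    using matrix_reznick[OF sym_Q deg_Q _ pos] \<epsilon> by auto
  have "2 * (N + e) + 2 * (2 * dG * k) \<le> 2 * (N + L - dG)" by (simp add: L(1) algebra_simps)
  moreover have "2 * deg_in UNIV (p h) \<le> 2 * (N + L - half_deg_y G)" if "h \<in> D" for h
    using m[OF that] by (simp add: L_def)
  ultimately obtain S :: "('n + 'm) rpoly^('p \<times> 'q)^('p \<times> 'q)" where S: "sos_matrix S"
    "map_matrix (y_integral \<nu> Y) (block_inner S G)
        = pscale (\<Sum>h\<in>D. Const c * theta ^ (N + e) * (T h)\<^sup>2 * separator G (p h) (v h)) (mat 1)"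
    "mdeg_in (range Inl) S \<le> 2 * (N + L - dG)" "mdeg_in (range Inr) S \<le> 2 * (N + L - half_deg_y G)"
    using exists_certificate[where c = c and T = T and D = D and t = "2 * dG * k" and e = "N + e"
        and a = "2 * (N + L - dG)" and p = p and b = "2 * (N + L - half_deg_y G)" and G = G and v = v]
      c(1) deg_T by blast
  have "(\<Sum>h\<in>D. Const c * theta ^ (N + e) * (T h)\<^sup>2 * separator G (p h) (v h)) = theta ^ N * \<Phi>"
    by (simp add: \<Phi>_def g_def sum_distrib_left power_add mult_ac)
  then have "map_matrix (y_integral \<nu> Y) (block_inner S G) = pscale (theta ^ N * \<Phi>) (mat 1)"
    using S(2) by simp
  moreover have "pscale (theta ^ (N + L - d)) A = pscale (theta ^ N) Q + pscale (theta ^ N * \<Phi>) (mat 1)"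
  proof -
    have "N + L - d = N + (L - d)" using L(3) by simp
    then show ?thesis by (simp add: vec_eq_iff Q_def power_add right_diff_distrib mult.assoc)
  qed
  moreover have "mdeg_in UNIV (pscale (theta ^ N) Q) \<le> 2 * (N + L)"
    unfolding mdeg_in_le_iff by (auto intro: deg_in_mult_le[OF deg_th deg_Q])
  moreover have "l0 \<le> N + L" by (simp add: L_def)
  ultimately show ?thesis
    using N S(1,3,4) unfolding A_def dG_def
    by (intro exI[of _ "N + L"] conjI exI[of _ "pscale (theta ^ N) Q"] exI[of _ S]) simp_all
qed

end

section \<open>The relaxed problem\<close>

lemma peval_Lam:
  "peval x (Lam \<Lambda>\<^sub>0 \<Lambda> \<gamma> $ i $ j) = peval x (\<Lambda>\<^sub>0 $ i $ j) - (\<Sum>r\<in>UNIV. \<gamma> $ r * peval x (\<Lambda> r $ i $ j))"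
  by (simp add: Lam_def)

text \<open>
  Substituting numbers for the indeterminates \<open>\<gamma>\<close> in the joint matrix does not raise the degree in \<open>x\<close>.
\<close>

lemma deg_Lam:
  fixes \<Lambda>\<^sub>0 :: "'n::finite rpoly^'p::finite^'p" and \<Lambda> :: "'r::finite \<Rightarrow> 'n rpoly^'p^'p"
  shows "deg_in UNIV (Lam \<Lambda>\<^sub>0 \<Lambda> \<gamma> $ i $ j) \<le> 2 * d_Lam \<Lambda>\<^sub>0 \<Lambda> - 1"
proof -
  define \<sigma> :: "'n + 'r \<Rightarrow> 'n rpoly" where "\<sigma> = case_sum Var (\<lambda>r. Const (\<gamma> $ r))"
  have "Lam \<Lambda>\<^sub>0 \<Lambda> \<gamma> $ i $ j = psubst \<sigma> (Lam_joint \<Lambda>\<^sub>0 \<Lambda> $ i $ j)"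
    by (rule rpoly_eqI) (simp add: peval_Lam Lam_joint_def Let_def \<sigma>_def)
  moreover have "deg_in UNIV (\<sigma> w) \<le> (if w \<in> range Inl then 1 else 0)" for w
  proof (cases w)
    case (Inl a)
    then show ?thesis using deg_in_Var_le[of UNIV a] by (simp add: \<sigma>_def)
  next
    case (Inr b)
    then show ?thesis by (simp add: \<sigma>_def)
  qed
  then have "deg_in UNIV (psubst \<sigma> (Lam_joint \<Lambda>\<^sub>0 \<Lambda> $ i $ j)) \<le> deg_in (range Inl) (Lam_joint \<Lambda>\<^sub>0 \<Lambda> $ i $ j)"
    by (rule deg_in_psubst_le) simp
  moreover have "deg_in (range Inl) (Lam_joint \<Lambda>\<^sub>0 \<Lambda> $ i $ j) < 2 * d_Lam \<Lambda>\<^sub>0 \<Lambda>"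
    unfolding d_Lam_def by (rule deg_in_less_half_deg_in)
  ultimately show ?thesis by simp
qed

lemma psd_matrix_quadratic:
  fixes A :: "real^'k::finite^'k"
  shows "psd_matrix A \<longleftrightarrow> (\<forall>i j. A $ i $ j = A $ j $ i) \<and> (\<forall>u. 0 \<le> (\<Sum>i\<in>UNIV. \<Sum>j\<in>UNIV. u i * u j * A $ i $ j))"
proof -
  have q: "v \<bullet> (A *v v) = (\<Sum>i\<in>UNIV. \<Sum>j\<in>UNIV. v $ i * v $ j * A $ i $ j)" for v
    by (simp add: inner_vec_def matrix_vector_mult_def sum_distrib_left mult_ac)
  have "(\<forall>v. 0 \<le> v \<bullet> (A *v v)) \<longleftrightarrow> (\<forall>u. 0 \<le> (\<Sum>i\<in>UNIV. \<Sum>j\<in>UNIV. u i * u j * A $ i $ j))"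
  proof
    assume *: "\<forall>v. 0 \<le> v \<bullet> (A *v v)"
    show "\<forall>u. 0 \<le> (\<Sum>i\<in>UNIV. \<Sum>j\<in>UNIV. u i * u j * A $ i $ j)"
    proof
      fix u :: "'k \<Rightarrow> real"
      show "0 \<le> (\<Sum>i\<in>UNIV. \<Sum>j\<in>UNIV. u i * u j * A $ i $ j)"
        using *[rule_format, of "\<chi> i. u i"] unfolding q by simp
    qed
  qed (simp add: q)
  moreover have "transpose A = A \<longleftrightarrow> (\<forall>i j. A $ i $ j = A $ j $ i)"
    unfolding vec_eq_iff transpose_def by auto
  ultimately show ?thesis unfolding psd_matrix_def by simp
qed

lemma sos_matrix_quadratic_nonneg:
  assumes "sos_matrix S"
  shows "0 \<le> (\<Sum>i\<in>UNIV. \<Sum>j\<in>UNIV. u i * u j * peval x (S $ i $ j))"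
proof -
  obtain l :: nat and T where S: "S = (\<Sum>k<l. rank_one (T k))"
    using assms unfolding sos_matrix_iff by blast
  have "(\<Sum>i\<in>UNIV. \<Sum>j\<in>UNIV. u i * u j * peval x (S $ i $ j))
      = (\<Sum>i\<in>UNIV. \<Sum>j\<in>UNIV. \<Sum>k<l. (u i * peval x (T k $ i)) * (u j * peval x (T k $ j)))"
    by (simp add: S sum_distrib_left mult_ac)
  also have "\<dots> = (\<Sum>i\<in>UNIV. \<Sum>k<l. \<Sum>j\<in>UNIV. (u i * peval x (T k $ i)) * (u j * peval x (T k $ j)))"
    by (intro sum.cong refl sum.swap)
  also have "\<dots> = (\<Sum>k<l. \<Sum>i\<in>UNIV. \<Sum>j\<in>UNIV. (u i * peval x (T k $ i)) * (u j * peval x (T k $ j)))"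
    by (rule sum.swap)
  also have "\<dots> = (\<Sum>k<l. (\<Sum>i\<in>UNIV. u i * peval x (T k $ i))\<^sup>2)"
    by (simp add: power2_eq_square sum_product)
  also have "\<dots> \<ge> 0" by (intro sum_nonneg) simp
  finally show ?thesis .
qed

lemma sum_rotate: "(\<Sum>a\<in>A. \<Sum>b\<in>B. \<Sum>c\<in>C. f a b c) = (\<Sum>c\<in>C. \<Sum>a\<in>A. \<Sum>b\<in>B. f a b c)"
proof -
  have "(\<Sum>a\<in>A. \<Sum>b\<in>B. \<Sum>c\<in>C. f a b c) = (\<Sum>a\<in>A. \<Sum>c\<in>C. \<Sum>b\<in>B. f a b c)"
    by (rule sum.cong[OF refl], rule sum.swap)
  also have "\<dots> = (\<Sum>c\<in>C. \<Sum>a\<in>A. \<Sum>b\<in>B. f a b c)"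
    by (rule sum.swap)
  finally show ?thesis .
qed

text \<open>
  For \<open>S = T\<^sup>T T\<close> the quadratic form of \<open>\<langle>S, G\<rangle>\<^sub>p\<close> at \<open>u\<close> is the sum over the rows of \<open>T\<close>, cut into \<open>p\<close>
  pieces and combined with the weights \<open>u\<close>, of the values of the form \<open>G\<close>.
\<close>

lemma block_inner_quadratic_nonneg:
  fixes S :: "('n::finite + 'm::finite) rpoly^('p::finite \<times> 'q::finite)^('p \<times> 'q)"
  assumes "sos_matrix S" and psd: "psd_matrix (map_matrix (peval z) G)"
  shows "0 \<le> (\<Sum>i\<in>UNIV. \<Sum>j\<in>UNIV. u i * u j * peval z (block_inner S G $ i $ j))"
proof -
  obtain r :: nat and T where S: "S = (\<Sum>h<r. rank_one (T h))"
    using assms unfolding sos_matrix_iff by blast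
  define w where "w h k = (\<Sum>i\<in>UNIV. u i * peval z (T h $ (i, k)))" for h k
  have ww: "w h l * w h k = (\<Sum>i\<in>UNIV. \<Sum>j\<in>UNIV. (u i * peval z (T h $ (i, k))) * (u j * peval z (T h $ (j, l))))" for h k l
    unfolding w_def by (subst mult.commute) (simp add: sum_product)
  have "(\<Sum>i\<in>UNIV. \<Sum>j\<in>UNIV. u i * u j * peval z (block_inner S G $ i $ j))
      = (\<Sum>i\<in>UNIV. \<Sum>j\<in>UNIV. \<Sum>k\<in>UNIV. \<Sum>l\<in>UNIV. \<Sum>h<r.
          (u i * peval z (T h $ (i, k))) * (u j * peval z (T h $ (j, l))) * peval z (G $ l $ k))"
    by (simp add: block_inner_nth S sum_distrib_left sum_distrib_right mult_ac)
  also have "\<dots> = (\<Sum>i\<in>UNIV. \<Sum>j\<in>UNIV. \<Sum>h<r. \<Sum>k\<in>UNIV. \<Sum>l\<in>UNIV. 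
          (u i * peval z (T h $ (i, k))) * (u j * peval z (T h $ (j, l))) * peval z (G $ l $ k))"
    by (intro sum.cong refl sum_rotate)
  also have "\<dots> = (\<Sum>h<r. \<Sum>i\<in>UNIV. \<Sum>j\<in>UNIV. \<Sum>k\<in>UNIV. \<Sum>l\<in>UNIV. 
          (u i * peval z (T h $ (i, k))) * (u j * peval z (T h $ (j, l))) * peval z (G $ l $ k))"
    by (rule sum_rotate)
  also have "\<dots> = (\<Sum>h<r. \<Sum>k\<in>UNIV. \<Sum>i\<in>UNIV. \<Sum>j\<in>UNIV. \<Sum>l\<in>UNIV. 
          (u i * peval z (T h $ (i, k))) * (u j * peval z (T h $ (j, l))) * peval z (G $ l $ k))"
    by (intro sum.cong refl sum_rotate)
  also have "\<dots> = (\<Sum>h<r. \<Sum>k\<in>UNIV. \<Sum>l\<in>UNIV. \<Sum>i\<in>UNIV. \<Sum>j\<in>UNIV. 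
          (u i * peval z (T h $ (i, k))) * (u j * peval z (T h $ (j, l))) * peval z (G $ l $ k))"
    by (intro sum.cong refl sum_rotate)
  also have "\<dots> = (\<Sum>h<r. \<Sum>k\<in>UNIV. \<Sum>l\<in>UNIV. w h l * w h k * peval z (G $ l $ k))"
    by (simp only: ww sum_distrib_right)
  also have "\<dots> = (\<Sum>h<r. \<Sum>l\<in>UNIV. \<Sum>k\<in>UNIV. w h l * w h k * map_matrix (peval z) G $ l $ k)"
    unfolding map_matrix_nth by (rule sum.cong[OF refl], rule sum.swap)
  also have "\<dots> \<ge> 0"
  proof (rule sum_nonneg)
    fix h
    show "0 \<le> (\<Sum>l\<in>UNIV. \<Sum>k\<in>UNIV. w h l * w h k * map_matrix (peval z) G $ l $ k)"
      using psd unfolding psd_matrix_quadratic by blast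
  qed
  finally show ?thesis .
qed

context carleman_set
begin

text \<open>
  On the feasible set both terms of a certificate are positive semidefinite, the second one as an
  integral of such matrices; the power of \<open>\<theta>\<close> on the left is positive and can be cancelled.
\<close>

lemma relaxed_gamma_quadratic_nonneg:
  fixes G :: "('n::finite + 'm) rpoly^'q::finite^'q" and \<Lambda>\<^sub>0 :: "'n rpoly^'p::finite^'p"
    and \<Lambda> :: "'r::finite \<Rightarrow> 'n rpoly^'p^'p"
  assumes \<gamma>: "\<gamma> \<in> relaxed_gamma \<nu> Y G \<Lambda>\<^sub>0 \<Lambda> \<epsilon> l" and x: "x \<in> feasible_x Y G"
  shows "0 \<le> (\<Sum>i\<in>UNIV. \<Sum>j\<in>UNIV. u i * u j * peval (($) x) (Lam \<Lambda>\<^sub>0 \<Lambda> \<gamma> $ i $ j))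
    + \<epsilon> * (peval (($) x) theta ^ d_Lam \<Lambda>\<^sub>0 \<Lambda> * (\<Sum>i\<in>UNIV. (u i)\<^sup>2))"
proof -
  obtain S\<^sub>0 :: "'n rpoly^'p^'p" and S :: "('n + 'm) rpoly^('p \<times> 'q)^('p \<times> 'q)"
    where S: "sos_matrix S\<^sub>0" "sos_matrix S" and eq: "pscale (theta ^ (l - d_Lam \<Lambda>\<^sub>0 \<Lambda>))
            (Lam \<Lambda>\<^sub>0 \<Lambda> \<gamma> + pscale (Const \<epsilon> * theta ^ d_Lam \<Lambda>\<^sub>0 \<Lambda>) (mat 1))
          = S\<^sub>0 + map_matrix (y_integral \<nu> Y) (block_inner S G)"
    using \<gamma> unfolding relaxed_gamma_def by blast
  define th where "th = peval (($) x) theta"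
  have th: "th > 0" unfolding th_def by (rule theta_pos)
  have "(\<Sum>i\<in>UNIV. \<Sum>j\<in>UNIV. u i * u j * peval (($) x) (y_integral \<nu> Y (block_inner S G $ i $ j)))
      = peval (($) x) (\<Sum>ij\<in>UNIV. Const (u (fst ij) * u (snd ij)) * y_integral \<nu> Y (block_inner S G $ fst ij $ snd ij))"
    by (simp add: sum.cartesian_product split_beta)
  also have "\<dots> = (LINT y:Y|\<nu>. \<Sum>i\<in>UNIV. \<Sum>j\<in>UNIV. u i * u j * peval (case_sum (($) x) (($) y)) (block_inner S G $ i $ j))"
    unfolding y_integral_embed_sum[symmetric] peval_y_integral[OF integrable_peval]
    by (simp add: sum.cartesian_product split_beta)
  also have "\<dots> \<ge> 0"
    unfolding set_lebesgue_integral_def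
  proof (intro integral_nonneg_AE AE_I2)
    fix y
    show "0 \<le> indicat_real Y y *\<^sub>R (\<Sum>i\<in>UNIV. \<Sum>j\<in>UNIV. u i * u j * peval (case_sum (($) x) (($) y)) (block_inner S G $ i $ j))"
    proof (cases "y \<in> Y")
      case True
      then have "psd_matrix (map_matrix (peval (case_sum (($) x) (($) y))) G)"
        using x unfolding feasible_x_def by blast
      from block_inner_quadratic_nonneg[OF S(2) this, of u] show ?thesis by simp
    qed simp
  qed
  finally have int: "0 \<le> (\<Sum>i\<in>UNIV. \<Sum>j\<in>UNIV. u i * u j * peval (($) x) (y_integral \<nu> Y (block_inner S G $ i $ j)))" .
  have "th ^ (l - d_Lam \<Lambda>\<^sub>0 \<Lambda>) * ((\<Sum>i\<in>UNIV. \<Sum>j\<in>UNIV. u i * u j * peval (($) x) (Lam \<Lambda>\<^sub>0 \<Lambda> \<gamma> $ i $ j))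
      + \<epsilon> * (th ^ d_Lam \<Lambda>\<^sub>0 \<Lambda> * (\<Sum>i\<in>UNIV. (u i)\<^sup>2)))
      = (\<Sum>i\<in>UNIV. \<Sum>j\<in>UNIV. u i * u j * peval (($) x) (pscale (theta ^ (l - d_Lam \<Lambda>\<^sub>0 \<Lambda>))
            (Lam \<Lambda>\<^sub>0 \<Lambda> \<gamma> + pscale (Const \<epsilon> * theta ^ d_Lam \<Lambda>\<^sub>0 \<Lambda>) (mat 1)) $ i $ j))"
  proof -
    have "u i * u j * peval (($) x) (pscale (theta ^ (l - d_Lam \<Lambda>\<^sub>0 \<Lambda>))
            (Lam \<Lambda>\<^sub>0 \<Lambda> \<gamma> + pscale (Const \<epsilon> * theta ^ d_Lam \<Lambda>\<^sub>0 \<Lambda>) (mat 1)) $ i $ j)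
        = th ^ (l - d_Lam \<Lambda>\<^sub>0 \<Lambda>) * (u i * u j * peval (($) x) (Lam \<Lambda>\<^sub>0 \<Lambda> \<gamma> $ i $ j))
          + u i * u j * ((th ^ (l - d_Lam \<Lambda>\<^sub>0 \<Lambda>) * (\<epsilon> * th ^ d_Lam \<Lambda>\<^sub>0 \<Lambda>)) * (if i = j then 1 else 0))" for i j
      by (simp add: th_def[symmetric] mat_def distrib_left mult_ac)
    then have "(\<Sum>i\<in>UNIV. \<Sum>j\<in>UNIV. u i * u j * peval (($) x) (pscale (theta ^ (l - d_Lam \<Lambda>\<^sub>0 \<Lambda>))
            (Lam \<Lambda>\<^sub>0 \<Lambda> \<gamma> + pscale (Const \<epsilon> * theta ^ d_Lam \<Lambda>\<^sub>0 \<Lambda>) (mat 1)) $ i $ j))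
        = th ^ (l - d_Lam \<Lambda>\<^sub>0 \<Lambda>) * (\<Sum>i\<in>UNIV. \<Sum>j\<in>UNIV. u i * u j * peval (($) x) (Lam \<Lambda>\<^sub>0 \<Lambda> \<gamma> $ i $ j))
          + th ^ (l - d_Lam \<Lambda>\<^sub>0 \<Lambda>) * (\<epsilon> * th ^ d_Lam \<Lambda>\<^sub>0 \<Lambda>) * (\<Sum>i\<in>UNIV. (u i)\<^sup>2)"
      by (simp only: sum.distrib sum_distrib_left[symmetric] quadratic_form_scalar)
    then show ?thesis by (simp only: distrib_left mult.assoc)
  qed
  also have "\<dots> = (\<Sum>i\<in>UNIV. \<Sum>j\<in>UNIV. u i * u j * peval (($) x) (S\<^sub>0 $ i $ j))
      + (\<Sum>i\<in>UNIV. \<Sum>j\<in>UNIV. u i * u j * peval (($) x) (y_integral \<nu> Y (block_inner S G $ i $ j)))"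
    unfolding eq by (simp add: distrib_left sum.distrib)
  also have "\<dots> \<ge> 0"
    using int sos_matrix_quadratic_nonneg[OF S(1), of u "($) x"] by simp
  finally have "0 \<le> th ^ (l - d_Lam \<Lambda>\<^sub>0 \<Lambda>) * ((\<Sum>i\<in>UNIV. \<Sum>j\<in>UNIV. u i * u j * peval (($) x) (Lam \<Lambda>\<^sub>0 \<Lambda> \<gamma> $ i $ j))
      + \<epsilon> * (th ^ d_Lam \<Lambda>\<^sub>0 \<Lambda> * (\<Sum>i\<in>UNIV. (u i)\<^sup>2)))" .
  moreover have "0 \<le> b" if "0 \<le> a * b" "0 < a" for a b :: real
    using that by (simp add: zero_le_mult_iff)
  moreover have "0 < th ^ (l - d_Lam \<Lambda>\<^sub>0 \<Lambda>)" using th by simp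
  ultimately show ?thesis unfolding th_def[symmetric] by blast
qed

lemma relaxed_gamma_mono_level:
  fixes G :: "('n::finite + 'm) rpoly^'q::finite^'q" and \<Lambda>\<^sub>0 :: "'n rpoly^'p::finite^'p"
    and \<Lambda> :: "'r::finite \<Rightarrow> 'n rpoly^'p^'p"
  assumes l: "d_Lam \<Lambda>\<^sub>0 \<Lambda> \<le> l" "d_G G \<le> l"
  shows "relaxed_gamma \<nu> Y G \<Lambda>\<^sub>0 \<Lambda> \<epsilon> l \<subseteq> relaxed_gamma \<nu> Y G \<Lambda>\<^sub>0 \<Lambda> \<epsilon> (Suc l)"
proof
  fix \<gamma> assume "\<gamma> \<in> relaxed_gamma \<nu> Y G \<Lambda>\<^sub>0 \<Lambda> \<epsilon> l"
  then obtain S\<^sub>0 :: "'n rpoly^'p^'p" and S :: "('n + 'm) rpoly^('p \<times> 'q)^('p \<times> 'q)"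
    where S: "sos_matrix S\<^sub>0" "sos_matrix S" and eq: "pscale (theta ^ (l - d_Lam \<Lambda>\<^sub>0 \<Lambda>))
            (Lam \<Lambda>\<^sub>0 \<Lambda> \<gamma> + pscale (Const \<epsilon> * theta ^ d_Lam \<Lambda>\<^sub>0 \<Lambda>) (mat 1))
          = S\<^sub>0 + map_matrix (y_integral \<nu> Y) (block_inner S G)"
      and deg: "mdeg_in UNIV S\<^sub>0 \<le> 2 * l" "mdeg_in (range Inl) S \<le> 2 * (l - d_G G)"
        "mdeg_in (range Inr) S \<le> 2 * (l - half_deg_y G)"
    unfolding relaxed_gamma_def by blast
  define S\<^sub>0' S' where "S\<^sub>0' = pscale theta S\<^sub>0" and "S' = pscale (embed_x theta) S"
  have sos: "sos_matrix S\<^sub>0'" "sos_matrix S'"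
    unfolding S\<^sub>0'_def S'_def by (intro sos_matrix_pscale sos_theta sos_embed_x_theta S)+
  have int: "y_integral \<nu> Y (embed_x theta * h) = theta * y_integral \<nu> Y h" for h :: "('n + 'm) rpoly"
    using y_integral_embed_sum[of "\<lambda>_. theta" "\<lambda>_. h" "{()}"] by simp
  have block: "block_inner S' G $ i $ j = embed_x theta * block_inner S G $ i $ j" for i j
    by (simp add: S'_def block_inner_nth sum_distrib_left mult.assoc)
  have "pscale (theta ^ (Suc l - d_Lam \<Lambda>\<^sub>0 \<Lambda>)) M = pscale theta (pscale (theta ^ (l - d_Lam \<Lambda>\<^sub>0 \<Lambda>)) M)" for M :: "'n rpoly^'p^'p"
    using l by (simp add: vec_eq_iff Suc_diff_le mult.assoc)
  then have "pscale (theta ^ (Suc l - d_Lam \<Lambda>\<^sub>0 \<Lambda>))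
            (Lam \<Lambda>\<^sub>0 \<Lambda> \<gamma> + pscale (Const \<epsilon> * theta ^ d_Lam \<Lambda>\<^sub>0 \<Lambda>) (mat 1))
          = pscale theta (S\<^sub>0 + map_matrix (y_integral \<nu> Y) (block_inner S G))"
    by (simp only: eq)
  also have "\<dots> = S\<^sub>0' + map_matrix (y_integral \<nu> Y) (block_inner S' G)"
    by (simp add: vec_eq_iff S\<^sub>0'_def block int distrib_left)
  finally have eq': "pscale (theta ^ (Suc l - d_Lam \<Lambda>\<^sub>0 \<Lambda>))
            (Lam \<Lambda>\<^sub>0 \<Lambda> \<gamma> + pscale (Const \<epsilon> * theta ^ d_Lam \<Lambda>\<^sub>0 \<Lambda>) (mat 1)) = \<dots>" .
  have "mdeg_in UNIV S\<^sub>0' \<le> 2 * Suc l"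
  proof -
    have "deg_in UNIV (S\<^sub>0 $ i $ j) \<le> 2 * l" for i j using deg(1) unfolding mdeg_in_le_iff by blast
    then have "deg_in UNIV (theta * S\<^sub>0 $ i $ j) \<le> 2 * Suc l" for i j
      by (rule deg_in_mult_le[OF deg_in_theta]) simp
    then show ?thesis by (simp add: mdeg_in_le_iff S\<^sub>0'_def)
  qed
  moreover have "mdeg_in (range Inl) S' \<le> 2 * (Suc l - d_G G)"
  proof -
    have "deg_in (range Inl) (S $ i $ j) \<le> 2 * (l - d_G G)" for i j using deg(2) unfolding mdeg_in_le_iff by blast
    then have "deg_in (range Inl) (embed_x theta * S $ i $ j) \<le> 2 * (Suc l - d_G G)" for i j
      by (rule deg_in_mult_le[OF deg_in_embed_x(1)[OF deg_in_theta]]) (use l in simp)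
    then show ?thesis unfolding mdeg_in_le_iff S'_def pscale_nth by blast
  qed
  moreover have "mdeg_in (range Inr) S' \<le> 2 * (Suc l - half_deg_y G)"
  proof -
    have "deg_in (range Inr) (S $ i $ j) \<le> 2 * (l - half_deg_y G)" for i j using deg(3) unfolding mdeg_in_le_iff by blast
    then have "deg_in (range Inr) (embed_x theta * S $ i $ j) \<le> 2 * (Suc l - half_deg_y G)" for i j
      by (rule deg_in_mult_le[OF deg_in_embed_x(2)[OF deg_in_theta]]) simp
    then show ?thesis unfolding mdeg_in_le_iff S'_def pscale_nth by blast
  qed
  ultimately show "\<gamma> \<in> relaxed_gamma \<nu> Y G \<Lambda>\<^sub>0 \<Lambda> \<epsilon> (Suc l)"
    using sos eq' unfolding relaxed_gamma_def by blast
qed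

end

text \<open>
  The difference of the two left-hand sides is a nonnegative multiple of a power of \<open>\<theta>\<close> times
  the identity.
\<close>

lemma relaxed_gamma_mono_eps:
  fixes G :: "('n::finite + 'm::finite) rpoly^'q::finite^'q" and \<Lambda>\<^sub>0 :: "'n rpoly^'p::finite^'p"
    and \<Lambda> :: "'r::finite \<Rightarrow> 'n rpoly^'p^'p"
  assumes "\<epsilon> \<le> \<epsilon>'" and l: "d_Lam \<Lambda>\<^sub>0 \<Lambda> \<le> l"
  shows "relaxed_gamma \<nu> Y G \<Lambda>\<^sub>0 \<Lambda> \<epsilon> l \<subseteq> relaxed_gamma \<nu> Y G \<Lambda>\<^sub>0 \<Lambda> \<epsilon>' l"
proof
  fix \<gamma> assume "\<gamma> \<in> relaxed_gamma \<nu> Y G \<Lambda>\<^sub>0 \<Lambda> \<epsilon> l"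
  then obtain S\<^sub>0 :: "'n rpoly^'p^'p" and S :: "('n + 'm) rpoly^('p \<times> 'q)^('p \<times> 'q)"
    where S: "sos_matrix S\<^sub>0" "sos_matrix S" and eq: "pscale (theta ^ (l - d_Lam \<Lambda>\<^sub>0 \<Lambda>))
            (Lam \<Lambda>\<^sub>0 \<Lambda> \<gamma> + pscale (Const \<epsilon> * theta ^ d_Lam \<Lambda>\<^sub>0 \<Lambda>) (mat 1))
          = S\<^sub>0 + map_matrix (y_integral \<nu> Y) (block_inner S G)"
      and deg: "mdeg_in UNIV S\<^sub>0 \<le> 2 * l" "mdeg_in (range Inl) S \<le> 2 * (l - d_G G)"
        "mdeg_in (range Inr) S \<le> 2 * (l - half_deg_y G)"
    unfolding relaxed_gamma_def by blast
  define d where "d = d_Lam \<Lambda>\<^sub>0 \<Lambda>"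
  define E where "E = (pscale (theta ^ (l - d) * (Const (\<epsilon>' - \<epsilon>) * theta ^ d)) (mat 1) :: 'n rpoly^'p^'p)"
  have "sos_matrix (S\<^sub>0 + E)"
    unfolding E_def using assms
    by (intro sos_matrix_add S sos_matrix_pscale sos_mult sos_power sos_theta sos_Const sos_matrix_mat_one) simp
  moreover have "pscale (theta ^ (l - d)) (Lam \<Lambda>\<^sub>0 \<Lambda> \<gamma> + pscale (Const \<epsilon>' * theta ^ d) (mat 1))
      = S\<^sub>0 + E + map_matrix (y_integral \<nu> Y) (block_inner S G)"
  proof -
    have "Const \<epsilon>' = Const \<epsilon> + (Const (\<epsilon>' - \<epsilon>) :: 'n rpoly)" by (simp flip: Const_add)
    then have "pscale (theta ^ (l - d)) (Lam \<Lambda>\<^sub>0 \<Lambda> \<gamma> + pscale (Const \<epsilon>' * theta ^ d) (mat 1))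
        = pscale (theta ^ (l - d)) (Lam \<Lambda>\<^sub>0 \<Lambda> \<gamma> + pscale (Const \<epsilon> * theta ^ d) (mat 1)) + E"
      by (simp add: vec_eq_iff E_def distrib_left distrib_right mult.assoc)
    then show ?thesis using eq unfolding d_def by (simp add: add_ac)
  qed
  moreover have "mdeg_in UNIV (S\<^sub>0 + E) \<le> 2 * l"
  proof -
    have "deg_in UNIV (S\<^sub>0 $ i $ j) \<le> 2 * l" for i j using deg(1) unfolding mdeg_in_le_iff by blast
    moreover have "deg_in UNIV (E $ i $ j) \<le> 2 * l" for i j
    proof -
      have th: "deg_in UNIV (theta ^ n :: 'n rpoly) \<le> 2 * n" for n
        by (rule deg_in_power_le[OF deg_in_theta]) simp
      have "deg_in UNIV (Const (\<epsilon>' - \<epsilon>) * theta ^ d :: 'n rpoly) \<le> 2 * d"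
        by (rule deg_in_mult_le[of _ _ 0 _ "2 * d"]) (auto intro: th)
      then have "deg_in UNIV (theta ^ (l - d) * (Const (\<epsilon>' - \<epsilon>) * theta ^ d) :: 'n rpoly) \<le> 2 * l"
        by (rule deg_in_mult_le[OF th]) (use l in \<open>simp add: d_def\<close>)
      then show ?thesis unfolding E_def pscale_nth
        by (rule deg_in_mult_le[of _ _ _ _ 0]) (auto simp: mat_def)
    qed
    ultimately show ?thesis by (simp add: mdeg_in_le_iff deg_in_add_le)
  qed
  ultimately show "\<gamma> \<in> relaxed_gamma \<nu> Y G \<Lambda>\<^sub>0 \<Lambda> \<epsilon>' l"
    using S(2) deg(2,3) unfolding relaxed_gamma_def d_def by blast
qed

section \<open>Stability of the infimum\<close>

text \<open>
  Otherwise there are points \<open>g n\<close> of sets shrinking to \<open>F 0\<close> with values at most \<open>\<tau> - \<eta>\<close>. A subsequence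
  converges once the points are moved into a ball around an optimal point \<open>\<gamma>s\<close>, by convexity. The limit
  \<open>z\<close> is an optimal point of \<open>F 0\<close>, but either its value is at most \<open>\<tau> - \<eta>\<close> or it lies on the sphere
  of radius \<open>R\<close>, which is too far from \<open>\<gamma>s\<close> for an optimal point.
\<close>

lemma perturbed_infimum:
  fixes a :: "'i \<Rightarrow> real" and b :: "'i \<Rightarrow> 'r::euclidean_space" and e :: "'i \<Rightarrow> real" and c :: 'r
    and I :: "'i set"
  defines "F \<epsilon> \<equiv> {\<gamma>. \<forall>i\<in>I. 0 \<le> a i - b i \<bullet> \<gamma> + \<epsilon> * e i}"
  assumes e: "\<And>i. i \<in> I \<Longrightarrow> e i \<ge> 0"
    and opt: "\<gamma>s \<in> F 0" "c \<bullet> \<gamma>s = \<tau>" and inf: "\<And>\<gamma>. \<gamma> \<in> F 0 \<Longrightarrow> \<tau> \<le> c \<bullet> \<gamma>"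
    and bdd: "bounded {\<gamma> \<in> F 0. c \<bullet> \<gamma> = \<tau>}" and "\<eta> > 0"
  shows "\<exists>\<epsilon>0>0. \<forall>\<gamma>\<in>F \<epsilon>0. \<tau> - \<eta> \<le> c \<bullet> \<gamma>"
proof (rule ccontr)
  assume "\<not> ?thesis"
  then have "\<exists>\<gamma>\<in>F (inverse (real (Suc n))). c \<bullet> \<gamma> < \<tau> - \<eta>" for n
    by (metis inverse_positive_iff_positive not_le of_nat_0_less_iff zero_less_Suc)
  then have "\<forall>n. \<exists>\<gamma>. \<gamma> \<in> F (inverse (real (Suc n))) \<and> c \<bullet> \<gamma> < \<tau> - \<eta>" by blast
  then obtain g where g: "\<forall>n. g n \<in> F (inverse (real (Suc n))) \<and> c \<bullet> g n < \<tau> - \<eta>"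
    unfolding choice_iff by (elim exE)
  obtain \<rho> where \<rho>: "\<And>\<gamma>. \<gamma> \<in> F 0 \<Longrightarrow> c \<bullet> \<gamma> = \<tau> \<Longrightarrow> dist \<gamma>s \<gamma> \<le> \<rho>"
    using bdd unfolding bounded_any_center[where a = \<gamma>s] by blast
  define R where "R = \<rho> + 1"
  have R: "R > 0" using \<rho>[OF opt] by (simp add: R_def)
  \<comment> \<open>Points at distance more than \<open>R\<close> are pulled back to the sphere along the segment towards \<open>\<gamma>s\<close>.\<close>
  define s where "s n = (if dist \<gamma>s (g n) \<le> R then 1 else R / dist \<gamma>s (g n))" for n
  have s: "0 \<le> s n" "s n \<le> 1" for n using R by (auto simp: s_def divide_le_eq)
  define h where "h n = (1 - s n) *\<^sub>R \<gamma>s + s n *\<^sub>R g n" for n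
  have hF: "0 \<le> a i - b i \<bullet> h n + inverse (real (Suc n)) * e i" if "i \<in> I" for i n
  proof -
    have "0 \<le> a i - b i \<bullet> \<gamma>s + inverse (real (Suc n)) * e i"
      using opt(1) that e[OF that] unfolding F_def by (simp add: add_nonneg_nonneg)
    then have "0 \<le> (1 - s n) * (a i - b i \<bullet> \<gamma>s + inverse (real (Suc n)) * e i)"
      using s by simp
    moreover have "0 \<le> s n * (a i - b i \<bullet> g n + inverse (real (Suc n)) * e i)"
      using g that s unfolding F_def by (intro mult_nonneg_nonneg) auto
    moreover have "a i - b i \<bullet> h n + inverse (real (Suc n)) * e i
        = (1 - s n) * (a i - b i \<bullet> \<gamma>s + inverse (real (Suc n)) * e i)
          + s n * (a i - b i \<bullet> g n + inverse (real (Suc n)) * e i)"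
      by (simp add: h_def inner_add_right algebra_simps)
    ultimately show ?thesis by linarith
  qed
  have hc: "c \<bullet> h n \<le> \<tau>" for n
  proof -
    have "c \<bullet> h n = \<tau> + s n * (c \<bullet> g n - \<tau>)"
      using opt(2) by (simp add: h_def inner_add_right algebra_simps)
    moreover have "s n * (c \<bullet> g n - \<tau>) \<le> 0"
    proof (rule mult_nonneg_nonpos)
      have "c \<bullet> g n < \<tau> - \<eta>" using g by blast
      then show "c \<bullet> g n - \<tau> \<le> 0" using \<open>\<eta> > 0\<close> by linarith
    qed (rule s)
    ultimately show ?thesis by linarith
  qed
  have dist_h: "dist \<gamma>s (h n) = s n * dist \<gamma>s (g n)" for n
  proof -
    have "\<gamma>s - h n = s n *\<^sub>R (\<gamma>s - g n)" by (simp add: h_def algebra_simps)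
    then show ?thesis using s[of n] by (simp add: dist_norm)
  qed
  have alt: "h n \<in> sphere \<gamma>s R \<union> {\<gamma>. c \<bullet> \<gamma> \<le> \<tau> - \<eta>}" for n
  proof (cases "dist \<gamma>s (g n) \<le> R")
    case True
    then have "h n = g n" by (simp add: h_def s_def)
    then show ?thesis using g by (simp add: less_imp_le)
  next
    case False
    then have "dist \<gamma>s (g n) > 0" using R by linarith
    then have "dist \<gamma>s (h n) = R" unfolding dist_h s_def using False by simp
    then show ?thesis by simp
  qed
  have "h n \<in> cball \<gamma>s R" for n
  proof (cases "dist \<gamma>s (g n) \<le> R")
    case False
    then have "dist \<gamma>s (g n) > 0" using R by linarith
    then show ?thesis unfolding mem_cball dist_h s_def using False by simp
  qed (simp add: dist_h s_def)
  then obtain z r where r: "strict_mono r" and z: "(h \<circ> r) \<longlonglongrightarrow> z"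
    using compact_cball[of \<gamma>s R] unfolding compact_def by blast
  have "z \<in> F 0"
    unfolding F_def
  proof (intro CollectI ballI)
    fix i assume i: "i \<in> I"
    have "(\<lambda>n. inverse (real (Suc (r n)))) \<longlonglongrightarrow> 0"
      using LIMSEQ_subseq_LIMSEQ[OF LIMSEQ_inverse_real_of_nat r] by (simp add: o_def)
    then have "(\<lambda>n. a i - b i \<bullet> (h \<circ> r) n + inverse (real (Suc (r n))) * e i) \<longlonglongrightarrow> a i - b i \<bullet> z + 0 * e i"
      by (intro tendsto_intros z)
    then show "0 \<le> a i - b i \<bullet> z + 0 * e i"
      by (rule tendsto_lowerbound) (use hF[OF i] in auto)
  qed
  moreover have "c \<bullet> z \<le> \<tau>"
  proof -
    have "(\<lambda>n. c \<bullet> (h \<circ> r) n) \<longlonglongrightarrow> c \<bullet> z" by (intro tendsto_intros z)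
    then show ?thesis by (rule tendsto_upperbound) (use hc in auto)
  qed
  ultimately have zopt: "c \<bullet> z = \<tau>" "dist \<gamma>s z \<le> \<rho>"
    using inf \<rho> by (auto intro: antisym)
  have "closed (sphere \<gamma>s R \<union> {\<gamma>. c \<bullet> \<gamma> \<le> \<tau> - \<eta>})"
    by (intro closed_Un closed_sphere closed_halfspace_le)
  then have "z \<in> sphere \<gamma>s R \<union> {\<gamma>. c \<bullet> \<gamma> \<le> \<tau> - \<eta>}"
    by (rule closed_sequentially) (use alt z in auto)
  then show False using zopt \<open>\<eta> > 0\<close> by (auto simp: R_def)
qed

section \<open>Convergence of the relaxation\<close>

theorem theorem5p2:
  fixes Y :: "(real^'m::finite) set"
    and G :: "('n::finite + 'm) rpoly^'q::finite^'q"
    and \<nu> :: "(real^'m) measure"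
    and c :: "real^'r::finite"
    and \<Lambda>\<^sub>0 :: "'n rpoly^'p::finite^'p"
    and \<Lambda> :: "'r \<Rightarrow> 'n rpoly^'p^'p"
  assumes "closed Y"
    and "transpose G = G"
    and "sets \<nu> = sets borel"
    and "measure_support \<nu> = Y"
    and "\<And>h :: 'm rpoly. (\<integral>\<^sup>+ y\<in>Y. ennreal \<bar>peval (($) y) h\<bar> \<partial>\<nu>) < \<infinity>"
    and "\<And>j. carleman \<nu> Y j"
    and "transpose \<Lambda>\<^sub>0 = \<Lambda>\<^sub>0"
    and "\<And>i. transpose (\<Lambda> i) = \<Lambda> i"
  shows "\<exists>(\<tau>_inf :: real \<Rightarrow> ereal) (\<tau>\<^sub>0 :: ereal).
           (\<forall>\<epsilon>>0. (\<lambda>l. tau_relaxed \<nu> Y G c \<Lambda>\<^sub>0 \<Lambda> \<epsilon> l) \<longlonglongrightarrow> \<tau>_inf \<epsilon>) \<and>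
           (\<tau>_inf \<longlongrightarrow> \<tau>\<^sub>0) (at_right 0) \<and>
           \<tau>\<^sub>0 \<le> tau_star (feasible_x Y G) c \<Lambda>\<^sub>0 \<Lambda> \<and>
           (optimal_gamma (feasible_x Y G) c \<Lambda>\<^sub>0 \<Lambda> \<noteq> {} \<and>
            bounded (optimal_gamma (feasible_x Y G) c \<Lambda>\<^sub>0 \<Lambda>)
              \<longrightarrow> \<tau>\<^sub>0 = tau_star (feasible_x Y G) c \<Lambda>\<^sub>0 \<Lambda>)"
proof -
  interpret carleman_set Y \<nu> using assms(1,3-6) by unfold_locales
  define X where "X = feasible_x Y G"
  define d where "d = d_Lam \<Lambda>\<^sub>0 \<Lambda>"
  \<comment> \<open>From this level on, the differences \<open>l - d\<close> and \<open>l - d_G G\<close> are not truncated.\<close>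
  define l0 where "l0 = d + d_G G"
  define tau where "tau \<epsilon> l = tau_relaxed \<nu> Y G c \<Lambda>\<^sub>0 \<Lambda> \<epsilon> l" for \<epsilon> l
  define \<tau>_inf where "\<tau>_inf \<epsilon> = (INF n. tau \<epsilon> (n + l0))" for \<epsilon>
  define \<tau>\<^sub>0 where "\<tau>\<^sub>0 = (SUP \<epsilon>\<in>{0<..}. \<tau>_inf \<epsilon>)"
  define form where "form \<gamma> x u = (\<Sum>i\<in>UNIV. \<Sum>j\<in>UNIV. u i * u j * peval (($) x) (Lam \<Lambda>\<^sub>0 \<Lambda> \<gamma> $ i $ j))" for \<gamma> x u
  have d: "d \<ge> 1" by (simp add: d_def d_Lam_def half_deg_in_def)
  have sym_entry: "A $ i $ j = A $ j $ i" if "transpose A = A" for A :: "'n rpoly^'p^'p" and i j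
    using arg_cong[OF that, of "\<lambda>B. B $ j $ i"] by (simp only: transpose_def vec_lambda_beta)
  have sym: "Lam \<Lambda>\<^sub>0 \<Lambda> \<gamma> $ i $ j = Lam \<Lambda>\<^sub>0 \<Lambda> \<gamma> $ j $ i" for \<gamma> i j
    using sym_entry[OF assms(7), of i j] sym_entry[OF assms(8), of _ i j] by (simp add: Lam_def)
  have feasible: "\<gamma> \<in> feasible_gamma X \<Lambda>\<^sub>0 \<Lambda> \<longleftrightarrow> (\<forall>x\<in>X. \<forall>u. 0 \<le> form \<gamma> x u)" for \<gamma>
    unfolding feasible_gamma_def psd_matrix_quadratic form_def using sym[of \<gamma>] by auto
  have dec: "decseq (\<lambda>n. tau \<epsilon> (n + l0))" for \<epsilon>
  proof (rule decseq_SucI)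
    fix n
    have "relaxed_gamma \<nu> Y G \<Lambda>\<^sub>0 \<Lambda> \<epsilon> (n + l0) \<subseteq> relaxed_gamma \<nu> Y G \<Lambda>\<^sub>0 \<Lambda> \<epsilon> (Suc (n + l0))"
      by (rule relaxed_gamma_mono_level) (simp_all add: l0_def d_def)
    then show "tau \<epsilon> (Suc n + l0) \<le> tau \<epsilon> (n + l0)"
      unfolding tau_def tau_relaxed_def by (simp add: INF_superset_mono)
  qed
  have lim_l: "(\<lambda>l. tau \<epsilon> l) \<longlonglongrightarrow> \<tau>_inf \<epsilon>" for \<epsilon>
    unfolding \<tau>_inf_def by (rule LIMSEQ_offset[OF LIMSEQ_INF[OF dec]])
  have anti: "\<tau>_inf \<epsilon>' \<le> \<tau>_inf \<epsilon>" if "\<epsilon> \<le> \<epsilon>'" for \<epsilon> \<epsilon>'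
    unfolding \<tau>_inf_def
  proof (rule INF_mono')
    fix n
    have "relaxed_gamma \<nu> Y G \<Lambda>\<^sub>0 \<Lambda> \<epsilon> (n + l0) \<subseteq> relaxed_gamma \<nu> Y G \<Lambda>\<^sub>0 \<Lambda> \<epsilon>' (n + l0)"
      using that by (rule relaxed_gamma_mono_eps) (simp add: l0_def d_def)
    then show "tau \<epsilon>' (n + l0) \<le> tau \<epsilon> (n + l0)"
      unfolding tau_def tau_relaxed_def by (simp add: INF_superset_mono)
  qed
  have lim_eps: "(\<tau>_inf \<longlongrightarrow> \<tau>\<^sub>0) (at_right 0)"
  proof (rule order_tendstoI)
    fix y assume "y < \<tau>\<^sub>0"
    then obtain \<epsilon>1 where \<epsilon>1: "\<epsilon>1 > 0" "y < \<tau>_inf \<epsilon>1"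
      unfolding \<tau>\<^sub>0_def less_SUP_iff by auto
    have "\<forall>\<epsilon>>0. \<epsilon> < \<epsilon>1 \<longrightarrow> y < \<tau>_inf \<epsilon>"
      using \<epsilon>1(2) anti by (meson less_imp_le less_le_trans)
    then show "\<forall>\<^sub>F \<epsilon> in at_right 0. y < \<tau>_inf \<epsilon>"
      unfolding eventually_at_right_field using \<epsilon>1(1) by blast
  next
    fix y assume y: "\<tau>\<^sub>0 < y"
    have "\<tau>_inf \<epsilon> < y" if "\<epsilon> > 0" for \<epsilon>
    proof -
      have "\<tau>_inf \<epsilon> \<le> \<tau>\<^sub>0" unfolding \<tau>\<^sub>0_def by (rule SUP_upper) (use that in simp)
      then show ?thesis using y by (rule le_less_trans)
    qed
    then show "\<forall>\<^sub>F \<epsilon> in at_right 0. \<tau>_inf \<epsilon> < y"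
      unfolding eventually_at_right_field using zero_less_one by blast
  qed
  have upper: "\<tau>_inf \<epsilon> \<le> ereal (c \<bullet> \<gamma>)" if "\<gamma> \<in> feasible_gamma X \<Lambda>\<^sub>0 \<Lambda>" "\<epsilon> > 0" for \<epsilon> \<gamma>
  proof -
    have "0 \<le> (\<Sum>i\<in>UNIV. \<Sum>j\<in>UNIV. u i * u j * peval (($) x) (Lam \<Lambda>\<^sub>0 \<Lambda> \<gamma> $ i $ j))" if "x \<in> feasible_x Y G" for x u
    proof -
      have "0 \<le> form \<gamma> x u"
        using \<open>\<gamma> \<in> feasible_gamma X \<Lambda>\<^sub>0 \<Lambda>\<close> that unfolding feasible X_def[symmetric] by blast
      then show ?thesis unfolding form_def .
    qed
    from positivstellensatz[OF assms(2) sym d deg_Lam[of \<Lambda>\<^sub>0 \<Lambda>, folded d_def] \<open>\<epsilon> > 0\<close> this, of l0]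
    obtain l where l: "l \<ge> l0" "\<gamma> \<in> relaxed_gamma \<nu> Y G \<Lambda>\<^sub>0 \<Lambda> \<epsilon> l"
      unfolding relaxed_gamma_def d_def by blast
    have "\<tau>_inf \<epsilon> \<le> tau \<epsilon> ((l - l0) + l0)" unfolding \<tau>_inf_def by (rule INF_lower) simp
    also have "\<dots> = tau \<epsilon> l" using l(1) by simp
    also have "\<dots> \<le> ereal (c \<bullet> \<gamma>)" unfolding tau_def tau_relaxed_def by (rule INF_lower[OF l(2)])
    finally show ?thesis .
  qed
  have le: "\<tau>\<^sub>0 \<le> tau_star X c \<Lambda>\<^sub>0 \<Lambda>"
    unfolding \<tau>\<^sub>0_def tau_star_def using upper by (intro SUP_least INF_greatest) auto
  have eq: "\<tau>\<^sub>0 = tau_star X c \<Lambda>\<^sub>0 \<Lambda>"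
    if ne: "optimal_gamma X c \<Lambda>\<^sub>0 \<Lambda> \<noteq> {}" and bdd: "bounded (optimal_gamma X c \<Lambda>\<^sub>0 \<Lambda>)"
  proof (rule antisym[OF le])
    obtain \<gamma>0 where \<gamma>0: "\<gamma>0 \<in> feasible_gamma X \<Lambda>\<^sub>0 \<Lambda>" "ereal (c \<bullet> \<gamma>0) = tau_star X c \<Lambda>\<^sub>0 \<Lambda>"
      using ne unfolding optimal_gamma_def by blast
    define a where "a = (\<lambda>(x, u). form 0 x u)"
    define b :: "(real^'n) \<times> ('p \<Rightarrow> real) \<Rightarrow> real^'r" where
      "b = (\<lambda>(x, u). \<chi> r. \<Sum>i\<in>UNIV. \<Sum>j\<in>UNIV. u i * u j * peval (($) x) (\<Lambda> r $ i $ j))"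
    define e :: "(real^'n) \<times> ('p \<Rightarrow> real) \<Rightarrow> real" where
      "e = (\<lambda>(x, u). peval (($) x) theta ^ d * (\<Sum>i\<in>UNIV. (u i)\<^sup>2))"
    define I :: "((real^'n) \<times> ('p \<Rightarrow> real)) set" where "I = X \<times> UNIV"
    have form: "form \<gamma> x u = a (x, u) - b (x, u) \<bullet> \<gamma>" for \<gamma> x u
    proof -
      have "b (x, u) \<bullet> \<gamma> = (\<Sum>r\<in>UNIV. \<Sum>i\<in>UNIV. \<Sum>j\<in>UNIV. u i * u j * (\<gamma> $ r * peval (($) x) (\<Lambda> r $ i $ j)))"
        by (simp add: b_def inner_vec_def sum_distrib_left sum_distrib_right mult_ac)
      also have "\<dots> = (\<Sum>i\<in>UNIV. \<Sum>r\<in>UNIV. \<Sum>j\<in>UNIV. u i * u j * (\<gamma> $ r * peval (($) x) (\<Lambda> r $ i $ j)))"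
        by (rule sum.swap)
      also have "\<dots> = (\<Sum>i\<in>UNIV. \<Sum>j\<in>UNIV. \<Sum>r\<in>UNIV. u i * u j * (\<gamma> $ r * peval (($) x) (\<Lambda> r $ i $ j)))"
        by (intro sum.cong refl sum.swap)
      finally show ?thesis
        by (simp add: form_def a_def peval_Lam right_diff_distrib sum_subtractf sum_distrib_left mult_ac)
    qed
    define F where "F \<epsilon> = {\<gamma>. \<forall>i\<in>I. 0 \<le> a i - b i \<bullet> \<gamma> + \<epsilon> * e i}" for \<epsilon>
    have F0: "F 0 = feasible_gamma X \<Lambda>\<^sub>0 \<Lambda>"
      unfolding F_def set_eq_iff mem_Collect_eq feasible form I_def by auto
    have star: "tau_star X c \<Lambda>\<^sub>0 \<Lambda> = ereal (c \<bullet> \<gamma>0)" using \<gamma>0(2) by simp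
    have inf: "c \<bullet> \<gamma>0 \<le> c \<bullet> \<gamma>" if "\<gamma> \<in> F 0" for \<gamma>
    proof -
      have "tau_star X c \<Lambda>\<^sub>0 \<Lambda> \<le> ereal (c \<bullet> \<gamma>)"
        unfolding tau_star_def using that F0 by (intro INF_lower) simp
      then show ?thesis by (simp add: star)
    qed
    have opt: "{\<gamma> \<in> F 0. c \<bullet> \<gamma> = c \<bullet> \<gamma>0} = optimal_gamma X c \<Lambda>\<^sub>0 \<Lambda>"
      unfolding optimal_gamma_def star F0 by auto
    have e: "e i \<ge> 0" for i
      unfolding e_def split_beta
      by (rule mult_nonneg_nonneg[OF zero_le_power[OF less_imp_le[OF theta_pos]] sum_nonneg]) simp
    show "tau_star X c \<Lambda>\<^sub>0 \<Lambda> \<le> \<tau>\<^sub>0"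
      unfolding star
    proof (rule ereal_le_epsilon2)
      fix \<eta> :: real assume "\<eta> > 0"
      have mem: "\<gamma>0 \<in> F 0" using \<gamma>0(1) F0 by simp
      have bdd_F: "bounded {\<gamma> \<in> F 0. c \<bullet> \<gamma> = c \<bullet> \<gamma>0}" using bdd opt by simp
      from perturbed_infimum[where a = a and b = b and e = e and I = I and c = c and \<gamma>s = \<gamma>0
          and \<tau> = "c \<bullet> \<gamma>0" and \<eta> = \<eta>, folded F_def, OF e mem refl inf bdd_F \<open>\<eta> > 0\<close>]
      obtain \<epsilon>0 where \<epsilon>0: "\<epsilon>0 > 0" "\<forall>\<gamma>\<in>F \<epsilon>0. c \<bullet> \<gamma>0 - \<eta> \<le> c \<bullet> \<gamma>"
        by blast
      have "ereal (c \<bullet> \<gamma>0 - \<eta>) \<le> tau \<epsilon>0 l" for l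
        unfolding tau_def tau_relaxed_def
      proof (rule INF_greatest)
        fix \<gamma> assume "\<gamma> \<in> relaxed_gamma \<nu> Y G \<Lambda>\<^sub>0 \<Lambda> \<epsilon>0 l"
        then have "0 \<le> form \<gamma> x u + \<epsilon>0 * e (x, u)" if "x \<in> X" for x u
          using that unfolding form_def e_def d_def X_def prod.case by (rule relaxed_gamma_quadratic_nonneg)
        then have "\<gamma> \<in> F \<epsilon>0" unfolding F_def I_def form by auto
        then show "ereal (c \<bullet> \<gamma>0 - \<eta>) \<le> ereal (c \<bullet> \<gamma>)" using \<epsilon>0(2) by simp
      qed
      then have "ereal (c \<bullet> \<gamma>0 - \<eta>) \<le> \<tau>_inf \<epsilon>0" unfolding \<tau>_inf_def by (intro INF_greatest)
      also have "\<dots> \<le> \<tau>\<^sub>0" unfolding \<tau>\<^sub>0_def by (rule SUP_upper) (use \<epsilon>0(1) in simp)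
      finally have "ereal (c \<bullet> \<gamma>0 - \<eta>) + ereal \<eta> \<le> \<tau>\<^sub>0 + ereal \<eta>" by (rule add_right_mono)
      then show "ereal (c \<bullet> \<gamma>0) \<le> \<tau>\<^sub>0 + ereal \<eta>" by simp
    qed
  qed
  show ?thesis
    using lim_l lim_eps le eq unfolding tau_def X_def
    by (intro exI[of _ \<tau>_inf] exI[of _ \<tau>\<^sub>0]) blast
qed

end
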